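(* Let $k\ge 1$ be an odd integer. For every $x>0$, \begin{align*} \sum_{n=1}^{\infty} D_{k,-1}(n) e^{-nx}=& \frac{1}{2} \log\left( \frac{x}{(2\pi)^k} \right)+\frac{1}{k}\Gamma\left(\frac{1}{k}\right)\zeta\left(1+\frac{1}{k}\right)x^{-\frac{1}{k}} + \frac{\zeta(-k)\,x}{2} \\ & - \sum_{\substack{j=-(k-1)\\ j\equiv k-1 \ (\mathrm{mod}\ 2)}}^{k-1} \sum_{m=1}^\infty \log \left[1- \exp\left(- e^{\frac{i\pi j}{2k}} (2\pi)^{1+\frac{1}{k}} \left( \frac{m}{x} \right)^{\frac{1}{k} } \right) \right]. \end{align*}
   Context: $\zeta$ is the Riemann zeta function and $\Gamma$ the gamma function. For $k\in\mathbb{N}$, $D_{k,-1}(n)=\sum_{d\ge1,\ d^k\mid n}\left(\frac{n}{d^k}\right)^{-1}$. The sum over $j$ runs over $j=-(k-1),-(k-3),\dots,k-3,k-1$; $\log$ denotes the principal branch. *)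

theory Defs
  imports "HOL-Complex_Analysis.Complex_Analysis" "HOL-Number_Theory.Cong"
begin

text \<open>
  The Riemann zeta function: the holomorphic extension to the complex plane without \<open>1\<close> of the
  Dirichlet series \<open>\<Sum>n\<ge>1. n powr (-s)\<close> (\<open>Re s > 1\<close>). By the identity theorem, the normalisation
  at the pole, \<open>f 1 = 0\<close>, makes the function unique.
\<close>

definition zeta :: "complex \<Rightarrow> complex" where
  "zeta = (THE f. f holomorphic_on (- {1}) \<and> f 1 = 0 \<and>
             (\<forall>s. Re s > 1 \<longrightarrow> (\<lambda>n. of_nat (Suc n) powr (- s)) sums f s))"

text \<open>Intended for \<open>k \<ge> 1\<close> and \<open>n \<ge> 1\<close>, where the index set is finite.\<close>

definition D :: "nat \<Rightarrow> int \<Rightarrow> nat \<Rightarrow> real" where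
  "D k r n = (\<Sum>d | d \<ge> 1 \<and> d ^ k dvd n. (real n / real d ^ k) powi r)"

definition log_arg :: "nat \<Rightarrow> real \<Rightarrow> int \<Rightarrow> nat \<Rightarrow> complex" where
  "log_arg k x j m =
     1 - exp (- (exp (\<i> * of_real pi * of_int j / (2 * of_nat k)) *
                 of_real ((2 * pi) powr (1 + 1 / real k) * (real m / x) powr (1 / real k))))"

end

theory Submission
  imports Defs "HOL-Real_Asymp.Real_Asymp"
begin

text \<open>
  The left-hand side equals the sum over \<open>d \<ge> 1\<close> of \<open>- ln (1 - exp (- x d^k))\<close>, to which Poisson
  summation is applied. As \<open>- ln (1 - exp (- x t^k))\<close> is singular at \<open>0\<close>, one first subtracts
  \<open>k/2 ln (1 + 1/t^2)\<close>, whose sum and integral are known; the difference \<open>g\<close> satisfies the first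
  Euler--Maclaurin formula, and it remains to compute the integral of \<open>h = - g'\<close> against the sawtooth
  \<open>frac t - 1/2\<close>, that is, against \<open>Im (Ln (1 - r e^(2 pi i t))) / pi\<close> in the limit \<open>r \<rightarrow> 1\<close>.

  For \<open>r < 1\<close> the integral is rotated from the positive real axis to the ray \<open>arg w = pi/(4k)\<close>, where
  the partial fraction expansion of \<open>1/(e^u - 1)\<close> at \<open>u = x w^k\<close> may be integrated term by term.
  Since \<open>k\<close> is odd, each term is odd, so its imaginary part is half the difference of the integrals
  along the rays \<open>pi/(4k)\<close> and \<open>pi - pi/(4k)\<close>; the residues between these rays, at the \<open>k\<close> roots of
  \<open>w^(2k) = - (2 pi m / x)^2\<close> in the upper half plane, give the logarithms of the right-hand side.
  The polynomial term of the expansion gives \<open>zeta (- k)\<close>.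
\<close>

section \<open>Partial fractions of the cotangent\<close>

text \<open>The damping answers an obstruction: at \<open>r = 1\<close> the kernel has a logarithmic
  singularity at every integer, on the very axis that is to be rotated. For \<open>r < 1\<close> it
  is holomorphic across the real axis and bounded above it, though by a constant that grows as
  \<open>r\<close> tends to 1; only its imaginary part stays below pi/2 uniformly, and this carries
  the limit. The rotation has to come before the expansion. \<open>H\<close> decays like 1/|w|^2
  only as a whole; its terms are of order 1/w or larger and not absolutely integrable on the real
  axis against a kernel that is periodic there. On a tilted ray the kernel decays exponentially. The
  comparison function shares the singularity -k ln t of the summand and has a rational derivative.
  Its share is therefore one more pole, at \<open>\<i>\<close>, open to the same residue argument,
  and in the end all of it cancels except -(k/2) ln (2 pi). As \<open>zeta\<close> is a definite
  description, a continuation must be built before its value at -k means anything. Riemann's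
  integral yields one whose values at the negative odd integers are explicit.\<close>

lemma cot_partial_fractions:
  fixes z :: complex
  assumes z: "z \<notin> \<int>"
  shows "(\<lambda>n. 2 * z / (z\<^sup>2 - of_nat (Suc n) ^ 2)) sums (of_real pi * cot (of_real pi * z) - 1 / z)"
proof -
  have nz: "z \<noteq> 0" using z by auto
  have nz1: "1 - z \<noteq> 0" using z by auto
  have z1: "z \<notin> \<int>\<^sub>\<le>\<^sub>0" using z by (meson nonpos_Ints_Int)
  have z2: "1 - z \<notin> \<int>\<^sub>\<le>\<^sub>0"
  proof
    assume "1 - z \<in> \<int>\<^sub>\<le>\<^sub>0"
    hence "1 - (1 - z) \<in> \<int>" by (intro Ints_diff) (auto dest: nonpos_Ints_Int)
    with z show False by simp
  qed
  have s0: "sin (of_real pi * z) \<noteq> 0"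
  proof
    assume "sin (of_real pi * z) = 0"
    then obtain n :: int where "of_real pi * z = of_real (n * pi)"
      by (metis Complex_Transcendental.sin_eq_0)
    hence "of_real pi * z = of_real pi * of_int n" by (simp add: mult.commute)
    hence "z = of_int n" by (subst (asm) mult_cancel_left) simp
    thus False using z by auto
  qed
  \<comment> \<open>Logarithmic derivative of the reflection formula rGamma z rGamma (1 - z) = sin
    (pi z) / pi: two computations of one derivative are compared.\<close>
  have refl: "Digamma (1 - z) - Digamma z = of_real pi * cot (of_real pi * z)"
  proof -
    have "((\<lambda>z. rGamma z * rGamma (1 - z)) has_field_derivative
            ((- rGamma z * Digamma z) * rGamma (1 - z) +
             (- rGamma (1 - z) * Digamma (1 - z)) * (-1) * rGamma z)) (at z)"
      using z1 z2 by (auto intro!: derivative_eq_intros)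
    moreover have "((\<lambda>z. rGamma z * rGamma (1 - z)) has_field_derivative
             (cos (of_real pi * z))) (at z)"
      unfolding rGamma_reflection_complex by (auto intro!: derivative_eq_intros)
    ultimately have "(- rGamma z * Digamma z) * rGamma (1 - z) +
             (- rGamma (1 - z) * Digamma (1 - z)) * (-1) * rGamma z = cos (of_real pi * z)"
      by (rule DERIV_unique)
    hence "(rGamma z * rGamma (1 - z)) * (Digamma (1 - z) - Digamma z) = cos (of_real pi * z)"
      by (simp add: algebra_simps)
    thus ?thesis unfolding rGamma_reflection_complex using s0 by (simp add: cot_def field_simps)
  qed
  have "(\<lambda>m. (of_real (ln (real m)) - (\<Sum>n<m. inverse (1 - z + of_nat n)))
           - (of_real (ln (real m)) - (\<Sum>n<m. inverse (z + of_nat n)))) \<longlonglongrightarrow> Digamma (1 - z) - Digamma z"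
    by (intro tendsto_diff Digamma_LIMSEQ nz nz1)
  hence A: "(\<lambda>m. (\<Sum>n<m. inverse (z + of_nat n)) - (\<Sum>n<m. inverse (1 - z + of_nat n)))
             \<longlonglongrightarrow> of_real pi * cot (of_real pi * z)"
    by (simp add: refl)
  have B: "(\<lambda>m. inverse (z + of_nat m)) \<longlonglongrightarrow> 0"
    by (intro filterlim_compose[OF tendsto_inverse_0]
              tendsto_add_filterlim_at_infinity[OF tendsto_const] tendsto_of_nat)
  \<comment> \<open>Each term is 1 / (z + n) + 1 / (z - n) with n from 1 to m, while the first
    Digamma sum runs from 0 to m - 1. The shift costs the two end terms, of which 1 / (z + m)
    vanishes in the limit.\<close>
  have eq: "(\<Sum>n<m. 2 * z / (z\<^sup>2 - of_nat (Suc n) ^ 2)) =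
     (\<Sum>n<m. inverse (z + of_nat n)) - (\<Sum>n<m. inverse (1 - z + of_nat n))
       + inverse (z + of_nat m) - 1 / z" for m
  proof (induction m)
    case 0
    show ?case by (simp add: field_simps)
  next
    case (Suc m)
    have "z \<noteq> - of_nat (Suc m)" "z \<noteq> of_nat (Suc m)"
      using z by (metis Ints_minus Ints_of_nat)+
    moreover have "1 - z + of_nat m = of_nat (Suc m) - z" by simp
    ultimately have n: "z + of_nat (Suc m) \<noteq> 0" "1 - z + of_nat m \<noteq> 0" "z - of_nat (Suc m) \<noteq> 0"
      by (metis add_eq_0_iff2, metis eq_iff_diff_eq_0, metis eq_iff_diff_eq_0)
    have "2 * z / (z\<^sup>2 - of_nat (Suc m) ^ 2) = inverse (z + of_nat (Suc m)) + inverse (z - of_nat (Suc m))"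
      using n by (simp add: field_simps power2_eq_square)
    also have "inverse (z - of_nat (Suc m)) = - inverse (1 - z + of_nat m)"
      by (simp add: algebra_simps flip: inverse_minus_eq)
    finally show ?case using Suc by simp
  qed
  show ?thesis unfolding sums_def eq
    using tendsto_diff[OF tendsto_add[OF A B] tendsto_const[of "1 / z"]] by simp
qed

text \<open>With u = 2 pi i z, 1 / (e^u - 1) + 1/2 equals pi cot (pi z) / (2 pi i), so this is the
  cotangent series divided by 2 pi i, with the poles moved from n to 2 pi i n.\<close>

lemma exp_partial_fractions:
  fixes u :: complex
  assumes u: "exp u \<noteq> 1"
  shows "(\<lambda>n. 2 * u / (u\<^sup>2 + of_real (2 * pi * real (Suc n)) ^ 2)) sums
           (1 / (exp u - 1) - 1 / u + 1 / 2)"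
proof -
  define z where "z = u / (2 * of_real pi * \<i>)"
  have u_eq: "u = 2 * of_real pi * \<i> * z" by (simp add: z_def)
  have zni: "z \<notin> \<int>"
  proof
    assume "z \<in> \<int>"
    then obtain n where "z = of_int n" by (auto elim: Ints_cases)
    hence "exp u = 1" unfolding exp_eq_1 by (auto simp: u_eq intro!: exI[of _ n])
    with u show False by simp
  qed
  have u0: "u \<noteq> 0" using u by auto
  have eqt: "2 * z / (z\<^sup>2 - of_nat (Suc n) ^ 2) / (2 * of_real pi * \<i>) =
          2 * u / (u\<^sup>2 + of_real (2 * pi * real (Suc n)) ^ 2)" for n
  proof -
    have "z\<^sup>2 - of_nat (Suc n) ^ 2 \<noteq> 0"
    proof
      assume "z\<^sup>2 - of_nat (Suc n) ^ 2 = 0"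
      hence "z = of_nat (Suc n) \<or> z = - of_nat (Suc n)" by (simp add: power2_eq_iff)
      thus False using zni by (metis Ints_minus Ints_of_nat)
    qed
    then have q0: "q \<noteq> 0" if "q = z\<^sup>2 - of_nat (Suc n) ^ 2" for q using that by simp
    define q where "q = z\<^sup>2 - of_nat (Suc n) ^ 2"
    define c where "c = 2 * of_real pi * \<i>"
    have A: "u\<^sup>2 + of_real (2 * pi * real (Suc n)) ^ 2 = c * c * q"
      by (simp add: u_eq c_def q_def power_mult_distrib algebra_simps power2_eq_square del: of_nat_Suc)
    have "c \<noteq> 0" "u = c * z" by (simp_all add: c_def u_eq)
    hence "2 * z / q / c = 2 * u / (c * c * q)" using q0[OF q_def] by (simp add: field_simps)
    thus ?thesis unfolding A by (simp only: q_def c_def)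
  qed
  have "cot (of_real pi * z) = \<i> * (exp u + 1) / (exp u - 1)"
  proof -
    define e where "e = exp (\<i> * (of_real pi * z))"
    have e0: "e \<noteq> 0" by (simp add: e_def)
    have ee: "exp u = e * e" unfolding e_def u_eq by (simp flip: exp_add add: mult_ac)
    have m: "exp (- (\<i> * (of_real pi * z))) = 1 / e" by (simp add: e_def exp_minus field_simps)
    have n: "e * e - 1 \<noteq> 0" using u ee by simp
    have "cos (of_real pi * z) = (e + 1 / e) / 2" unfolding cos_exp_eq e_def[symmetric] m by simp
    moreover have "sin (of_real pi * z) = (e - 1 / e) / (2 * \<i>)" unfolding sin_exp_eq e_def[symmetric] m by simp
    ultimately have "cot (of_real pi * z) = ((e + 1 / e) / 2) / ((e - 1 / e) / (2 * \<i>))" by (simp only: cot_def)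
    also have "e + 1 / e = (e*e+1)/e" using e0 by (simp add: field_simps)
    also have "e - 1 / e = (e*e-1)/e" using e0 by (simp add: field_simps)
    also have "(p / e / 2) / ((q / e) / (2 * \<i>)) = \<i> * p / q" if "q \<noteq> 0" for p q
      using that e0 by (simp add: field_simps)
    note this[OF n]
    finally show ?thesis by (simp only: ee)
  qed
  moreover have "(of_real pi * (\<i> * (e + 1) / (e - 1)) - 2 * of_real pi * \<i> / u) / (2 * of_real pi * \<i>) =
      1 / (e - 1) - 1 / u + 1 / 2" if "e \<noteq> 1" for e
    using that u0 by (simp add: divide_simps) (simp add: algebra_simps)
  note this[OF u]
  moreover have "1 / z = 2 * of_real pi * \<i> / u" by (simp add: z_def)
  ultimately have "(of_real pi * cot (of_real pi * z) - 1 / z) / (2 * of_real pi * \<i>) = 1 / (exp u - 1) - 1 / u + 1 / 2"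
    by simp
  with sums_divide[OF cot_partial_fractions[OF zni], of "2 * of_real pi * \<i>"]
  show ?thesis by (simp only: eqt)
qed

section \<open>Integration lemmas\<close>

lemma set_integrable_lborel_powr_exp:
  fixes p a :: real
  assumes "p > -1" "a > 0"
  shows "set_integrable lborel {0<..} (\<lambda>t. t powr p * exp (- (a * t)))"
proof -
  have "(\<lambda>t. complex_of_real t powr (of_real (p + 1) - 1) / of_real (exp (a * t))) absolutely_integrable_on {0<..}"
    using assms by (intro absolutely_integrable_Gamma_integral) auto
  hence "set_integrable lebesgue {0<..} (\<lambda>t. norm (complex_of_real t powr (of_real (p + 1) - 1) / of_real (exp (a * t))))"
    by (rule set_integrable_norm)
  also have "?this \<longleftrightarrow> set_integrable lebesgue {0<..} (\<lambda>t. t powr p * exp (- (a * t)))"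
    by (intro set_integrable_cong) (auto simp: norm_divide norm_powr_real_powr exp_minus field_simps)
  finally show ?thesis unfolding set_integrable_def
    by (subst (asm) integrable_completion) auto
qed

lemma set_integrable_Ici_iff_Ioi:
  fixes f :: "real \<Rightarrow> 'a::{banach,second_countable_topology}"
  shows "set_integrable lborel {a..} f \<longleftrightarrow> set_integrable lborel {a<..} f"
  by (rule set_integrable_discrete_difference[of "{a}"]) auto

lemma set_lebesgue_integral_Ici_eq_Ioi:
  fixes f :: "real \<Rightarrow> 'a::{banach,second_countable_topology}"
  shows "(LINT t:{a..}|lborel. f t) = (LINT t:{a<..}|lborel. f t)"
  by (rule set_integral_discrete_difference[of "{a}"]) auto

text \<open>Termwise integration in the form of set integrals; the exchanges of series and integral
  below go through it.\<close>

lemma set_sums_integral: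
  fixes f :: "nat \<Rightarrow> 'b \<Rightarrow> 'a::{banach,second_countable_topology}"
  assumes "\<And>i. set_integrable M A (f i)" "\<And>x. x \<in> A \<Longrightarrow> summable (\<lambda>i. norm (f i x))"
    and "summable (\<lambda>i. LINT x:A|M. norm (f i x))"
  shows "set_integrable M A (\<lambda>x. \<Sum>i. f i x)"
    and "(\<lambda>i. LINT x:A|M. f i x) sums (LINT x:A|M. (\<Sum>i. f i x))"
proof -
  have eq: "(\<Sum>i. indicator A x *\<^sub>R f i x) = indicator A x *\<^sub>R (\<Sum>i. f i x)" for x
    by (cases "x \<in> A") auto
  have 1: "integrable M (\<lambda>x. indicator A x *\<^sub>R f i x)" for i
    using assms(1) unfolding set_integrable_def .
  have 2: "AE x in M. summable (\<lambda>i. norm (indicator A x *\<^sub>R f i x))"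
  proof (rule AE_I2)
    fix x show "summable (\<lambda>i. norm (indicator A x *\<^sub>R f i x))"
      by (cases "x \<in> A") (auto simp: assms(2))
  qed
  have 3: "summable (\<lambda>i. \<integral>x. norm (indicator A x *\<^sub>R f i x) \<partial>M)"
    using assms(3) by (simp add: set_lebesgue_integral_def)
  show "set_integrable M A (\<lambda>x. \<Sum>i. f i x)"
    using integrable_suminf[OF 1 2 3] unfolding eq set_integrable_def .
  show "(\<lambda>i. LINT x:A|M. f i x) sums (LINT x:A|M. (\<Sum>i. f i x))"
    using sums_integral[OF 1 2 3] unfolding eq set_lebesgue_integral_def .
qed

section \<open>Analytic continuation of the zeta function\<close>

text \<open>
  \<open>bern_coeff i\<close> is the coefficient of \<open>t^(2 i + 1)\<close> in \<open>1 / (e^t - 1)\<close>, so it equals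
  \<open>B\<^bsub>2 i + 2\<^esub> / (2 i + 2)!\<close>; the expansion is valid for \<open>0 < t < 2 pi\<close>.
\<close>

definition bern_coeff :: "nat \<Rightarrow> real" where
  "bern_coeff i = 2 * (-1) ^ i * (\<Sum>m. 1 / (2 * pi * real (Suc m)) ^ (2 * i + 2))"

lemma two_pi_Suc_ge: "2 * pi * real (Suc m) \<ge> 2"
proof -
  have "2 * 1 * 1 \<le> 2 * pi * real (Suc m)"
    using pi_ge_two by (intro mult_mono) auto
  thus ?thesis by simp
qed

lemma summable_inverse_two_pi_power:
  assumes "n \<ge> 2"
  shows "summable (\<lambda>m. 1 / (2 * pi * real (Suc m)) ^ n)"
proof -
  have "summable (\<lambda>m. inverse (real m ^ n))"
    using assms by (intro inverse_power_summable) auto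
  hence "summable (\<lambda>m. 1 / (2 * pi) ^ n * inverse (real (Suc m) ^ n))"
    by (intro summable_mult) (subst (asm) summable_Suc_iff[symmetric], simp)
  thus ?thesis by (simp add: power_mult_distrib field_simps del: of_nat_Suc)
qed

text \<open>The crude bound 2 pi m \<ge> 2 already gains a factor 1/4 per index, enough for absolute
  convergence up to t = 1, where the zeta integral is split.\<close>

lemma abs_bern_coeff_le:
  "\<bar>bern_coeff i\<bar> \<le> 2 * (\<Sum>m. 1 / (2 * pi * real (Suc m)) ^ 2) * (1/4) ^ i"
proof -
  have "1 / (2 * pi * real (Suc m)) ^ (2 * i + 2) \<le> 1 / (2 * pi * real (Suc m)) ^ 2 * (1/4) ^ i" for m
  proof -
    define b where "b = 2 * pi * real (Suc m)"
    have b: "b \<ge> 2" unfolding b_def by (rule two_pi_Suc_ge)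
    have "(2\<^sup>2) ^ i \<le> (b\<^sup>2) ^ i" using b by (intro power_mono) auto
    hence "1 / (b\<^sup>2) ^ i \<le> 1 / 4 ^ i" using b by (intro divide_left_mono) auto
    hence "1 / b\<^sup>2 * (1 / (b\<^sup>2) ^ i) \<le> 1 / b\<^sup>2 * (1 / 4 ^ i)" by (intro mult_left_mono) auto
    moreover have "b ^ (2 * i + 2) = b\<^sup>2 * (b\<^sup>2) ^ i" by (metis power_add power_mult mult.commute)
    ultimately show ?thesis unfolding b_def[symmetric] by (simp add: power_one_over)
  qed
  hence "(\<Sum>m. 1 / (2 * pi * real (Suc m)) ^ (2 * i + 2)) \<le>
      (\<Sum>m. 1 / (2 * pi * real (Suc m)) ^ 2 * (1/4) ^ i)"
    by (intro suminf_le summable_mult2 summable_inverse_two_pi_power) auto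
  also have "\<dots> = (\<Sum>m. 1 / (2 * pi * real (Suc m)) ^ 2) * (1/4) ^ i"
    by (intro suminf_mult2[symmetric] summable_inverse_two_pi_power) auto
  moreover have "(\<Sum>m. 1 / (2 * pi * real (Suc m)) ^ (2 * i + 2)) \<ge> 0"
    by (intro suminf_nonneg summable_inverse_two_pi_power) auto
  ultimately show ?thesis by (simp add: bern_coeff_def abs_mult power_abs)
qed

lemma summable_bern_coeff: "summable (\<lambda>i. \<bar>bern_coeff i\<bar>)"
proof (rule summable_comparison_test)
  show "\<exists>N. \<forall>n\<ge>N. norm \<bar>bern_coeff n\<bar> \<le> 2 * (\<Sum>m. 1 / (2 * pi * real (Suc m)) ^ 2) * (1/4) ^ n"
    using abs_bern_coeff_le by auto
  show "summable (\<lambda>n. 2 * (\<Sum>m. 1 / (2 * pi * real (Suc m)) ^ 2) * (1/4) ^ n)"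
    by (intro summable_mult summable_geometric) auto
qed

text \<open>Each partial fraction 2 t / (t^2 + b^2) is a geometric series of ratio -t^2 / b^2, of
  modulus at most 1/4. Truncating it after N terms, for all m at once, needs only the exchange of a
  finite sum with a series, and the remainders add up to at most S / 4^N.\<close>

lemma bern_coeff_sums:
  fixes t :: real
  assumes t: "0 < t" "t \<le> 1"
  shows "(\<lambda>i. bern_coeff i * t ^ (2 * i + 1)) sums (1 / (exp t - 1) - 1 / t + 1 / 2)"
proof -
  define b where "b = (\<lambda>m. 2 * pi * real (Suc m))"
  define S where "S = 1 / (exp t - 1) - 1 / t + 1 / 2"
  have b: "b m \<ge> 2" for m unfolding b_def by (rule two_pi_Suc_ge)
  have S: "(\<lambda>m. 2 * t / (t\<^sup>2 + b m ^ 2)) sums S"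
  proof -
    have "exp (complex_of_real t) \<noteq> 1" 
      using t by (metis exp_of_real exp_eq_one_iff of_real_eq_1_iff less_irrefl)
    from exp_partial_fractions[OF this]
    have "(\<lambda>m. complex_of_real (2 * t / (t\<^sup>2 + b m ^ 2))) sums of_real S"
      by (simp add: b_def S_def exp_of_real)
    thus ?thesis by (simp only: sums_of_real_iff)
  qed
  define q where "q = (\<lambda>m. - (t\<^sup>2 / b m ^ 2))"
  have q: "\<bar>q m\<bar> \<le> 1/4" for m
  proof -
    have "t\<^sup>2 \<le> 1" using t by (simp add: power_le_one)
    moreover have "b m ^ 2 \<ge> 2 ^ 2" using b[of m] by (intro power_mono) auto
    ultimately have "t\<^sup>2 / b m ^ 2 \<le> 1 / 4" by (intro frac_le) auto
    thus ?thesis by (simp add: q_def)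
  qed
  have geo: "(\<Sum>i<N. 2 * (-1) ^ i * t ^ (2 * i + 1) * (1 / b m ^ (2 * i + 2))) =
     2 * t / (t\<^sup>2 + b m ^ 2) - 2 * t / (t\<^sup>2 + b m ^ 2) * q m ^ N" for N m
  proof -
    have b0: "b m > 0" using b[of m] by simp
    have q1: "q m \<noteq> 1" using q[of m] by auto
    have "(\<Sum>i<N. 2 * (-1) ^ i * t ^ (2 * i + 1) * (1 / b m ^ (2 * i + 2))) = (\<Sum>i<N. 2 * t / b m ^ 2 * q m ^ i)"
    proof (rule sum.cong)
      fix i
      have "q m ^ i = (-1) ^ i * ((t ^ (2 * i)) / b m ^ (2 * i))"
        unfolding q_def by (subst power_minus) (simp add: power_divide power_mult)
      thus "2 * (-1) ^ i * t ^ (2 * i + 1) * (1 / b m ^ (2 * i + 2)) = 2 * t / b m ^ 2 * q m ^ i"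
        using b0 by (simp add: power_add field_simps power2_eq_square)
    qed auto
    also have "\<dots> = 2 * t / b m ^ 2 * ((1 - q m ^ N) / (1 - q m))"
      unfolding sum_distrib_left[symmetric] using q1 by (simp add: sum_gp_strict)
    also have "\<dots> = 2 * t / (b m ^ 2 * (1 - q m)) * (1 - q m ^ N)" by simp
    also have "b m ^ 2 * (1 - q m) = t\<^sup>2 + b m ^ 2"
      using b0 by (simp add: q_def field_simps)
    finally show ?thesis by (simp only: right_diff_distrib mult_1_right)
  qed
  have partial: "(\<lambda>m. \<Sum>i<N. 2 * (-1) ^ i * t ^ (2 * i + 1) * (1 / b m ^ (2 * i + 2))) sums
       (\<Sum>i<N. bern_coeff i * t ^ (2 * i + 1))" for N
  proof (rule sums_sum)
    fix i
    have "(\<lambda>m. 1 / b m ^ (2 * i + 2)) sums (\<Sum>m. 1 / b m ^ (2 * i + 2))"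
      unfolding b_def by (intro summable_sums summable_inverse_two_pi_power) auto
    from sums_mult[OF this, of "2 * (-1) ^ i * t ^ (2 * i + 1)"]
    show "(\<lambda>m. 2 * (-1) ^ i * t ^ (2 * i + 1) * (1 / b m ^ (2 * i + 2))) sums (bern_coeff i * t ^ (2 * i + 1))"
      by (simp add: bern_coeff_def b_def mult_ac)
  qed
  have bound: "\<bar>S - (\<Sum>i<N. bern_coeff i * t ^ (2 * i + 1))\<bar> \<le> S * (1/4) ^ N" for N
  proof -
    have A: "(\<lambda>m. 2 * t / (t\<^sup>2 + b m ^ 2) * q m ^ N) sums (S - (\<Sum>i<N. bern_coeff i * t ^ (2 * i + 1)))"
      using sums_diff[OF S partial[of N]] unfolding geo by simp
    have B: "(\<lambda>m. 2 * t / (t\<^sup>2 + b m ^ 2) * (1/4) ^ N) sums (S * (1/4) ^ N)"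
      by (intro sums_mult2 S)
    have le: "\<bar>2 * t / (t\<^sup>2 + b m ^ 2) * q m ^ N\<bar> \<le> 2 * t / (t\<^sup>2 + b m ^ 2) * (1/4) ^ N" for m
    proof -
      have "\<bar>q m ^ N\<bar> \<le> (1/4) ^ N" unfolding power_abs by (intro power_mono q) auto
      thus ?thesis using t by (simp add: abs_mult mult_left_mono divide_right_mono)
    qed
    have "norm (\<Sum>m. 2 * t / (t\<^sup>2 + b m ^ 2) * q m ^ N) \<le> (\<Sum>m. 2 * t / (t\<^sup>2 + b m ^ 2) * (1/4) ^ N)"
      using B le by (intro norm_suminf_le) (auto simp: sums_iff)
    thus ?thesis using A B by (simp add: sums_iff)
  qed
  have "(\<lambda>N. S - (\<Sum>i<N. bern_coeff i * t ^ (2 * i + 1))) \<longlonglongrightarrow> 0"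
  proof (rule tendsto_0_le[where K = 1])
    show "(\<lambda>N. S * (1/4) ^ N) \<longlonglongrightarrow> 0" by (intro tendsto_mult_right_zero LIMSEQ_realpow_zero) auto
    show "\<forall>\<^sub>F N in sequentially. norm (S - (\<Sum>i<N. bern_coeff i * t ^ (2 * i + 1))) \<le> norm (S * (1/4) ^ N) * 1"
    proof (intro always_eventually allI)
      fix N
      have "\<bar>S - (\<Sum>i<N. bern_coeff i * t ^ (2 * i + 1))\<bar> \<le> \<bar>S * (1/4) ^ N\<bar>"
        using bound[of N] by linarith
      thus "norm (S - (\<Sum>i<N. bern_coeff i * t ^ (2 * i + 1))) \<le> norm (S * (1/4) ^ N) * 1"
        by (simp only: real_norm_def mult_1_right)
    qed
  qed
  from tendsto_diff[OF tendsto_const[of S] this] show ?thesis unfolding sums_def S_def[symmetric] by simp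
qed

lemma Gamma_integral_scaled:
  fixes s :: complex and a :: real
  assumes s: "Re s > 0" and a: "a > 0"
  shows "set_integrable lborel {0<..} (\<lambda>t. of_real t powr (s - 1) * of_real (exp (- (a * t))))"
    and "(LINT t:{0<..}|lborel. of_real t powr (s - 1) * of_real (exp (- (a * t)))) = Gamma s * of_real a powr (- s)"
proof -
  have int: "set_integrable lborel {0<..} (\<lambda>t. of_real t powr (s - 1) * of_real (exp (- (a * t))))" if "a > 0" for a
  proof -
    have "(\<lambda>t. complex_of_real t powr (s - 1) / of_real (exp (a * t))) absolutely_integrable_on {0<..}"
      using s that by (intro absolutely_integrable_Gamma_integral) auto
    hence "set_integrable lebesgue {0<..} (\<lambda>t. complex_of_real t powr (s - 1) * of_real (exp (- (a * t))))"
      by (simp add: exp_minus field_simps)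
    thus ?thesis unfolding set_integrable_def
      by (subst (asm) integrable_completion) auto
  qed
  show "set_integrable lborel {0<..} (\<lambda>t. of_real t powr (s - 1) * of_real (exp (- (a * t))))"
    by (rule int) fact
  have one: "(LINT t:{0<..}|lborel. of_real t powr (s - 1) * of_real (exp (- (1 * t)))) = Gamma s"
  proof -
    have "((\<lambda>t. of_real t powr (s - 1) * of_real (exp (- (1 * t)))) has_integral Gamma s) {0<..}"
      using Gamma_integral_complex'[OF s] by (simp add: exp_minus field_simps)
    thus ?thesis using set_borel_integral_eq_integral(2)[OF int[of 1]] by (simp add: integral_unique)
  qed
  have p: "complex_of_real (a * t) powr (s - 1) = of_real a powr (s - 1) * of_real t powr (s - 1)" if "t > 0" for t
  proof -
    have "Ln (complex_of_real (a * t)) = of_real (ln a) + of_real (ln t)"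
      using a that by (subst Ln_of_real) (auto simp: ln_mult)
    thus ?thesis using a that by (simp add: powr_def Ln_of_real exp_add[symmetric] algebra_simps del: of_real_mult)
  qed
  have "Gamma s = (LINT t|lborel. indicator {0<..} t *\<^sub>R (complex_of_real t powr (s - 1) * of_real (exp (- (1 * t)))))"
    using one by (simp add: set_lebesgue_integral_def)
  also have "\<dots> = a *\<^sub>R (LINT t|lborel. indicator {0<..} (0 + a * t) *\<^sub>R (complex_of_real (0 + a * t) powr (s - 1) * of_real (exp (- (1 * (0 + a * t))))))"
    using a by (subst lborel_integral_real_affine[of a _ 0]) auto
  also have "(LINT t|lborel. indicator {0<..} (0 + a * t) *\<^sub>R (complex_of_real (0 + a * t) powr (s - 1) * of_real (exp (- (1 * (0 + a * t)))))) =
     (LINT t:{0<..}|lborel. of_real a powr (s - 1) * (complex_of_real t powr (s - 1) * of_real (exp (- (a * t)))))"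
    using a unfolding set_lebesgue_integral_def by (intro Bochner_Integration.integral_cong) (auto simp: indicator_def p zero_less_mult_iff simp del: of_real_mult)
  also have "\<dots> = of_real a powr (s - 1) * (LINT t:{0<..}|lborel. complex_of_real t powr (s - 1) * of_real (exp (- (a * t))))"
    by simp
  finally have "Gamma s = (of_real a * of_real a powr (s - 1)) * (LINT t:{0<..}|lborel. complex_of_real t powr (s - 1) * of_real (exp (- (a * t))))"
    by (simp add: scaleR_conv_of_real)
  also have "of_real a * of_real a powr (s - 1) = of_real a powr s"
    using a by (simp add: powr_def exp_diff Ln_of_real algebra_simps flip: exp_of_real) (simp add: exp_of_real)
  finally show "(LINT t:{0<..}|lborel. of_real t powr (s - 1) * of_real (exp (- (a * t)))) = Gamma s * of_real a powr (- s)"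
    using a by (simp add: powr_minus field_simps)
qed

lemma powr_exp_integral:
  fixes a p :: real
  assumes a: "a > 0" and p: "p > 0"
  shows "(LINT t:{0<..}|lborel. t powr (p - 1) * exp (- (a * t))) = Gamma p * a powr (- p)"
proof -
  have "complex_of_real (LINT t:{0<..}|lborel. t powr (p - 1) * exp (- (a * t))) =
      (LINT t:{0<..}|lborel. complex_of_real (t powr (p - 1) * exp (- (a * t))))"
    by (rule set_integral_complex_of_real[symmetric])
  also have "\<dots> = (LINT t:{0<..}|lborel. complex_of_real t powr (of_real p - 1) * of_real (exp (- (a * t))))"
    by (rule set_lebesgue_integral_cong) (auto simp: powr_Reals_eq)
  also have "\<dots> = Gamma (of_real p) * of_real a powr (- of_real p)"
    using a p by (intro Gamma_integral_scaled(2)) auto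
  also have "\<dots> = of_real (Gamma p * a powr (- p))"
    using a by (simp add: Gamma_complex_of_real powr_Reals_eq)
  finally show ?thesis by (simp only: of_real_eq_iff)
qed

lemma set_integrable_powr_unit_interval:
  fixes p :: real
  assumes "p > -1"
  shows "set_integrable lborel {0<..<1} (\<lambda>t. t powr p)"
proof (rule set_integrable_bound)
  \<comment> \<open>On (0, 1) the factor exp 1 * exp (-t) is at least 1, so the Gamma integrand
    dominates.\<close>
  show "set_integrable lborel {0<..<1} (\<lambda>t. exp 1 * (t powr p * exp (- (1 * t))))"
    by (intro set_integrable_mult_right set_integrable_subset[OF set_integrable_lborel_powr_exp] assms) auto
  show "set_borel_measurable lborel {0<..<1} (\<lambda>t. t powr p)"
    by (auto simp: set_borel_measurable_def)
  show "AE t in lborel. t \<in> {0<..<1} \<longrightarrow> norm (t powr p) \<le> norm (exp 1 * (t powr p * exp (- (1 * t))))"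
  proof (intro AE_I2 impI)
    fix t :: real assume "t \<in> {0<..<1}"
    hence "t powr p * 1 \<le> t powr p * (exp 1 * exp (- (1 * t)))"
      by (intro mult_left_mono) (auto simp flip: exp_add)
    thus "norm (t powr p) \<le> norm (exp 1 * (t powr p * exp (- (1 * t))))"
      by (simp add: mult_ac)
  qed
qed

lemma powr_unit_interval_integral:
  fixes a :: complex
  assumes a: "Re a > 0"
  shows "set_integrable lborel {0<..<1} (\<lambda>t. of_real t powr (a - 1))"
    and "(LINT t:{0<..<1}|lborel. of_real t powr (a - 1)) = 1 / a"
proof -
  have "a \<noteq> 0" using a by auto
  show int: "set_integrable lborel {0<..<1} (\<lambda>t. of_real t powr (a - 1))"
  proof (rule set_integrable_bound)
    show "set_integrable lborel {0<..<1} (\<lambda>t. t powr (Re a - 1))"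
      using a by (intro set_integrable_powr_unit_interval) auto
    show "set_borel_measurable lborel {0<..<1} (\<lambda>t. complex_of_real t powr (a - 1))"
      by (auto simp: set_borel_measurable_def)
    show "AE t in lborel. t \<in> {0<..<1} \<longrightarrow> norm (complex_of_real t powr (a - 1)) \<le> norm (t powr (Re a - 1))"
      by (auto simp: norm_powr_real_powr)
  qed
  have "((\<lambda>t. complex_of_real t powr (a - 1)) has_integral (of_real 1 powr a / a - of_real 0 powr a / a)) {0..1}"
    using a \<open>a \<noteq> 0\<close> by (intro fundamental_theorem_of_calculus_interior)
      (auto intro!: continuous_intros derivative_eq_intros has_vector_derivative_real_field)
  hence "((\<lambda>t. complex_of_real t powr (a - 1)) has_integral (1 / a)) {0..1}"
    using \<open>a \<noteq> 0\<close> by simp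
  hence "((\<lambda>t. complex_of_real t powr (a - 1)) has_integral (1 / a)) {0<..<1}"
    by (simp add: has_integral_Icc_iff_Ioo)
  thus "(LINT t:{0<..<1}|lborel. of_real t powr (a - 1)) = 1 / a"
    using set_borel_integral_eq_integral(2)[OF int] by (simp add: integral_unique)
qed

text \<open>The power of \<open>t\<close> is written with \<open>exp\<close>, which makes the
  integrand differentiable in \<open>s\<close> and jointly continuous by the standard rules.\<close>

definition zeta_tail :: "complex \<Rightarrow> complex" where
  "zeta_tail s = (LINT t:{1..}|lborel. exp ((s - 1) * of_real (ln t)) / of_real (exp t - 1))"

text \<open>
  Riemann's splitting of \<open>\<integral> t^(s-1) / (e^t - 1)\<close> at \<open>1\<close>, with the integrand expanded on \<open>(0, 1)\<close>: the series
  term stands for \<open>rGamma s * bern_coeff i / (s + 2 i + 1)\<close>, written so that it is visibly entire.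
\<close>

definition zeta_term :: "nat \<Rightarrow> complex \<Rightarrow> complex" where
  "zeta_term i s = of_real (bern_coeff i) * (pochhammer s (2 * i + 1) * rGamma (s + of_nat (2 * i + 2)))"

text \<open>The first two terms integrate the parts 1/t and -1/2 of the expansion. The second would
  be rGamma s / (2 s); as rGamma (s + 1) / 2 it has no apparent pole at 0, so that 1 is the only
  point left out.\<close>

definition zeta_ext :: "complex \<Rightarrow> complex" where
  "zeta_ext s = rGamma s / (s - 1) - rGamma (s + 1) / 2
     + (\<Sum>i. zeta_term i s)
     + rGamma s * zeta_tail s"

text \<open>The majorant depends on \<open>s\<close> only through an upper bound of its real part,
  so it serves a whole disc at once.\<close>

lemma expm1_bound:
  assumes "1 \<le> t" "Re s \<le> R"
  shows "norm (exp ((s - 1) * of_real (ln t)) / of_real (exp t - 1)) \<le> 2 * (t powr \<bar>R\<bar> * exp (- (1 * t)))"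
proof -
  have "exp t \<ge> 2" using exp_ge_add_one_self[of t] assms by linarith
  hence e: "exp t - 1 \<ge> exp t / 2" "exp t - 1 > 0" by linarith+
  have "norm (exp ((s - 1) * of_real (ln t)) / of_real (exp t - 1)) = exp ((Re s - 1) * ln t) / (exp t - 1)"
    using e by (simp add: norm_divide del: of_real_diff)
  also have "\<dots> \<le> t powr \<bar>R\<bar> / (exp t / 2)"
  proof (intro frac_le)
    have "(Re s - 1) * ln t \<le> \<bar>R\<bar> * ln t" using assms by (intro mult_right_mono) auto
    thus "exp ((Re s - 1) * ln t) \<le> t powr \<bar>R\<bar>" using assms by (simp add: powr_def)
  qed (use e in auto)
  finally show ?thesis by (simp add: exp_minus field_simps)
qed

lemma zeta_tail_set_integrable_bound:
  "set_integrable lborel {1..} (\<lambda>t. 2 * (t powr \<bar>R\<bar> * exp (- (1 * t))) :: real)"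
  by (intro set_integrable_mult_right set_integrable_subset[OF set_integrable_lborel_powr_exp]) auto

lemma zeta_tail_set_integrable:
  fixes s :: complex
  shows
  "set_integrable lborel {1..} (\<lambda>t. exp ((s - 1) * of_real (ln t)) / of_real (exp t - 1))"
proof (rule set_integrable_bound[OF zeta_tail_set_integrable_bound[of "Re s"]])
  show "set_borel_measurable lborel {1..} (\<lambda>t. exp ((s - 1) * of_real (ln t)) / of_real (exp t - 1))"
    by (simp add: set_borel_measurable_def)
  show "AE t in lborel. t \<in> {1..} \<longrightarrow> norm (exp ((s - 1) * of_real (ln t)) / of_real (exp t - 1))
           \<le> norm (2 * (t powr \<bar>Re s\<bar> * exp (- (1 * t))))"
    using expm1_bound[of _ s "Re s"] by (auto intro!: AE_I2 simp del: of_real_diff)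
qed

text \<open>Over [1, 1 + n] one may differentiate under the integral; by the common majorant these
  truncations converge uniformly on unit discs, and locally uniform limits of holomorphic functions
  are holomorphic.\<close>

lemma zeta_tail_holomorphic: "zeta_tail holomorphic_on UNIV"
proof (rule holomorphic_uniform_sequence)
  define f where "f = (\<lambda>(s::complex) t. exp ((s - 1) * complex_of_real (ln t)) / of_real (exp t - 1))"
  fix n :: nat
  have eq: "(LINT t:{1..1 + real n}|lborel. f s t) = integral (cbox 1 (1 + real n)) (f s)" for s
  proof -
    have "set_integrable lborel {1..1 + real n} (f s)" unfolding f_def
      by (rule set_integrable_subset[OF zeta_tail_set_integrable]) auto
    from set_borel_integral_eq_integral(2)[OF this] show ?thesis by simp
  qed
  show "(\<lambda>s. LINT t:{1..1 + real n}|lborel. f s t) holomorphic_on UNIV"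
    unfolding eq
  proof (rule leibniz_rule_holomorphic)
    fix s t assume "t \<in> cbox 1 (1 + real n)"
    thus "((\<lambda>s. f s t) has_field_derivative of_real (ln t) * f s t) (at s within UNIV)"
      unfolding f_def by (auto intro!: derivative_eq_intros)
  next
    fix s
    have "continuous_on (cbox 1 (1 + real n)) (f s)"
      unfolding f_def by (auto intro!: continuous_intros)
    thus "f s integrable_on cbox 1 (1 + real n)" by (rule integrable_continuous)
  next
    show "continuous_on (UNIV \<times> cbox 1 (1 + real n)) (\<lambda>(s, t). of_real (ln t) * f s t)"
      unfolding f_def case_prod_unfold by (auto intro!: continuous_intros)
  qed auto
next
  define f where "f = (\<lambda>(s::complex) t. exp ((s - 1) * complex_of_real (ln t)) / of_real (exp t - 1))"
  fix s :: complex
  have "uniform_limit (cball s 1) (\<lambda>b s. LINT t:{1..b}|lborel. f s t) (\<lambda>s. LINT t:{1..}|lborel. f s t) at_top"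
  proof (rule uniform_limit_set_lebesgue_integral_at_top)
    fix x t assume x: "x \<in> cball s 1" and t: "1 \<le> (t::real)"
    have "Re x \<le> norm s + 1"
      using x complex_Re_le_cmod[of x] norm_triangle_sub[of x s] by (auto simp: dist_norm norm_minus_commute)
    thus "norm (f x t) \<le> 2 * (t powr \<bar>norm s + 1\<bar> * exp (- (1 * t)))" unfolding f_def by (rule expm1_bound[OF t])
  next
    fix x show "set_borel_measurable lborel {1..} (f x)" unfolding f_def
      by (simp add: set_borel_measurable_def)
  next
    show "set_integrable lborel {1..} (\<lambda>t. 2 * (t powr \<bar>norm s + 1\<bar> * exp (- (1 * t))))"
      by (rule zeta_tail_set_integrable_bound)
  qed auto
  hence "uniform_limit (cball s 1) (\<lambda>n s. LINT t:{1..1 + real n}|lborel. f s t) (\<lambda>s. LINT t:{1..}|lborel. f s t) sequentially"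
    by (rule filterlim_compose) (auto intro!: filterlim_tendsto_add_at_top filterlim_real_sequentially)
  thus "\<exists>d>0. cball s d \<subseteq> UNIV \<and> uniform_limit (cball s d) (\<lambda>n s. LINT t:{1..1 + real n}|lborel.
         exp ((s - 1) * complex_of_real (ln t)) / of_real (exp t - 1)) zeta_tail sequentially"
    unfolding f_def zeta_tail_def[abs_def] by (intro exI[of _ 1]) auto
qed auto

text \<open>Multiplying the Gamma factor of a term by s + 2 i + 1 gives rGamma s. Where that number
  has modulus at least 1, the factor is thus bounded by the maximum of |rGamma| on the disc, and the
  Weierstrass test applies to all but finitely many terms.\<close>

lemma zeta_ext_series_holomorphic:
  "(\<lambda>s. \<Sum>i. zeta_term i s) holomorphic_on UNIV"
proof (rule holomorphic_uniform_sequence)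
  fix n :: nat
  show "(\<lambda>s. \<Sum>i<n. zeta_term i s) holomorphic_on UNIV"
    unfolding zeta_term_def pochhammer_prod by (intro holomorphic_intros)
next
  fix x :: complex
  have "compact (rGamma ` cball x 1)"
    by (intro compact_continuous_image holomorphic_on_imp_continuous_on holomorphic_intros compact_cball)
  then obtain M where M: "\<And>s. s \<in> cball x 1 \<Longrightarrow> norm (rGamma s) \<le> M"
    by (meson compact_imp_bounded bounded_iff imageI)
  have "uniform_limit (cball x 1) (\<lambda>n s. \<Sum>i<n. zeta_term i s)
          (\<lambda>s. \<Sum>i. zeta_term i s) sequentially"
  proof (rule Weierstrass_m_test_ev)
    show "\<forall>\<^sub>F i in sequentially. \<forall>s\<in>cball x 1. norm (zeta_term i s) \<le> \<bar>bern_coeff i\<bar> * M"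
      \<comment> \<open>From here on |s| \<le> |x| + 1 \<le> i on the disc, hence |s + 2 i + 1|
        \<ge> i + 1.\<close>
      using eventually_ge_at_top[of "nat \<lceil>norm x\<rceil> + 1"]
    proof eventually_elim
      case (elim i)
      hence i: "real i \<ge> norm x + 1" by linarith
      show ?case
      proof
        fix s assume s: "s \<in> cball x 1"
        have "norm s \<le> norm x + 1"
          using s norm_triangle_sub[of s x] by (auto simp: dist_norm norm_minus_commute)
        moreover have "norm (s + of_nat (2 * i + 1)) \<ge> real (2 * i + 1) - norm s"
          using norm_diff_ineq[of "of_nat (2 * i + 1)" s] by (simp add: add.commute del: of_nat_add of_nat_mult of_nat_Suc)
        ultimately have n1: "norm (s + of_nat (2 * i + 1)) \<ge> 1" using i by simp
        have "rGamma s = pochhammer s (2 * i + 2) * rGamma (s + of_nat (2 * i + 2))"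
          by (rule pochhammer_rGamma)
        also have "pochhammer s (2 * i + 2) = pochhammer s (2 * i + 1) * (s + of_nat (2 * i + 1))"
          by (simp add: pochhammer_rec' mult.commute)
        finally have "norm (pochhammer s (2 * i + 1) * rGamma (s + of_nat (2 * i + 2))) * norm (s + of_nat (2 * i + 1)) = norm (rGamma s)"
          by (simp add: norm_mult mult_ac)
        moreover have "norm (pochhammer s (2 * i + 1) * rGamma (s + of_nat (2 * i + 2))) * 1 \<le>
            norm (pochhammer s (2 * i + 1) * rGamma (s + of_nat (2 * i + 2))) * norm (s + of_nat (2 * i + 1))"
          by (rule mult_left_mono[OF n1]) auto
        ultimately have "norm (pochhammer s (2 * i + 1) * rGamma (s + of_nat (2 * i + 2))) \<le> M"
          using M[OF s] by linarith
        thus "norm (zeta_term i s) \<le> \<bar>bern_coeff i\<bar> * M"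
          unfolding zeta_term_def norm_mult[of "of_real _"] norm_of_real by (rule mult_left_mono) auto
      qed
    qed
    show "summable (\<lambda>i. \<bar>bern_coeff i\<bar> * M)" by (intro summable_mult2 summable_bern_coeff)
  qed
  thus "\<exists>d>0. cball x d \<subseteq> UNIV \<and> uniform_limit (cball x d)
     (\<lambda>n s. \<Sum>i<n. zeta_term i s)
          (\<lambda>s. \<Sum>i. zeta_term i s) sequentially"
    by (intro exI[of _ 1]) auto
qed auto

lemma zeta_ext_holomorphic: "zeta_ext holomorphic_on (- {1})"
proof -
  have "(\<lambda>s. \<Sum>i. zeta_term i s) holomorphic_on (-{1})"
    using zeta_ext_series_holomorphic holomorphic_on_subset by blast
  moreover have "zeta_tail holomorphic_on (-{1})"
    using zeta_tail_holomorphic holomorphic_on_subset by blast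
  ultimately show ?thesis unfolding zeta_ext_def[abs_def]
    by (intro holomorphic_intros) auto
qed

text \<open>Every \<open>rGamma\<close> at a non-positive integer vanishes, which removes the terms
  outside the series and those with index below \<open>i\<close>. Above \<open>i\<close> the
  Pochhammer symbol contains the factor 0. The term \<open>i\<close> remains, with pochhammer (-k) k
  = - k! for the odd k = 2 i + 1.\<close>

lemma zeta_ext_minus_odd:
  "zeta_ext (- of_nat (2 * i + 1)) = - of_real (fact (2 * i + 1) * bern_coeff i)"
proof -
  define k where "k = 2 * i + 1"
  have r0: "rGamma (- of_nat n :: complex) = 0" for n by (simp add: rGamma_eq_zero_iff)
  have "(- of_nat k :: complex) + 1 = - of_nat (2 * i)" by (simp add: k_def)
  hence r1: "rGamma (- of_nat k + 1 :: complex) = 0" by (metis r0)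
  have tm: "zeta_term j (- of_nat k) =
       (if j = i then - of_real (fact k * bern_coeff i) else (0 :: complex))" for j
  proof -
    consider "j = i" | "j > i" | "j < i" by linarith
    thus ?thesis
    proof cases
      case 1
      have "pochhammer (- of_nat k :: complex) k = - fact k"
        unfolding pochhammer_same by (simp add: k_def)
      moreover have "- of_nat k + of_nat (2 * i + 2) = (1 :: complex)" by (simp add: k_def)
      moreover have "2 * j + 1 = k" using 1 by (simp add: k_def)
      ultimately show ?thesis using 1 by (simp add: zeta_term_def del: of_nat_add of_nat_mult)
    next
      case 2
      hence "pochhammer (- of_nat k :: complex) (2 * j + 1) = 0"
        by (subst pochhammer_of_nat_eq_0_iff) (simp add: k_def)
      thus ?thesis using 2 by (simp add: zeta_term_def)
    next
      case 3
      hence "(- of_nat k + of_nat (2 * j + 2) :: complex) = - of_nat (k - (2 * j + 2))"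
        by (subst of_nat_diff) (auto simp: k_def)
      hence "rGamma (- of_nat k + of_nat (2 * j + 2) :: complex) = 0" by (metis r0)
      thus ?thesis using 3 by (simp add: zeta_term_def del: of_nat_add of_nat_mult)
    qed
  qed
  have "(\<Sum>j. zeta_term j (- of_nat k)) =
         - complex_of_real (fact k * bern_coeff i)"
    unfolding tm by (subst suminf_finite[of "{i}"]) auto
  hence "zeta_ext (- of_nat k) = - complex_of_real (fact k * bern_coeff i)"
    unfolding zeta_ext_def r0 r1 by simp
  thus ?thesis unfolding k_def .
qed

text \<open>The expansion holds on all of (0, 1), and |t^(s + 2 i)| \<le> 1 there, so the summable
  coefficients themselves dominate.\<close>

lemma zeta_ext_integral_unit_interval:
  fixes s :: complex
  assumes s: "Re s > 1"
  shows "set_integrable lborel {0<..<1} (\<lambda>t. of_real t powr (s - 1) / of_real (exp t - 1))"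
    and "(LINT t:{0<..<1}|lborel. of_real t powr (s - 1) / of_real (exp t - 1)) =
          1 / (s - 1) - 1 / (2 * s) + (\<Sum>i. of_real (bern_coeff i) / (s + of_nat (2 * i + 1)))"
proof -
  define g where "g = (\<lambda>i t. of_real (bern_coeff i) * complex_of_real t powr (s + of_nat (2 * i + 1) - 1))"
  have Re_pos: "Re (s + of_nat (2 * i + 1)) > 0" for i using s by simp
  have gi: "set_integrable lborel {0<..<1} (g i)" for i
    unfolding g_def by (intro set_integrable_mult_right powr_unit_interval_integral Re_pos)
  have gv: "(LINT t:{0<..<1}|lborel. g i t) = of_real (bern_coeff i) / (s + of_nat (2 * i + 1))" for i
    unfolding g_def set_integral_mult_right powr_unit_interval_integral(2)[OF Re_pos] by simp
  have ng: "norm (g i t) \<le> \<bar>bern_coeff i\<bar>" if "t \<in> {0<..<1}" for i t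
  proof -
    have "norm (complex_of_real t powr (s + of_nat (2 * i + 1) - 1)) = t powr Re (s + of_nat (2 * i + 1) - 1)"
      using that by (subst norm_powr_real_powr) auto
    also have "\<dots> \<le> 1" using that s by (intro powr_le1) auto
    finally show ?thesis unfolding g_def norm_mult by (simp add: mult_left_le del: of_nat_add of_nat_mult)
  qed
  have s2: "summable (\<lambda>i. norm (g i t))" if "t \<in> {0<..<1}" for t
    by (rule summable_comparison_test[OF _ summable_bern_coeff]) (use ng[OF that] in auto)
  have s3: "summable (\<lambda>i. LINT t:{0<..<1}|lborel. norm (g i t))"
  proof (rule summable_comparison_test[OF _ summable_bern_coeff], intro exI allI impI)
    fix i
    have "(LINT t:{0<..<1}|lborel. norm (g i t)) \<le> (LINT t:{0<..<1::real}|lborel. \<bar>bern_coeff i\<bar>)"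
      by (intro set_integral_mono set_integrable_norm gi ng) (auto simp: set_integrable_def)
    also have "\<dots> = \<bar>bern_coeff i\<bar>" by (simp add: set_lebesgue_integral_def)
    finally show "norm (LINT t:{0<..<1}|lborel. norm (g i t)) \<le> \<bar>bern_coeff i\<bar>"
      by (simp add: set_lebesgue_integral_def Bochner_Integration.integral_nonneg)
  qed
  note G = set_sums_integral[OF gi s2 s3]
  have split: "of_real t powr (s - 1) / of_real (exp t - 1) =
      of_real t powr (s - 1 - 1) - 1 / 2 * of_real t powr (s - 1) + (\<Sum>i. g i t)" if t: "t \<in> {0<..<1}" for t
  proof -
    have "(\<lambda>i. of_real (bern_coeff i * t ^ (2 * i + 1))) sums complex_of_real (1 / (exp t - 1) - 1 / t + 1 / 2)"
      using t bern_coeff_sums[of t] by (simp only: sums_of_real_iff) auto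
    hence "(\<lambda>i. of_real t powr (s - 1) * of_real (bern_coeff i * t ^ (2 * i + 1))) sums
       (of_real t powr (s - 1) * complex_of_real (1 / (exp t - 1) - 1 / t + 1 / 2))" by (rule sums_mult)
    also have "(\<lambda>i. of_real t powr (s - 1) * of_real (bern_coeff i * t ^ (2 * i + 1))) = (\<lambda>i. g i t)"
    proof
      fix i
      have "s + of_nat (2 * i + 1) - 1 = s - 1 + of_nat (2 * i + 1)" by simp
      hence "complex_of_real t powr (s + of_nat (2 * i + 1) - 1) = of_real t powr (s - 1) * of_real t powr of_nat (2 * i + 1)"
        by (simp only: powr_add)
      also have "complex_of_real t powr of_nat (2 * i + 1) = of_real t ^ (2 * i + 1)"
        using t by (subst powr_nat) auto
      finally show "of_real t powr (s - 1) * of_real (bern_coeff i * t ^ (2 * i + 1)) = g i t"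
        unfolding g_def by simp
    qed
    finally have "(\<Sum>i. g i t) = of_real t powr (s - 1) * complex_of_real (1 / (exp t - 1) - 1 / t + 1 / 2)"
      by (simp add: sums_iff)
    moreover have "complex_of_real t powr (s - 1 - 1) = of_real t powr (s - 1) / of_real t"
      using t by (subst powr_diff) auto
    ultimately show ?thesis by (simp add: algebra_simps)
  qed
  have i1: "set_integrable lborel {0<..<1} (\<lambda>t. complex_of_real t powr (s - 1 - 1))"
    "(LINT t:{0<..<1}|lborel. complex_of_real t powr (s - 1 - 1)) = 1 / (s - 1)"
    using s by (intro powr_unit_interval_integral; simp)+
  have i2: "set_integrable lborel {0<..<1} (\<lambda>t. 1 / 2 * complex_of_real t powr (s - 1))"
    "(LINT t:{0<..<1}|lborel. 1 / 2 * complex_of_real t powr (s - 1)) = 1 / 2 * (1 / s)"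
    using s powr_unit_interval_integral[of s] by auto
  have cong: "set_integrable lborel {0<..<1} (\<lambda>t. of_real t powr (s - 1) / of_real (exp t - 1)) \<longleftrightarrow>
     set_integrable lborel {0<..<1} (\<lambda>t. of_real t powr (s - 1 - 1) - 1 / 2 * of_real t powr (s - 1) + (\<Sum>i. g i t))"
    "(LINT t:{0<..<1}|lborel. of_real t powr (s - 1) / of_real (exp t - 1)) =
     (LINT t:{0<..<1}|lborel. of_real t powr (s - 1 - 1) - 1 / 2 * of_real t powr (s - 1) + (\<Sum>i. g i t))"
    by (rule set_integrable_cong[OF refl refl split], assumption)
       (rule set_lebesgue_integral_cong, use split in auto)
  show "set_integrable lborel {0<..<1} (\<lambda>t. of_real t powr (s - 1) / of_real (exp t - 1))"
    unfolding cong by (intro set_integral_add set_integral_diff i1 i2 G)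
  have "(LINT t:{0<..<1}|lborel. of_real t powr (s - 1) / of_real (exp t - 1)) =
       (LINT t:{0<..<1}|lborel. of_real t powr (s - 1 - 1) - 1 / 2 * of_real t powr (s - 1)) + (LINT t:{0<..<1}|lborel. \<Sum>i. g i t)"
    unfolding cong(2) by (intro set_integral_add set_integral_diff i1 i2 G)
  also have "(LINT t:{0<..<1}|lborel. of_real t powr (s - 1 - 1) - 1 / 2 * of_real t powr (s - 1)) = 1 / (s - 1) - 1 / 2 * (1 / s)"
    using set_integral_diff(2)[OF i1(1) i2(1)] unfolding i1(2) i2(2) .
  also have "(LINT t:{0<..<1}|lborel. \<Sum>i. g i t) = (\<Sum>i. of_real (bern_coeff i) / (s + of_nat (2 * i + 1)))"
    using G(2) unfolding gv by (simp add: sums_iff)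
  finally show "(LINT t:{0<..<1}|lborel. of_real t powr (s - 1) / of_real (exp t - 1)) =
          1 / (s - 1) - 1 / (2 * s) + (\<Sum>i. of_real (bern_coeff i) / (s + of_nat (2 * i + 1)))" by simp
qed

text \<open>Gamma s n^(-s) is the integral of t^(s-1) e^(-n t), and these integrands add up to
  t^(s-1) / (e^t - 1). The integrals of the norms are Gamma (Re s) n^(-Re s), so Re s > 1 permits
  the exchange.\<close>

lemma zeta_ext_sums:
  fixes s :: complex
  assumes s: "Re s > 1"
  shows "(\<lambda>n. of_nat (Suc n) powr (- s)) sums zeta_ext s"
proof -
  have s0: "Re s > 0" using s by simp
  have G0: "Gamma s \<noteq> 0" using s0 by (auto simp: Gamma_eq_zero_iff elim!: nonpos_Ints_cases)
  define f where "f = (\<lambda>n t. complex_of_real t powr (s - 1) * of_real (exp (- (real (Suc n) * t))))"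
  have f1: "set_integrable lborel {0<..} (f n)" for n
    unfolding f_def by (rule Gamma_integral_scaled[OF s0]) auto
  have f1': "(LINT t:{0<..}|lborel. f n t) = Gamma s * of_nat (Suc n) powr (- s)" for n
    unfolding f_def by (subst Gamma_integral_scaled(2)[OF s0]) auto
  have nf: "norm (f n t) = t powr (Re s - 1) * exp (- (real (Suc n) * t))" if "t > 0" for n t
    using that unfolding f_def norm_mult by (simp add: norm_powr_real_powr)
  have geom: "(\<lambda>n. exp (- (real (Suc n) * t))) sums (1 / (exp t - 1))" if "t > 0" for t :: real
  proof -
    have "(\<lambda>n. exp (- t) * exp (- t) ^ n) sums (exp (- t) * (1 / (1 - exp (- t))))"
      using that by (intro sums_mult geometric_sums) auto
    also have "exp (- t) * (1 / (1 - exp (- t))) = 1 / (exp t - 1)"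
      using that by (simp add: exp_minus field_simps)
    also have "(\<lambda>n. exp (- t) * exp (- t) ^ n) = (\<lambda>n. exp (- (real (Suc n) * t)))"
      by (rule ext) (simp add: exp_of_nat_mult[symmetric] exp_add[symmetric] algebra_simps)
    finally show ?thesis .
  qed
  have f2: "summable (\<lambda>n. norm (f n t))" if "t \<in> {0<..}" for t
    using that geom[of t] by (simp add: nf summable_mult sums_iff del: of_nat_Suc)
  have f3: "summable (\<lambda>n. LINT t:{0<..}|lborel. norm (f n t))"
  proof -
    have r: "(LINT t:{0<..}|lborel. norm (f n t)) = Gamma (Re s) * real (Suc n) powr (- Re s)" for n
    proof -
      have "(LINT t:{0<..}|lborel. norm (f n t)) = (LINT t:{0<..}|lborel. t powr (Re s - 1) * exp (- (real (Suc n) * t)))"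
        by (rule set_lebesgue_integral_cong) (auto simp: nf)
      also have "\<dots> = Gamma (Re s) * real (Suc n) powr (- Re s)"
        using s0 by (intro powr_exp_integral) auto
      finally show ?thesis .
    qed
    have "summable (\<lambda>n. real n powr (- Re s))"
      using s by (subst summable_real_powr_iff) auto
    hence "summable (\<lambda>n. real (Suc n) powr (- Re s))" by (subst summable_Suc_iff)
    thus ?thesis unfolding r by (rule summable_mult)
  qed
  note F = set_sums_integral[OF f1 f2 f3]
  have suminf_f: "(\<Sum>n. f n t) = of_real t powr (s - 1) / of_real (exp t - 1)" if "t > 0" for t
  proof -
    have "(\<lambda>n. complex_of_real (exp (- (real (Suc n) * t)))) sums of_real (1 / (exp t - 1))"
      using geom[OF that] by (simp only: sums_of_real_iff)
    from sums_mult[OF this, of "of_real t powr (s - 1)"] show ?thesis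
      unfolding f_def by (simp add: sums_iff)
  qed
  have "(LINT t:{0<..}|lborel. (\<Sum>n. f n t)) = (LINT t:{0<..<1}|lborel. (\<Sum>n. f n t)) + (LINT t:{1..}|lborel. (\<Sum>n. f n t))"
  proof -
    have eq: "{0<..} = {0<..<1} \<union> {1::real..}" by auto
    have "set_integrable lborel {0<..<1} (\<lambda>t. \<Sum>n. f n t)" "set_integrable lborel {1..} (\<lambda>t. \<Sum>n. f n t)"
      by (rule set_integrable_subset[OF F(1)]; auto)+
    thus ?thesis unfolding eq by (intro set_integral_Un) auto
  qed
  also have "(LINT t:{1..}|lborel. (\<Sum>n. f n t)) = zeta_tail s"
    unfolding zeta_tail_def
    by (rule set_lebesgue_integral_cong) (auto simp: suminf_f powr_def Ln_of_real)
  also have "(LINT t:{0<..<1}|lborel. (\<Sum>n. f n t)) = (LINT t:{0<..<1}|lborel. of_real t powr (s - 1) / of_real (exp t - 1))"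
    by (rule set_lebesgue_integral_cong) (auto simp: suminf_f)
  also note zeta_ext_integral_unit_interval(2)[OF s]
  finally have "(\<lambda>n. Gamma s * of_nat (Suc n) powr (- s)) sums
     (1 / (s - 1) - 1 / (2 * s) + (\<Sum>i. of_real (bern_coeff i) / (s + of_nat (2 * i + 1))) + zeta_tail s)" (is "_ sums ?J")
    using F(2) unfolding f1' by simp
  from sums_mult[OF this, of "rGamma s"]
  have "(\<lambda>n. of_nat (Suc n) powr (- s)) sums (rGamma s * ?J)"
    using G0 by (simp add: rGamma_inverse_Gamma field_simps)
  also have "rGamma s * ?J = zeta_ext s"
  proof -
    have s1: "s \<noteq> 0" "s \<noteq> 1" using s by auto
    have r1: "rGamma (s + 1) = rGamma s / s" using rGamma_plus1[of s] s1 by (simp add: field_simps)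
    \<comment> \<open>In this half plane s + 2 i + 1 is nonzero, and the entire form of the term can
      be divided by it again.\<close>
    have r2: "zeta_term i s = rGamma s * (of_real (bern_coeff i) / (s + of_nat (2 * i + 1)))" for i
    proof -
      have "Re (s + of_nat (2 * i + 1)) > 0" using s by simp
      hence "s + of_nat (2 * i + 1) \<noteq> 0" by (metis less_irrefl zero_complex.simps(1))
      moreover have "rGamma s = pochhammer s (2 * i + 2) * rGamma (s + of_nat (2 * i + 2))"
        by (rule pochhammer_rGamma)
      moreover have "pochhammer s (2 * i + 2) = pochhammer s (2 * i + 1) * (s + of_nat (2 * i + 1))"
        by (simp add: pochhammer_rec' mult.commute)
      ultimately show ?thesis by (simp add: zeta_term_def field_simps)
    qed
    have "summable (\<lambda>i. of_real (bern_coeff i) / (s + of_nat (2 * i + 1)))"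
    proof (rule summable_comparison_test[OF _ summable_bern_coeff], intro exI allI impI)
      fix i
      have "1 \<le> Re (s + of_nat (2 * i + 1))" using s by simp
      also have "\<dots> \<le> norm (s + of_nat (2 * i + 1))" by (rule complex_Re_le_cmod)
      finally have "\<bar>bern_coeff i\<bar> / norm (s + of_nat (2 * i + 1)) \<le> \<bar>bern_coeff i\<bar> / 1"
        by (intro divide_left_mono) auto
      thus "norm (of_real (bern_coeff i) / (s + of_nat (2 * i + 1))) \<le> \<bar>bern_coeff i\<bar>"
        by (simp add: norm_divide del: of_nat_add of_nat_mult)
    qed
    from suminf_mult[OF this, of "rGamma s"]
    show ?thesis unfolding zeta_ext_def r1 r2 using s1 by (simp add: algebra_simps)
  qed
  finally show ?thesis .
qed

text \<open>Uniqueness is the identity theorem on the connected set of all s \<noteq> 1; the value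
  that the formula happens to give at 1 is replaced by the prescribed 0.\<close>

lemma zeta_eq_zeta_ext: "zeta = (\<lambda>s. if s = 1 then 0 else zeta_ext s)"
  unfolding zeta_def
proof (rule the_equality)
  have "(\<lambda>s. if s = 1 then 0 else zeta_ext s) holomorphic_on - {1}"
    using zeta_ext_holomorphic by (rule holomorphic_transform) auto
  thus "(\<lambda>s. if s = 1 then 0 else zeta_ext s) holomorphic_on - {1} \<and>
    (if (1::complex) = 1 then 0 else zeta_ext 1) = 0 \<and>
    (\<forall>s. 1 < Re s \<longrightarrow> (\<lambda>n. of_nat (Suc n) powr - s) sums (if s = 1 then 0 else zeta_ext s))"
    using zeta_ext_sums by auto
next
  fix f assume f: "f holomorphic_on - {1} \<and> f 1 = 0 \<and>
             (\<forall>s. 1 < Re s \<longrightarrow> (\<lambda>n. of_nat (Suc n) powr - s) sums f s)"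
  show "f = (\<lambda>s. if s = 1 then 0 else zeta_ext s)"
  proof
    fix s
    show "f s = (if s = 1 then 0 else zeta_ext s)"
    proof (cases "s = 1")
      case False
      have "f s = zeta_ext s"
      proof (rule analytic_continuation_open[of "{s. Re s > 1}" "- {1}" f zeta_ext s])
        show "connected (- {1 :: complex})" by (rule connected_punctured_universe) auto
        show "{s. Re s > 1} \<noteq> {}" by (auto intro!: exI[of _ 2])
        show "f z = zeta_ext z" if "z \<in> {s. Re s > 1}" for z
          using that f zeta_ext_sums[of z] by (metis mem_Collect_eq sums_unique2)
      qed (use f False zeta_ext_holomorphic in \<open>auto simp: open_halfspace_Re_gt\<close>)
      thus ?thesis using False by simp
    qed (use f in auto)
  qed
qed

lemma zeta_sums:
  assumes "Re s > 1"
  shows "(\<lambda>n. of_nat (Suc n) powr (- s)) sums zeta s"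
  using zeta_ext_sums[OF assms] assms by (auto simp: zeta_eq_zeta_ext)

text \<open>The series is zeta (k + 1) / (2 pi)^(k + 1), so this is an instance of the functional
  equation. The same series turns up in the limit of \<open>P\<close>, where the two meet.\<close>

lemma zeta_minus_odd:
  assumes "odd k"
  shows "zeta (- of_nat k) =
     - of_real (2 * (-1) ^ (k div 2) * fact k * (\<Sum>m. 1 / (2 * pi * real (Suc m)) ^ Suc k))"
proof -
  obtain i where k: "k = 2 * i + 1" using assms by (auto elim: oddE)
  have "(- of_nat k :: complex) \<noteq> 1"
  proof
    assume "(- of_nat k :: complex) = 1"
    hence "Re (- of_nat k :: complex) = 1" by simp
    thus False by simp
  qed
  hence "zeta (- of_nat k) = - of_real (fact (2 * i + 1) * bern_coeff i)"
    unfolding zeta_eq_zeta_ext k using zeta_ext_minus_odd[of i] by simp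
  thus ?thesis by (simp add: bern_coeff_def k mult_ac)
qed

section \<open>Integrals along rays\<close>

text \<open>The contour integral from 0 along the ray, kept as a Lebesgue integral so that the
  convergence theorems apply; the factor \<open>cis \<phi>\<close> is dw/dt.\<close>

definition ray :: "(complex \<Rightarrow> complex) \<Rightarrow> real \<Rightarrow> complex" where
  "ray h \<phi> = (LINT t:{0<..}|lborel. h (of_real t * cis \<phi>) * cis \<phi>)"

definition ray_integrable :: "(complex \<Rightarrow> complex) \<Rightarrow> real \<Rightarrow> bool" where
  "ray_integrable h \<phi> \<longleftrightarrow> set_integrable lborel {0<..} (\<lambda>t. h (of_real t * cis \<phi>) * cis \<phi>)"

lemma integrable_quadratic_decay:
  fixes f :: "real \<Rightarrow> 'a::euclidean_space"
  assumes cont: "continuous_on {0..} f" and bound: "\<And>t. t \<ge> T \<Longrightarrow> norm (f t) \<le> C / t\<^sup>2" and T: "T > 0"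
  shows "set_integrable lborel {0<..} f"
proof -
  have "(\<lambda>t::real. t powr (-2)) integrable_on {T..}"
    using has_integral_powr_to_inf[of "-2" T] T by (auto simp: integrable_on_def)
  hence "(\<lambda>t::real. t powr (-2)) absolutely_integrable_on {T..}"
    by (rule nonnegative_absolutely_integrable_1) auto
  hence "set_integrable lborel {T..} (\<lambda>t::real. t powr (-2))"
    unfolding set_integrable_def by (subst (asm) integrable_completion) (use T in auto)
  hence dom: "set_integrable lborel {T..} (\<lambda>t::real. C * t powr (-2))"
    by (rule set_integrable_mult_right)
  have "set_integrable lborel {0..T} f"
    unfolding set_integrable_def
    by (rule borel_integrable_compact) (auto intro: continuous_on_subset[OF cont])
  moreover from dom have "set_integrable lborel {T..} f"
  proof (rule set_integrable_bound)
    show "set_borel_measurable lborel {T..} f" unfolding set_borel_measurable_def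
      using continuous_on_subset[OF cont, of "{T..}"] T
      by (subst measurable_lborel2, intro borel_measurable_continuous_on_indicator) auto
    show "AE t in lborel. t \<in> {T..} \<longrightarrow> norm (f t) \<le> norm (C * t powr (-2))"
    proof (intro AE_I2 impI)
      fix t :: real assume "t \<in> {T..}"
      hence "norm (f t) \<le> C * t powr (-2)"
        using bound[of t] T by (simp add: powr_minus powr_realpow field_simps)
      thus "norm (f t) \<le> norm (C * t powr (-2))" by simp
    qed
  qed
  ultimately have "set_integrable lborel ({0..T} \<union> {T..}) f" by (rule set_integrable_Un) auto
  thus ?thesis by (rule set_integrable_subset) (use T in auto)
qed

lemma ray_segment:
  assumes "ray_integrable h \<phi>" "R > 0"
  shows "(h has_contour_integral (LINT t:{0..R}|lborel. h (of_real t * cis \<phi>) * cis \<phi>)) (linepath 0 (of_real R * cis \<phi>))"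
proof -
  define f where "f = (\<lambda>t. h (of_real t * cis \<phi>) * cis \<phi>)"
  have "set_integrable lborel {0..} f"
    using assms(1) unfolding ray_integrable_def f_def set_integrable_Ici_iff_Ioi .
  hence "set_integrable lborel {0..R} f" by (rule set_integrable_subset) auto
  hence "(f has_integral (LINT t:{0..R}|lborel. f t)) (cbox 0 R)"
    using set_borel_integral_eq_integral by (metis cbox_interval integrable_integral)
  from has_integral_affinity'[OF this assms(2), of 0]
  have "((\<lambda>u. f (R * u)) has_integral ((LINT t:{0..R}|lborel. f t) /\<^sub>R R)) {0..1}"
    using assms(2) by simp
  from has_integral_mult_left[OF this, of "of_real R"]
  have "((\<lambda>u. f (R * u) * of_real R) has_integral (LINT t:{0..R}|lborel. f t)) {0..1}"
    using assms(2) by (simp add: scaleR_conv_of_real field_simps)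
  thus ?thesis unfolding has_contour_integral_linepath f_def
    by (simp add: linepath_def scaleR_conv_of_real mult_ac)
qed

text \<open>The rays are closed by a chord, not an arc, since Cauchy's theorem is at hand for
  triangles. The chord has length at most 2 R and the integrand is at most C / R^2 on it, so its
  share is O(1/R).\<close>

lemma ray_triangle:
  assumes int: "ray_integrable h \<alpha>" "ray_integrable h \<beta>"
    and tri: "\<And>R. R \<ge> R0 \<Longrightarrow> (h has_contour_integral c)
      (linepath 0 (of_real R * cis \<alpha>) +++ linepath (of_real R * cis \<alpha>) (of_real R * cis \<beta>) +++ linepath (of_real R * cis \<beta>) 0)"
    and chord: "\<And>R z. R \<ge> R0 \<Longrightarrow> z \<in> closed_segment (of_real R * cis \<alpha>) (of_real R * cis \<beta>) \<Longrightarrow> norm (h z) \<le> C / R\<^sup>2"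
  shows "ray h \<alpha> - ray h \<beta> = c"
proof -
  define I where "I = (\<lambda>\<phi> R. LINT t:{0..R}|lborel. h (of_real t * cis \<phi>) * cis \<phi>)"
  have lim: "(I \<phi> \<longlongrightarrow> ray h \<phi>) at_top" if "ray_integrable h \<phi>" for \<phi>
    unfolding I_def ray_def set_lebesgue_integral_Ici_eq_Ioi[symmetric]
    using that unfolding ray_integrable_def set_integrable_Ici_iff_Ioi[symmetric]
    by (intro tendsto_set_lebesgue_integral_at_top) auto
  have "((\<lambda>R. I \<alpha> R - I \<beta> R) \<longlongrightarrow> ray h \<alpha> - ray h \<beta>) at_top"
    by (intro tendsto_diff lim int)
  moreover have "((\<lambda>R. I \<alpha> R - I \<beta> R - c) \<longlongrightarrow> 0) at_top"
  proof (rule Lim_null_comparison)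
    show "\<forall>\<^sub>F R in at_top. norm (I \<alpha> R - I \<beta> R - c) \<le> C * 2 / R"
      using eventually_ge_at_top[of R0] eventually_gt_at_top[of 0]
    proof eventually_elim
      case (elim R)
      define a where "a = of_real R * cis \<alpha>"
      define b where "b = of_real R * cis \<beta>"
      have A: "(h has_contour_integral I \<alpha> R) (linepath 0 a)"
        unfolding I_def a_def by (intro ray_segment int elim)
      have "(h has_contour_integral I \<beta> R) (linepath 0 b)"
        unfolding I_def b_def by (intro ray_segment int elim)
      hence B: "(h has_contour_integral (- I \<beta> R)) (linepath b 0)"
        using has_contour_integral_reversepath[OF valid_path_linepath] by fastforce
      have T: "(h has_contour_integral c) (linepath 0 a +++ linepath a b +++ linepath b 0)"
        unfolding a_def b_def by (intro tri elim)
      hence "h contour_integrable_on (linepath 0 a +++ linepath a b +++ linepath b 0)"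
        by (rule has_contour_integral_integrable)
      hence "h contour_integrable_on (linepath a b)" by simp
      then obtain d where D: "(h has_contour_integral d) (linepath a b)"
        by (auto simp: contour_integrable_on_def)
      have "(h has_contour_integral (I \<alpha> R + (d + - I \<beta> R))) (linepath 0 a +++ linepath a b +++ linepath b 0)"
        by (intro has_contour_integral_join A B D) auto
      with T have c: "c = I \<alpha> R + (d + - I \<beta> R)" by (rule has_contour_integral_unique)
      have C0: "0 \<le> C / R\<^sup>2"
        using order.trans[OF norm_ge_zero chord[OF elim(1), of a]] by (simp add: a_def)
      have "norm d \<le> (C / R\<^sup>2) * norm (b - a)"
        by (rule has_contour_integral_bound_linepath[OF D C0])
           (use chord[OF elim(1)] in \<open>simp add: a_def b_def\<close>)
      also have "norm (b - a) \<le> 2 * R"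
        using norm_triangle_ineq4[of b a] elim(2) by (simp add: a_def b_def norm_mult)
      hence "(C / R\<^sup>2) * norm (b - a) \<le> (C / R\<^sup>2) * (2 * R)"
        using C0 by (rule mult_left_mono)
      finally have "norm d \<le> (C / R\<^sup>2) * (2 * R)" .
      moreover have "I \<alpha> R - I \<beta> R - c = - d" using c by simp
      ultimately show ?case using elim(2) by (simp add: power2_eq_square)
    qed
    show "((\<lambda>R. C * 2 / R) \<longlongrightarrow> 0) at_top"
      by (intro tendsto_divide_0[OF tendsto_const] filterlim_at_top_imp_at_infinity filterlim_ident)
  qed
  hence "((\<lambda>R. I \<alpha> R - I \<beta> R - c + c) \<longlongrightarrow> 0 + c) at_top" by (intro tendsto_add tendsto_const)
  hence "((\<lambda>R. I \<alpha> R - I \<beta> R) \<longlongrightarrow> c) at_top" by simp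
  ultimately show ?thesis by (rule tendsto_unique[OF trivial_limit_at_top_linorder])
qed

definition sector :: "real \<Rightarrow> real \<Rightarrow> complex set" where
  "sector \<alpha> \<beta> = {of_real t * cis \<phi> | t \<phi>. 0 \<le> t \<and> \<alpha> \<le> \<phi> \<and> \<phi> \<le> \<beta>}"

lemma sectorI:
  assumes ab: "\<alpha> < \<beta>" "\<beta> < \<alpha> + pi" and uv: "u \<ge> 0" "v \<ge> 0"
  shows "of_real u * cis \<alpha> + of_real v * cis \<beta> \<in> sector \<alpha> \<beta>"
proof -
  define z where "z = of_real u * cis \<alpha> + of_real v * cis \<beta>"
  define \<psi> where "\<psi> = Arg2pi (z * cis (- \<alpha>))"
  define t where "t = norm z"
  have psi: "0 \<le> \<psi>" "\<psi> < 2 * pi" unfolding \<psi>_def using Arg2pi by auto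
  have "z * cis (- \<alpha>) = of_real t * cis \<psi>"
    unfolding t_def \<psi>_def using Arg2pi_eq[of "z * cis (- \<alpha>)"] by (simp add: norm_mult cis_conv_exp)
  moreover have "z = (z * cis (- \<alpha>)) * cis \<alpha>" by (simp add: mult.assoc cis_mult)
  ultimately have z1: "z = of_real t * cis (\<psi> + \<alpha>)" by (simp add: mult.assoc cis_mult)
  show ?thesis
  proof (cases "t = 0")
    case True
    hence "z = of_real 0 * cis \<alpha>" by (simp add: t_def)
    thus ?thesis unfolding z_def[symmetric] sector_def using ab by (blast intro: less_imp_le)
  next
    case False
    hence t: "t > 0" by (simp add: t_def)
    \<comment> \<open>Turning by -\<alpha> makes the first summand real: the sign of the imaginary
      part shows \<psi> \<le> pi. Turning by -\<beta> below treats the other side in the same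
      way.\<close>
    have "Im (z * cis (- \<alpha>)) = v * sin (\<beta> - \<alpha>)"
      unfolding z_def by (simp add: algebra_simps cis_mult mult.assoc sin_diff)
    moreover have "Im (z * cis (- \<alpha>)) = t * sin \<psi>" unfolding z1 by (simp add: sin_diff cis_mult mult.assoc)
    ultimately have "t * sin \<psi> = v * sin (\<beta> - \<alpha>)" by (simp only:)
    moreover have sin0: "sin (\<beta> - \<alpha>) \<ge> 0" using ab by (intro sin_ge_zero) auto
    ultimately have "t * sin \<psi> \<ge> 0" using uv by simp
    hence s1: "sin \<psi> \<ge> 0" using t by (simp add: zero_le_mult_iff)
    have psi_pi: "\<psi> \<le> pi"
    proof (rule ccontr)
      assume "\<not> \<psi> \<le> pi"
      hence "sin \<psi> < 0" using psi by (intro sin_lt_zero) auto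
      with s1 show False by simp
    qed
    have "Im (z * cis (- \<beta>)) = - (u * sin (\<beta> - \<alpha>))"
      unfolding z_def by (simp add: algebra_simps cis_mult mult.assoc sin_diff)
    moreover have "Im (z * cis (- \<beta>)) = t * sin (\<psi> + \<alpha> - \<beta>)" unfolding z1 by (simp add: cis_mult mult.assoc)
    ultimately have "t * sin (\<psi> + \<alpha> - \<beta>) = - (u * sin (\<beta> - \<alpha>))" by (simp only:)
    hence "t * sin (\<psi> + \<alpha> - \<beta>) \<le> 0" using uv sin0 by simp
    hence s2: "sin (\<psi> + \<alpha> - \<beta>) \<le> 0" using t by (simp add: mult_le_0_iff)
    have "\<psi> + \<alpha> \<le> \<beta>"
    proof (rule ccontr)
      assume "\<not> \<psi> + \<alpha> \<le> \<beta>"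
      hence "sin (\<psi> + \<alpha> - \<beta>) > 0" using psi_pi ab by (intro sin_gt_zero) auto
      with s2 show False by simp
    qed
    thus ?thesis unfolding z_def[symmetric] sector_def using z1 psi t
      by (intro CollectI exI[of _ t] exI[of _ "\<psi> + \<alpha>"]) simp
  qed
qed

lemma triangle_subset_sector:
  assumes ab: "\<alpha> < \<beta>" "\<beta> < \<alpha> + pi" and R: "R \<ge> 0"
  shows "convex hull {0, of_real R * cis \<alpha>, of_real R * cis \<beta>} \<subseteq> sector \<alpha> \<beta>"
proof
  fix z assume "z \<in> convex hull {0, of_real R * cis \<alpha>, of_real R * cis \<beta>}"
  then obtain u v w where uvw: "u \<ge> 0" "v \<ge> 0" "w \<ge> 0" "z = u *\<^sub>R 0 + v *\<^sub>R (of_real R * cis \<alpha>) + w *\<^sub>R (of_real R * cis \<beta>)"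
    unfolding convex_hull_3 by blast
  have "z = of_real (v * R) * cis \<alpha> + of_real (w * R) * cis \<beta>"
    unfolding uvw by (simp add: scaleR_conv_of_real)
  also have "\<dots> \<in> sector \<alpha> \<beta>" using uvw R by (intro sectorI ab) auto
  finally show "z \<in> sector \<alpha> \<beta>" .
qed

text \<open>Both ends of the chord, hence all its points, have the same projection onto the
  bisecting direction.\<close>

lemma norm_chord_ge:
  assumes z: "z \<in> closed_segment (of_real R * cis \<alpha>) (of_real R * cis \<beta>)"
  shows "R * cos ((\<beta> - \<alpha>) / 2) \<le> norm z"
proof -
  obtain u where u: "z = (1 - u) *\<^sub>R (of_real R * cis \<alpha>) + u *\<^sub>R (of_real R * cis \<beta>)"
    using z by (auto simp: closed_segment_def)
  define g where "g = (\<alpha> + \<beta>) / 2"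
  have "Re (z * cis (- g)) = (1 - u) * (R * cos (\<alpha> - g)) + u * (R * cos (\<beta> - g))"
    unfolding u by (simp add: cos_diff algebra_simps)
  also have "\<alpha> - g = - ((\<beta> - \<alpha>) / 2)" by (simp add: g_def field_simps)
  also have "\<beta> - g = (\<beta> - \<alpha>) / 2" by (simp add: g_def field_simps)
  finally have "R * cos ((\<beta> - \<alpha>) / 2) = Re (z * cis (- g))" by (simp add: algebra_simps)
  also have "\<dots> \<le> norm (z * cis (- g))" by (rule complex_Re_le_cmod)
  finally show ?thesis by (simp add: norm_mult)
qed

lemma ray_integrableI:
  assumes "continuous_on (sector \<alpha> \<beta>) h" "\<alpha> \<le> \<phi>" "\<phi> \<le> \<beta>"
    and "\<And>z. z \<in> sector \<alpha> \<beta> \<Longrightarrow> norm z \<ge> 1 \<Longrightarrow> norm (h z) \<le> C / norm z ^ 2"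
  shows "ray_integrable h \<phi>"
  unfolding ray_integrable_def
proof (rule integrable_quadratic_decay[of _ 1])
  have mem: "of_real t * cis \<phi> \<in> sector \<alpha> \<beta>" if "t \<ge> 0" for t
    using that assms(2,3) by (auto simp: sector_def)
  show "continuous_on {0..} (\<lambda>t. h (of_real t * cis \<phi>) * cis \<phi>)"
    by (intro continuous_intros continuous_on_compose2[OF assms(1)]) (use mem in auto)
  show "norm (h (of_real t * cis \<phi>) * cis \<phi>) \<le> C / t\<^sup>2" if "t \<ge> 1" for t
    using assms(4)[OF mem[of t]] that by (simp add: norm_mult)
qed auto

text \<open>Cauchy's theorem for a triangle asks for differentiability only in the interior, so
  continuity suffices on the two rays. An opening below pi keeps the chord at distance R d from 0,
  which turns decay in |z| into decay in R.\<close>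

lemma ray_rotate:
  assumes ab: "\<alpha> < \<beta>" "\<beta> < \<alpha> + pi"
    and cont: "continuous_on (sector \<alpha> \<beta>) h"
    and diff: "\<And>z. z \<in> interior (sector \<alpha> \<beta>) \<Longrightarrow> z \<noteq> 0 \<Longrightarrow> h field_differentiable at z"
    and decay: "\<And>z. z \<in> sector \<alpha> \<beta> \<Longrightarrow> norm z \<ge> 1 \<Longrightarrow> norm (h z) \<le> C / norm z ^ 2"
  shows "ray h \<alpha> = ray h \<beta>"
proof -
  define d where "d = cos ((\<beta> - \<alpha>) / 2)"
  have d: "d > 0" unfolding d_def using ab by (intro cos_gt_zero_pi) auto
  have "ray h \<alpha> - ray h \<beta> = 0"
  proof (rule ray_triangle)
    show "ray_integrable h \<alpha>" "ray_integrable h \<beta>"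
      using ab by (auto intro!: ray_integrableI[OF cont _ _ decay])
    fix R assume "R \<ge> 1 / d"
    hence R: "R * d \<ge> 1" using d by (simp add: field_simps)
    hence "R * d > 0" by linarith
    hence R0: "R > 0" using d by (simp add: zero_less_mult_iff)
    have sub: "convex hull {0, of_real R * cis \<alpha>, of_real R * cis \<beta>} \<subseteq> sector \<alpha> \<beta>"
      using R0 by (intro triangle_subset_sector ab) auto
    show "(h has_contour_integral 0)
      (linepath 0 (of_real R * cis \<alpha>) +++ linepath (of_real R * cis \<alpha>) (of_real R * cis \<beta>) +++ linepath (of_real R * cis \<beta>) 0)"
      by (rule Cauchy_theorem_triangle_cofinite[of _ _ _ _ "{0}"])
         (use sub interior_mono[OF sub] in \<open>auto intro: continuous_on_subset[OF cont] diff\<close>)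
    fix z assume z: "z \<in> closed_segment (of_real R * cis \<alpha>) (of_real R * cis \<beta>)"
    have "R * d \<le> norm z" unfolding d_def by (rule norm_chord_ge[OF z])
    have "z \<in> convex hull {of_real R * cis \<alpha>, of_real R * cis \<beta>}" using z by (simp add: segment_convex_hull)
    also have "\<dots> \<subseteq> convex hull {0, of_real R * cis \<alpha>, of_real R * cis \<beta>}" by (intro hull_mono) auto
    finally have zs: "z \<in> sector \<alpha> \<beta>" using sub by blast
    have z1: "norm z \<ge> 1" using \<open>R * d \<le> norm z\<close> R by linarith
    have "0 \<le> C / norm z ^ 2" using decay[OF zs z1] norm_ge_zero order.trans by blast
    moreover have "norm z > 0" using z1 by linarith
    ultimately have C0: "C \<ge> 0" by (simp add: zero_le_divide_iff)
    have "norm (h z) \<le> C / norm z ^ 2" by (rule decay[OF zs z1])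
    also have "\<dots> \<le> C / (R * d) ^ 2"
      using \<open>R * d \<le> norm z\<close> R0 z1 C0 d by (intro divide_left_mono power_mono mult_pos_pos) auto
    finally show "norm (h z) \<le> C / d\<^sup>2 / R\<^sup>2" by (simp add: power_mult_distrib mult.commute)
  qed
  thus ?thesis by simp
qed

section \<open>The logarithmic kernel\<close>

definition kern :: "real \<Rightarrow> complex \<Rightarrow> complex" where
  "kern r w = Ln (1 - of_real r * exp (2 * of_real pi * \<i> * w))"

lemma norm_kern_arg: "norm (exp (2 * of_real pi * \<i> * w)) = exp (- (2 * pi * Im w))"
  by simp

text \<open>The separate bound \<open>q\<close> makes the constant uniform, while the factor
  \<open>norm u\<close> keeps the decay of the argument.\<close>

lemma norm_Ln_one_minus_le:
  fixes u :: complex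
  assumes u: "norm u \<le> q" "q < 1"
  shows "norm (Ln (1 - u)) \<le> norm u / (1 - q)"
proof -
  have u1: "norm u < 1" using u by simp
  have "(\<lambda>n. - (u ^ n) / of_nat n) sums Ln (1 - u)" using Ln_series'[of "- u"] u1 by simp
  hence S: "(\<lambda>n. - (u ^ Suc n) / of_nat (Suc n)) sums Ln (1 - u)"
    by (subst sums_Suc_iff) simp
  have G: "(\<lambda>n. norm u * norm u ^ n) sums (norm u * (1 / (1 - norm u)))"
    using u1 by (intro sums_mult geometric_sums) auto
  have "norm (\<Sum>n. - (u ^ Suc n) / of_nat (Suc n)) \<le> (\<Sum>n. norm u * norm u ^ n)"
  proof (rule norm_suminf_le)
    fix n
    have "norm (- (u ^ Suc n) / of_nat (Suc n)) = norm u ^ Suc n / real (Suc n)"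
      unfolding norm_divide norm_minus_cancel norm_power norm_of_nat ..
    also have "\<dots> \<le> norm u ^ Suc n / 1" by (intro divide_left_mono) auto
    finally show "norm (- (u ^ Suc n) / of_nat (Suc n)) \<le> norm u * norm u ^ n" by simp
  qed (use G in \<open>simp add: sums_iff\<close>)
  hence "norm (Ln (1 - u)) \<le> norm u * (1 / (1 - norm u))" using S G by (simp add: sums_iff)
  also have "\<dots> \<le> norm u * (1 / (1 - q))" using u by (intro mult_left_mono frac_le) auto
  finally show ?thesis by simp
qed

lemma kern_arg_le:
  assumes "0 < r" "Im w \<ge> 0"
  shows "norm (of_real r * exp (2 * of_real pi * \<i> * w)) \<le> r"
  using assms unfolding norm_mult norm_kern_arg by (simp add: mult_left_le)

lemma norm_kern_le:
  assumes "0 < r" "r < 1" "Im w \<ge> 0"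
  shows "norm (kern r w) \<le> r / (1 - r) * exp (- (2 * pi * Im w))"
proof -
  have "norm (kern r w) \<le> norm (of_real r * exp (2 * of_real pi * \<i> * w)) / (1 - r)"
    unfolding kern_def using assms by (intro norm_Ln_one_minus_le kern_arg_le) auto
  thus ?thesis using assms unfolding norm_mult norm_kern_arg by simp
qed

text \<open>Im w = ln r / (2 pi) is the line on which r e^(2 pi i w) has modulus 1. For r < 1 it
  runs below the real axis, so the principal logarithm is safe on a neighbourhood of the closed
  upper half plane.\<close>

lemma kern_arg_Re_pos:
  assumes r: "0 < r" and w: "Im w > ln r / (2 * pi)"
  shows "Re (1 - of_real r * exp (2 * of_real pi * \<i> * w)) > 0"
proof -
  have "Re (of_real r * exp (2 * of_real pi * \<i> * w)) \<le> norm (of_real r * exp (2 * of_real pi * \<i> * w))"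
    by (rule complex_Re_le_cmod)
  also have "\<dots> = r * exp (- (2 * pi * Im w))" unfolding norm_mult norm_kern_arg using r by simp
  also have "\<dots> = exp (ln r - 2 * pi * Im w)" using r by (simp add: exp_diff exp_minus field_simps)
  also have "\<dots> < 1" using w by (simp add: field_simps)
  finally show ?thesis by simp
qed

lemma kern_arg_Re_pos':
  assumes "0 < r" "r < 1" "Im w \<ge> 0"
  shows "Re (1 - of_real r * exp (2 * of_real pi * \<i> * w)) > 0"
proof (rule kern_arg_Re_pos[OF assms(1)])
  have "ln r / (2 * pi) < 0" using assms by (intro divide_neg_pos) auto
  thus "Im w > ln r / (2 * pi)" using assms(3) by linarith
qed

lemma Re_pos_nonpos_Reals: "Re z > 0 \<Longrightarrow> z \<notin> \<real>\<^sub>\<le>\<^sub>0"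
  by (auto simp: complex_nonpos_Reals_iff)

lemma kern_holomorphic:
  assumes "0 < r" "\<And>w. w \<in> A \<Longrightarrow> Im w > ln r / (2 * pi)"
  shows "kern r holomorphic_on A"
  unfolding kern_def[abs_def]
  by (intro holomorphic_intros Re_pos_nonpos_Reals kern_arg_Re_pos assms)

lemma kern_continuous:
  assumes "0 < r" "r < 1"
  shows "continuous_on {w. Im w \<ge> 0} (kern r)"
proof (intro holomorphic_on_imp_continuous_on kern_holomorphic assms(1))
  fix w assume "w \<in> {w. Im w \<ge> 0}"
  moreover have "ln r / (2 * pi) < 0" using assms by (intro divide_neg_pos) auto
  ultimately show "Im w > ln r / (2 * pi)" by simp
qed

lemma kern_field_differentiable:
  assumes "0 < r" "r < 1" "Im z \<ge> 0"
  shows "kern r field_differentiable at z"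
proof (rule holomorphic_on_imp_differentiable_at)
  show "kern r holomorphic_on {w. Im w > ln r / (2 * pi)}" using assms by (intro kern_holomorphic) auto
  have "ln r / (2 * pi) < 0" using assms by (intro divide_neg_pos) auto
  thus "z \<in> {w. Im w > ln r / (2 * pi)}" using assms(3) by simp
qed (rule open_halfspace_Im_gt)

text \<open>Reflection in the imaginary axis conjugates e^(2 pi i w), and the logarithm commutes
  with conjugation in the right half plane.\<close>

lemma kern_reflect:
  assumes "0 < r" "r < 1" "Im w \<ge> 0"
  shows "kern r (- cnj w) = cnj (kern r w)"
proof -
  have "kern r (- cnj w) = Ln (cnj (1 - of_real r * exp (2 * of_real pi * \<i> * w)))"
    unfolding kern_def by (simp add: exp_cnj)
  also have "\<dots> = cnj (kern r w)" unfolding kern_def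
    by (intro cnj_Ln[symmetric] Re_pos_nonpos_Reals kern_arg_Re_pos' assms)
  finally show ?thesis .
qed

lemma exp_minus_le_power:
  fixes y :: real
  assumes "y > 0"
  shows "exp (- y) \<le> fact n / y ^ n"
proof -
  have "(\<Sum>i\<in>{n}. y ^ i / fact i) \<le> (\<Sum>i. y ^ i / fact i)"
    using summable_exp_generic[of y] assms
    by (intro sum_le_suminf) (auto simp: scaleR_conv_of_real divide_inverse mult.commute)
  also have "\<dots> = exp y" unfolding exp_def by (simp add: divide_inverse mult.commute)
  finally have "y ^ n / fact n \<le> exp y" by simp
  hence "inverse (exp y) \<le> inverse (y ^ n / fact n)" using assms by (intro le_imp_inverse_le) auto
  thus ?thesis by (simp add: exp_minus)
qed

text \<open>The conditions on \<open>p\<close> say that its argument lies strictly between \<theta>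
  and pi - \<theta>. Cauchy's formula is applied to kern r w * 2 w / (w + p), whose value at
  \<open>p\<close> is kern r p, on the triangle between the rays with a horizontal third side;
  \<open>- p\<close> lies in the lower half plane.\<close>

lemma ray_residue:
  fixes p :: complex
  assumes r: "0 < r" "r < 1" and \<theta>: "0 < \<theta>" "\<theta> < pi / 2"
    and p: "Im (p * cis (- \<theta>)) > 0" "Im (p * cis \<theta>) > 0"
  defines "h \<equiv> (\<lambda>w. kern r w * (2 * w / (w\<^sup>2 - p\<^sup>2)))"
  shows "ray_integrable h \<theta>" and "ray_integrable h (pi - \<theta>)"
    and "ray h \<theta> - ray h (pi - \<theta>) = 2 * pi * \<i> * kern r p"
proof -
  have sin0: "sin \<theta> > 0" using \<theta> by (intro sin_gt_zero) auto
  have cos0: "cos \<theta> > 0" using \<theta> by (intro cos_gt_zero_pi) auto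
  have "Im (p * cis (- \<theta>)) + Im (p * cis \<theta>) = 2 * cos \<theta> * Im p" by (simp add: algebra_simps)
  hence "2 * cos \<theta> * Im p > 0" using p by linarith
  hence Imp: "Im p > 0" using cos0 by (simp add: zero_less_mult_iff)
  hence p0: "p \<noteq> 0" by auto
  define C where "C = r / (1 - r)"
  have C: "C > 0" using r by (simp add: C_def)
  \<comment> \<open>|w| \<ge> 2 |p| gives |w^2 - p^2| \<ge> |w|^2 / 2, and |w| \<ge> 1 then bounds
    the rational factor by 4. The other factor 2 comes from e^(-y) \<le> 2 / y^2.\<close>
  have bound: "norm (h w) \<le> 8 * C / (2 * pi * Im w)\<^sup>2" if w: "Im w > 0" "norm w \<ge> 2 * norm p + 1" for w
  proof -
    have w1: "norm w \<ge> 1" using w(2) norm_ge_zero[of p] by linarith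
    have "(2 * norm p)\<^sup>2 \<le> (norm w)\<^sup>2" using w by (intro power_mono) auto
    hence "4 * norm p ^ 2 \<le> norm w ^ 2" by (simp add: power_mult_distrib)
    moreover have "norm (w\<^sup>2 - p\<^sup>2) \<ge> norm w ^ 2 - norm p ^ 2"
      using norm_triangle_ineq2[of "w\<^sup>2" "p\<^sup>2"] by (simp add: norm_power)
    ultimately have n: "norm (w\<^sup>2 - p\<^sup>2) \<ge> norm w ^ 2 / 2" using zero_le_power2[of "norm w"] by linarith
    have "norm (2 * w / (w\<^sup>2 - p\<^sup>2)) = 2 * norm w / norm (w\<^sup>2 - p\<^sup>2)" by (simp add: norm_divide norm_mult)
    also have "\<dots> \<le> 2 * norm w / (norm w ^ 2 / 2)" using n w1 by (intro divide_left_mono mult_pos_pos) auto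
    also have "\<dots> = 4 / norm w" using w1 by (simp add: power2_eq_square field_simps)
    also have "\<dots> \<le> 4 / 1" using w1 by (intro divide_left_mono) auto
    finally have A: "norm (2 * w / (w\<^sup>2 - p\<^sup>2)) \<le> 4" by simp
    have "norm (kern r w) \<le> C * exp (- (2 * pi * Im w))"
      unfolding C_def using r w by (intro norm_kern_le) auto
    also have "\<dots> \<le> C * (2 / (2 * pi * Im w)\<^sup>2)"
      using exp_minus_le_power[of "2 * pi * Im w" 2] C w by (intro mult_left_mono) (auto simp: fact_2)
    finally have "norm (h w) \<le> (C * (2 / (2 * pi * Im w)\<^sup>2)) * 4"
      unfolding h_def norm_mult[of "kern r w"] using A C by (intro mult_mono) auto
    thus ?thesis by simp
  qed
  have rays: "ray_integrable h \<phi>" if \<phi>: "sin \<phi> = sin \<theta>" "Im (p * cis (- \<phi>)) \<noteq> 0" for \<phi>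
    unfolding ray_integrable_def
  proof (rule integrable_quadratic_decay[of _ "2 * norm p + 1"])
    have Im: "Im (of_real t * cis \<phi>) = t * sin \<theta>" for t using \<phi> by simp
    have ne: "(of_real t * cis \<phi>)\<^sup>2 - p\<^sup>2 \<noteq> 0" for t
    proof
      assume "(of_real t * cis \<phi>)\<^sup>2 - p\<^sup>2 = 0"
      hence "p = of_real t * cis \<phi> \<or> p = - (of_real t * cis \<phi>)" by (auto simp: power2_eq_iff)
      hence "p * cis (- \<phi>) = of_real t \<or> p * cis (- \<phi>) = - of_real t" by (auto simp: mult.assoc cis_mult)
      hence "Im (p * cis (- \<phi>)) = 0" by (elim disjE; simp only:) simp_all
      with \<phi>(2) show False by contradiction
    qed
    have "continuous_on {0..} (\<lambda>t. kern r (of_real t * cis \<phi>))"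
      by (rule continuous_on_compose2[OF kern_continuous[OF r]]) (use sin0 \<phi>(1) in \<open>auto intro!: continuous_intros\<close>)
    thus "continuous_on {0..} (\<lambda>t. h (of_real t * cis \<phi>) * cis \<phi>)"
      unfolding h_def using ne by (intro continuous_intros) auto
    show "norm (h (of_real t * cis \<phi>) * cis \<phi>) \<le> 8 * C / (2 * pi * sin \<theta>)\<^sup>2 / t\<^sup>2" if "t \<ge> 2 * norm p + 1" for t
    proof -
      have t: "t > 0" using that norm_ge_zero[of p] by linarith
      show ?thesis using bound[of "of_real t * cis \<phi>"] that t sin0 unfolding Im
        by (simp add: norm_mult power_mult_distrib mult_ac)
    qed
    show "2 * norm p + 1 > 0" using norm_ge_zero[of p] by linarith
  qed
  have "Im (p * cis (- (pi - \<theta>))) = - Im (p * cis \<theta>)" by (simp add: algebra_simps)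
  hence p': "Im (p * cis (- (pi - \<theta>))) < 0" using p by simp
  show int1: "ray_integrable h \<theta>" using p by (intro rays) auto
  show int2: "ray_integrable h (pi - \<theta>)" using p' by (intro rays) auto
  \<comment> \<open>Chosen so that the horizontal side, at height R sin \<theta>, passes above
    \<open>p\<close> and lies where \<open>bound\<close> applies.\<close>
  define R0 where "R0 = (2 * norm p + 1) / sin \<theta>"
  have R: "R > 0" "R * sin \<theta> \<ge> 2 * norm p + 1" if "R \<ge> R0" for R
  proof -
    show *: "R * sin \<theta> \<ge> 2 * norm p + 1" using that sin0 by (simp add: R0_def field_simps)
    have "2 * norm p + 1 > 0" using norm_ge_zero[of p] by linarith
    hence "R * sin \<theta> > 0" using * by linarith
    thus "R > 0" using sin0 by (simp add: zero_less_mult_iff)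
  qed
  have Imseg: "Im z = R * sin \<theta>" if "z \<in> closed_segment (of_real R * cis \<theta>) (of_real R * cis (pi - \<theta>))" for z R
  proof -
    from that obtain u where u: "z = (1 - u) *\<^sub>R (of_real R * cis \<theta>) + u *\<^sub>R (of_real R * cis (pi - \<theta>))"
      by (auto simp: closed_segment_def)
    show ?thesis unfolding u by (simp add: algebra_simps)
  qed
  show "ray h \<theta> - ray h (pi - \<theta>) = 2 * pi * \<i> * kern r p"
  proof (rule ray_triangle[OF int1 int2, of R0])
    fix R z assume RR: "R \<ge> R0" and z: "z \<in> closed_segment (of_real R * cis \<theta>) (of_real R * cis (pi - \<theta>))"
    note RR = R[OF RR]
    have Im: "Im z = R * sin \<theta>" by (rule Imseg[OF z])
    have "norm z \<ge> 2 * norm p + 1" using RR abs_Im_le_cmod[of z] unfolding Im by linarith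
    thus "norm (h z) \<le> 8 * C / (2 * pi * sin \<theta>)\<^sup>2 / R\<^sup>2"
      using bound[of z] RR sin0 unfolding Im by (simp add: power_mult_distrib mult_ac)
  next
    fix R assume "R \<ge> R0"
    note RR = R[OF this]
    define b where "b = of_real R * cis \<theta>"
    define c where "c = of_real R * cis (pi - \<theta>)"
    define f where "f = (\<lambda>w. kern r w * (2 * w / (w + p)))"
    \<comment> \<open>The first half plane is the domain of the kernel, the second excludes
      \<open>- p\<close>; their intersection still contains the closed upper half plane.\<close>
    define S where "S = {w. Im w > ln r / (2 * pi)} \<inter> {w. Im w > - Im p}"
    have lnr: "ln r / (2 * pi) < 0" using r by (intro divide_neg_pos) auto
    have S: "open S" "convex S" unfolding S_def
      by (auto intro!: open_Int convex_Int open_halfspace_Im_gt convex_halfspace_Im_gt)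
    have f: "f holomorphic_on S" unfolding f_def
    proof (intro holomorphic_intros kern_holomorphic r)
      fix w assume w: "w \<in> S"
      thus "Im w > ln r / (2 * pi)" by (simp add: S_def)
      show "w + p \<noteq> 0"
      proof
        assume "w + p = 0"
        hence "Im (w + p) = 0" by simp
        with w show False by (simp add: S_def)
      qed
    qed
    have hf: "h = (\<lambda>w. f w / (w - p))"
    proof
      fix w
      have "w\<^sup>2 - p\<^sup>2 = (w + p) * (w - p)" by (simp add: power2_eq_square algebra_simps)
      thus "h w = f w / (w - p)" unfolding h_def f_def by simp
    qed
    have fp: "f p = kern r p" using p0 by (simp add: f_def)
    \<comment> \<open>The open triangle as an intersection of half planes. As it is open and
      contained in the hull, it puts \<open>p\<close> into the interior.\<close>
    define U where "U = {w. Im (w * cis (- \<theta>)) > 0} \<inter> {w. Im (w * cis \<theta>) > 0} \<inter> {w. Im w < R * sin \<theta>}"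
    have Uo: "open U" unfolding U_def
      by (intro open_Int open_Collect_less continuous_intros)
    have pU: "p \<in> U"
    proof -
      have "Im p < R * sin \<theta>" using RR abs_Im_le_cmod[of p] norm_ge_zero[of p] by linarith
      thus ?thesis using p by (simp add: U_def)
    qed
    have hull: "U \<subseteq> convex hull {0, b, c}"
    proof
      fix w assume w: "w \<in> U"
      \<comment> \<open>Solution of w = u b + v c: the real part gives (u - v) R cos \<theta>, the
        imaginary part (u + v) R sin \<theta>.\<close>
      define u where "u = (Im w / sin \<theta> + Re w / cos \<theta>) / (2 * R)"
      define v where "v = (Im w / sin \<theta> - Re w / cos \<theta>) / (2 * R)"
      have "u \<ge> 0"
      proof -
        have "Im w * cos \<theta> + Re w * sin \<theta> > 0" using w by (simp add: U_def algebra_simps)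
        moreover have "u = (Im w * cos \<theta> + Re w * sin \<theta>) / (2 * R * sin \<theta> * cos \<theta>)"
          using sin0 cos0 RR by (simp add: u_def field_simps)
        ultimately show ?thesis using sin0 cos0 RR by simp
      qed
      moreover have "v \<ge> 0"
      proof -
        have "Im w * cos \<theta> - Re w * sin \<theta> > 0" using w by (simp add: U_def algebra_simps)
        moreover have "v = (Im w * cos \<theta> - Re w * sin \<theta>) / (2 * R * sin \<theta> * cos \<theta>)"
          using sin0 cos0 RR by (simp add: v_def field_simps)
        ultimately show ?thesis using sin0 cos0 RR by simp
      qed
      moreover have "u + v \<le> 1"
      proof -
        have "u + v = Im w / (R * sin \<theta>)" using RR sin0 by (simp add: u_def v_def field_simps)
        thus ?thesis using w RR sin0 by (simp add: U_def)
      qed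
      moreover have "w = (1 - u - v) *\<^sub>R 0 + u *\<^sub>R b + v *\<^sub>R c"
      proof (rule complex_eqI)
        have "Re ((1 - u - v) *\<^sub>R 0 + u *\<^sub>R b + v *\<^sub>R c) = (u - v) * R * cos \<theta>"
          by (simp add: b_def c_def algebra_simps)
        also have "u - v = Re w / cos \<theta> / R" using RR by (simp add: u_def v_def field_simps)
        finally show "Re w = Re ((1 - u - v) *\<^sub>R 0 + u *\<^sub>R b + v *\<^sub>R c)" using RR cos0 by simp
        have "Im ((1 - u - v) *\<^sub>R 0 + u *\<^sub>R b + v *\<^sub>R c) = (u + v) * R * sin \<theta>"
          by (simp add: b_def c_def algebra_simps)
        also have "u + v = Im w / sin \<theta> / R" using RR by (simp add: u_def v_def field_simps)
        finally show "Im w = Im ((1 - u - v) *\<^sub>R 0 + u *\<^sub>R b + v *\<^sub>R c)" using RR sin0 by simp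
      qed
      ultimately show "w \<in> convex hull {0, b, c}" unfolding convex_hull_3
        by (intro CollectI exI[of _ "1 - u - v"] exI[of _ u] exI[of _ v]) auto
    qed
    have pint: "p \<in> interior (convex hull {0, b, c})"
      using interior_maximal[OF hull Uo] pU by blast
    have ImS: "w \<in> S" if "Im w \<ge> 0" for w using that lnr Imp by (simp add: S_def)
    define g where "g = linepath 0 b +++ linepath b c +++ linepath c 0"
    have "w \<in> S \<and> w \<noteq> p" if "w \<in> path_image g" for w
    proof -
      from that have "w \<in> closed_segment 0 b \<union> closed_segment b c \<union> closed_segment c 0"
        by (auto simp: g_def path_image_join)
      then consider s where "w = of_real s * cis \<theta>" "s \<ge> 0" | "Im w = R * sin \<theta>" | s where "w = of_real s * cis (pi - \<theta>)" "s \<ge> 0"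
      proof (elim UnE)
        assume "w \<in> closed_segment 0 b"
        then obtain u where "w = u *\<^sub>R b" "u \<ge> 0" by (auto simp: closed_segment_def)
        thus ?thesis using that(1)[of "u * R"] RR by (simp add: b_def scaleR_conv_of_real)
      next
        assume "w \<in> closed_segment b c"
        thus ?thesis using that(2) Imseg[of w R] by (simp add: b_def c_def)
      next
        assume "w \<in> closed_segment c 0"
        hence "w \<in> closed_segment 0 c" by (simp add: closed_segment_commute)
        then obtain u where "w = u *\<^sub>R c" "u \<ge> 0" by (auto simp: closed_segment_def)
        thus ?thesis using that(3)[of "u * R"] RR by (simp add: c_def scaleR_conv_of_real)
      qed
      thus ?thesis
      proof cases
        case 1
        have "Im (w * cis (- \<theta>)) = 0" unfolding 1 by (simp add: mult.assoc cis_mult)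
        hence "w \<noteq> p" using p by auto
        thus ?thesis using 1 sin0 by (auto intro!: ImS)
      next
        case 2
        thus ?thesis using pU RR sin0 by (auto intro!: ImS simp: U_def)
      next
        case 3
        have "Im (w * cis (- (pi - \<theta>))) = 0" unfolding 3 by (simp add: mult.assoc cis_mult)
        hence "w \<noteq> p" using p' by auto
        thus ?thesis using 3 sin0 by (auto intro!: ImS)
      qed
    qed
    hence img: "path_image g \<subseteq> S - {p}" by blast
    have "((\<lambda>w. f w / (w - p)) has_contour_integral (2 * pi * \<i> * winding_number g p * f p)) g"
      by (rule Cauchy_integral_formula_convex_simple[OF S(2) f])
         (use img S(1) ImS[of p] Imp in \<open>auto simp: g_def interior_open\<close>)
    moreover have "winding_number g p = 1"
    proof -
      \<comment> \<open>The sign fixes the orientation: \<open>p\<close> lies to the left of the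
        side from 0 to \<open>b\<close>, so the triangle is run through counterclockwise.\<close>
      have "Im ((b - 0) * cnj (b - p)) = R * Im (p * cis (- \<theta>))"
        by (simp add: b_def algebra_simps)
      thus ?thesis unfolding g_def using winding_number_triangle[OF pint] p RR by simp
    qed
    ultimately show "(h has_contour_integral (2 * pi * \<i> * kern r p))
      (linepath 0 (of_real R * cis \<theta>) +++ linepath (of_real R * cis \<theta>) (of_real R * cis (pi - \<theta>)) +++ linepath (of_real R * cis (pi - \<theta>)) 0)"
      unfolding hf g_def b_def c_def fp by simp
  qed
qed

section \<open>The meromorphic integrand\<close>

text \<open>The Weierstrass bound for the series in \<open>H\<close> is uniform only on bounded
  parts of the sector.\<close>

lemma continuous_on_ball_exhaust:
  fixes f :: "'a::real_normed_vector \<Rightarrow> 'b::topological_space"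
  assumes "\<And>R. continuous_on (S \<inter> cball 0 R) f"
  shows "continuous_on S f"
  unfolding continuous_on_def
proof
  fix z assume z: "z \<in> S"
  define R where "R = norm z + 1"
  have "(f \<longlongrightarrow> f z) (at z within S \<inter> cball 0 R)"
    using assms[of R] z by (auto simp: continuous_on_def R_def)
  also have "at z within S \<inter> cball 0 R = at z within S"
    by (rule at_within_nhd[of _ "ball 0 R"]) (auto simp: R_def)
  finally show "(f \<longlongrightarrow> f z) (at z within S)" .
qed

locale lambert =
  fixes k :: nat and x :: real
  assumes odd_k: "odd k" and x_pos: "x > 0"
begin

text \<open>
  Off the origin, \<open>exp (x w^k) = 1\<close> holds where \<open>w^k = \<plusminus> i pole m\<close>; of these points, \<open>pt m l\<close>
  (\<open>l < k\<close>) below are the ones in the upper half plane. \<open>H\<close> continues \<open>h\<close> from the positive real axis.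
\<close>

definition pole :: "nat \<Rightarrow> real" where
  "pole m = 2 * pi * real (Suc m) / x"

definition G :: "nat \<Rightarrow> complex \<Rightarrow> complex" where
  "G m w = 2 * of_nat k * w ^ (2 * k - 1) / (w ^ (2 * k) + of_real (pole m ^ 2))"

text \<open>Stated by its expansion and not in closed form: this is continuous at 0, where the two
  parts of the closed form blow up, and it shows the three pieces that are integrated
  separately.\<close>

definition H :: "complex \<Rightarrow> complex" where
  "H w = of_nat k * (w / (w\<^sup>2 + 1)) - of_nat k * of_real x / 2 * w ^ (k - 1) + (\<Sum>m. G m w)"

text \<open>Half the argument pi/(2k) of the first singular ray. Up to this angle w^(2k) stays in
  the closed right half plane, so that no denominator of \<open>G\<close> is smaller than at w =
  0.\<close>

definition \<theta> :: real where "\<theta> = pi / (4 * real k)"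

lemma k_pos: "k > 0" using odd_k by (auto elim: oddE)

lemma theta: "0 < \<theta>" "\<theta> \<le> pi / 4" "\<theta> < pi / 2"
  using k_pos by (auto simp: \<theta>_def field_simps)

lemma pole_pos: "pole m > 0"
  using x_pos by (simp add: pole_def)

lemma summable_pole: "summable (\<lambda>m. 1 / pole m ^ 2)"
proof -
  have "summable (\<lambda>m. x\<^sup>2 * (1 / (2 * pi * real (Suc m)) ^ 2))"
    by (intro summable_mult summable_inverse_two_pi_power) auto
  thus ?thesis by (simp add: pole_def power_divide)
qed

lemma sector_power:
  assumes w: "w \<in> sector 0 \<theta>"
  shows "Re (w ^ (2 * k)) \<ge> 0" "Re (w\<^sup>2) \<ge> 0" "Re (w ^ k) \<ge> norm w ^ k / 2"
proof -
  obtain t \<phi> where t: "w = of_real t * cis \<phi>" "t \<ge> 0" "0 \<le> \<phi>" "\<phi> \<le> \<theta>"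
    using w by (auto simp: sector_def)
  have p: "Re (w ^ n) = t ^ n * cos (real n * \<phi>)" for n
    unfolding t(1) power_mult_distrib by (simp add: Complex.DeMoivre flip: of_real_power)
  have c: "0 \<le> real n * \<phi> \<and> real n * \<phi> \<le> real n * (pi / (4 * real k))" for n
    using t by (intro conjI mult_left_mono) (auto simp: \<theta>_def)
  have e: "real (2 * k) * (pi / (4 * real k)) = pi / 2" using k_pos by (simp add: field_simps)
  have "0 \<le> real (2 * k) * \<phi>" "real (2 * k) * \<phi> \<le> pi / 2" using c[of "2 * k"] unfolding e by blast+
  hence "cos (real (2 * k) * \<phi>) \<ge> 0" using pi_gt_zero by (intro cos_ge_zero) linarith+
  thus "Re (w ^ (2 * k)) \<ge> 0" unfolding p using t by simp
  have "2 * \<phi> \<le> pi / 2" using t theta by simp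
  thus "Re (w\<^sup>2) \<ge> 0" unfolding p using t
    by (intro mult_nonneg_nonneg cos_ge_zero) auto
  have "real k * (pi / (4 * real k)) = pi / 4" using k_pos by simp
  \<comment> \<open>The angle pi/4 is relaxed to pi/3 because the cosine of the latter is
    1/2.\<close>
  hence "real k * \<phi> \<le> pi / 3" using c[of k] pi_gt_zero by linarith
  hence "cos (pi / 3) \<le> cos (real k * \<phi>)" using c[of k] by (intro cos_monotone_0_pi_le) auto
  hence "t ^ k * (1 / 2) \<le> t ^ k * cos (real k * \<phi>)" using t by (intro mult_left_mono) (auto simp: cos_60)
  thus "Re (w ^ k) \<ge> norm w ^ k / 2" unfolding p using t by (simp add: t(1) norm_mult)
qed

lemma G_denom_ge:
  assumes "Re (w ^ (2 * k)) \<ge> 0"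
  shows "norm (w ^ (2 * k) + of_real (pole m ^ 2)) \<ge> pole m ^ 2"
proof -
  have "pole m ^ 2 \<le> Re (w ^ (2 * k) + of_real (pole m ^ 2))"
    using assms by (simp flip: of_real_power)
  also have "\<dots> \<le> norm (w ^ (2 * k) + of_real (pole m ^ 2))" by (rule complex_Re_le_cmod)
  finally show ?thesis .
qed

lemma norm_G_le:
  assumes "Re (w ^ (2 * k)) \<ge> 0"
  shows "norm (G m w) \<le> 2 * real k * norm w ^ (2 * k - 1) * (1 / pole m ^ 2)"
proof -
  have "norm (G m w) = 2 * real k * norm w ^ (2 * k - 1) / norm (w ^ (2 * k) + of_real (pole m ^ 2))"
    by (simp add: G_def norm_divide norm_mult norm_power)
  also have "\<dots> \<le> 2 * real k * norm w ^ (2 * k - 1) / pole m ^ 2"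
    using G_denom_ge[OF assms, of m] pole_pos[of m] by (intro divide_left_mono mult_pos_pos) auto
  finally show ?thesis by simp
qed

lemma G_continuous:
  assumes "\<And>w. w \<in> A \<Longrightarrow> Re (w ^ (2 * k)) \<ge> 0"
  shows "continuous_on A (G m)"
proof -
  have "w ^ (2 * k) + of_real (pole m ^ 2) \<noteq> 0" if "w \<in> A" for w
    using G_denom_ge[OF assms[OF that], of m] pole_pos[of m] by (metis norm_zero not_le zero_less_power)
  thus ?thesis unfolding G_def[abs_def] by (intro continuous_intros) auto
qed

lemma H_continuous: "continuous_on (sector 0 \<theta>) H"
proof (rule continuous_on_ball_exhaust)
  fix R :: real
  let ?S = "sector 0 \<theta> \<inter> cball 0 R"
  have Re: "Re (w ^ (2 * k)) \<ge> 0" if "w \<in> ?S" for w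
    using sector_power(1) that by blast
  have "continuous_on ?S (\<lambda>w. \<Sum>m. G m w)"
  proof (rule uniform_limit_theorem)
    show "uniform_limit ?S (\<lambda>n w. \<Sum>m<n. G m w) (\<lambda>w. \<Sum>m. G m w) sequentially"
    proof (rule Weierstrass_m_test)
      fix m w assume w: "w \<in> ?S"
      have "norm (G m w) \<le> 2 * real k * norm w ^ (2 * k - 1) * (1 / pole m ^ 2)"
        by (rule norm_G_le[OF Re[OF w]])
      also have "\<dots> \<le> 2 * real k * R ^ (2 * k - 1) * (1 / pole m ^ 2)"
        using w by (intro mult_right_mono mult_left_mono power_mono) auto
      finally show "norm (G m w) \<le> 2 * real k * R ^ (2 * k - 1) * (1 / pole m ^ 2)" .
    next
      show "summable (\<lambda>m. 2 * real k * R ^ (2 * k - 1) * (1 / pole m ^ 2))"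
        by (intro summable_mult summable_pole)
    qed
    show "\<forall>\<^sub>F n in sequentially. continuous_on ?S (\<lambda>w. \<Sum>m<n. G m w)"
      using Re by (intro always_eventually allI continuous_on_sum G_continuous) auto
  qed auto
  moreover have "w\<^sup>2 + 1 \<noteq> 0" if "w \<in> ?S" for w
  proof
    assume "w\<^sup>2 + 1 = 0"
    hence "Re (w\<^sup>2 + 1) = 0" by simp
    moreover have "Re (w\<^sup>2) \<ge> 0" using that by (intro sector_power) auto
    ultimately show False by simp
  qed
  ultimately show "continuous_on ?S H" unfolding H_def[abs_def]
    by (intro continuous_intros) auto
qed

lemma exp_sector_ne_1:
  assumes w: "w \<in> sector 0 \<theta>" "w \<noteq> 0"
  shows "exp (of_real x * w ^ k) \<noteq> 1"
proof
  assume "exp (of_real x * w ^ k) = 1"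
  hence "norm (exp (of_real x * w ^ k)) = 1" by simp
  hence "x * Re (w ^ k) = 0" by simp
  moreover have "Re (w ^ k) > 0" using sector_power(3)[OF w(1)] w(2)
    by (intro less_le_trans[OF _ sector_power(3)[OF w(1)]]) auto
  ultimately show False using x_pos by simp
qed

text \<open>The partial fractions at u = x w^k are multiplied by du/dw = k x w^(k-1). The term 1/u
  becomes k/w, which merges with - k / (w (w^2 + 1)) into k w / (w^2 + 1).\<close>

lemma H_closed_form:
  assumes w: "w \<noteq> 0" "w\<^sup>2 + 1 \<noteq> 0" and e: "exp (of_real x * w ^ k) \<noteq> 1"
  shows "H w = of_nat k * of_real x * w ^ (k - 1) / (exp (of_real x * w ^ k) - 1) - of_nat k / (w * (w\<^sup>2 + 1))"
proof -
  define u where "u = of_real x * w ^ k"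
  define E where "E = 1 / (exp u - 1)"
  have u0: "u \<noteq> 0" using w x_pos by (simp add: u_def)
  have wk: "w ^ k = w * w ^ (k - 1)" using k_pos by (cases k) auto
  have "(\<lambda>m. of_nat k * of_real x * w ^ (k - 1) * (2 * u / (u\<^sup>2 + of_real (2 * pi * real (Suc m)) ^ 2))) sums
      (of_nat k * of_real x * w ^ (k - 1) * (E - 1 / u + 1 / 2))"
    unfolding E_def using e by (intro sums_mult exp_partial_fractions) (auto simp: u_def)
  also have "(\<lambda>m. of_nat k * of_real x * w ^ (k - 1) * (2 * u / (u\<^sup>2 + of_real (2 * pi * real (Suc m)) ^ 2))) = (\<lambda>m. G m w)"
  proof
    fix m
    have p: "2 * pi * real (Suc m) = x * pole m" using x_pos by (simp add: pole_def)
    have "u\<^sup>2 + of_real (2 * pi * real (Suc m)) ^ 2 = of_real x ^ 2 * (w ^ (2 * k) + of_real (pole m ^ 2))"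
      unfolding p u_def power_even_eq[of w k] by (simp add: power_mult_distrib distrib_left)
    hence "of_nat k * of_real x * w ^ (k - 1) * (2 * u / (u\<^sup>2 + of_real (2 * pi * real (Suc m)) ^ 2)) =
      (of_real x ^ 2 * (2 * of_nat k * (w ^ (k - 1) * w ^ k))) / (of_real x ^ 2 * (w ^ (2 * k) + of_real (pole m ^ 2)))"
      by (simp add: u_def power2_eq_square)
    also have "\<dots> = 2 * of_nat k * (w ^ (k - 1) * w ^ k) / (w ^ (2 * k) + of_real (pole m ^ 2))"
      using x_pos by simp
    also have "w ^ (k - 1) * w ^ k = w ^ (2 * k - 1)"
      using k_pos by (simp flip: power_add) (simp add: mult_2)
    finally show "of_nat k * of_real x * w ^ (k - 1) * (2 * u / (u\<^sup>2 + of_real (2 * pi * real (Suc m)) ^ 2)) = G m w"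
      by (simp add: G_def)
  qed
  finally have S: "(\<Sum>m. G m w) = of_nat k * of_real x * w ^ (k - 1) * (E - 1 / u + 1 / 2)"
    by (simp add: sums_iff)
  have "of_nat k * of_real x * w ^ (k - 1) * (1 / u) = of_nat k / w"
    using w u0 x_pos by (simp add: u_def wk)
  hence "(\<Sum>m. G m w) = of_nat k * of_real x * w ^ (k - 1) * E - of_nat k / w + of_nat k * of_real x * w ^ (k - 1) / 2"
    unfolding S by (simp add: algebra_simps)
  moreover have "of_nat k * (w / (w\<^sup>2 + 1)) - of_nat k / w = - of_nat k / (w * (w\<^sup>2 + 1))"
    using w by (simp add: divide_simps) (simp add: algebra_simps power2_eq_square)
  ultimately show ?thesis unfolding H_def u_def[symmetric] E_def by (simp add: algebra_simps)
qed

lemma sector_sq_plus_1: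
  assumes "w \<in> sector 0 \<theta>"
  shows "norm (w\<^sup>2 + 1) \<ge> norm w ^ 2" "w\<^sup>2 + 1 \<noteq> 0"
proof -
  have R: "Re (w\<^sup>2) \<ge> 0" by (rule sector_power(2)[OF assms])
  have "(norm (w\<^sup>2)) ^ 2 \<le> (norm (w\<^sup>2 + 1)) ^ 2"
    unfolding cmod_power2 using R by (simp add: power2_eq_square algebra_simps)
  hence "norm (w\<^sup>2) \<le> norm (w\<^sup>2 + 1)" by (rule power2_le_imp_le) auto
  thus "norm (w\<^sup>2 + 1) \<ge> norm w ^ 2" by (simp add: norm_power)
  show "w\<^sup>2 + 1 \<noteq> 0"
  proof
    assume "w\<^sup>2 + 1 = 0"
    hence "Re (w\<^sup>2 + 1) = 0" by simp
    with R show False by simp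
  qed
qed

definition H_bound :: real where "H_bound = 8 * real k / x + real k"

lemma H_decay:
  assumes w: "w \<in> sector 0 \<theta>" "norm w \<ge> 1"
  shows "norm (H w) \<le> H_bound / norm w ^ 2"
proof -
  define s where "s = norm w"
  have s: "s \<ge> 1" using w by (simp add: s_def)
  have w0: "w \<noteq> 0" using w by auto
  define y where "y = x * Re (w ^ k)"
  have y: "y \<ge> x * (s ^ k / 2)" unfolding y_def s_def using sector_power(3)[OF w(1)] x_pos by (intro mult_left_mono) auto
  have y0: "x * (s ^ k / 2) > 0" using x_pos s by simp
  \<comment> \<open>The quadratic Taylor term is what gives s^(-k-1) \<le> s^(-2) for the quotient;
    the linear one would leave only 1/s.\<close>
  have "(x * (s ^ k / 2))\<^sup>2 / 2 \<le> y\<^sup>2 / 2" using y y0 by (intro divide_right_mono power_mono) auto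
  also have "\<dots> \<le> exp y - 1" using exp_lower_Taylor_quadratic[of y] y y0 by simp
  also have "\<dots> = norm (exp (of_real x * w ^ k)) - norm (1::complex)" by (simp add: y_def)
  also have "\<dots> \<le> norm (exp (of_real x * w ^ k) - 1)" by (rule norm_triangle_ineq2)
  finally have den: "x\<^sup>2 * s ^ (2 * k) / 8 \<le> norm (exp (of_real x * w ^ k) - 1)"
    unfolding power_even_eq[of s k] by (simp add: power_mult_distrib power_divide)
  have "norm (of_nat k * of_real x * w ^ (k - 1) / (exp (of_real x * w ^ k) - 1)) =
      real k * x * s ^ (k - 1) / norm (exp (of_real x * w ^ k) - 1)"
    using x_pos by (simp add: norm_divide norm_mult norm_power s_def)
  also have "\<dots> \<le> real k * x * s ^ (k - 1) / (x\<^sup>2 * s ^ (2 * k) / 8)"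
    using den x_pos s by (intro divide_left_mono mult_pos_pos less_le_trans[OF _ den]) auto
  also have "\<dots> = 8 * real k / x * (s ^ (k - 1) / s ^ (2 * k))"
    using x_pos by (simp add: power2_eq_square field_simps)
  also have "s ^ (k - 1) / s ^ (2 * k) \<le> 1 / s ^ 2"
  proof -
    have "s ^ (k - 1) * s ^ 2 = s ^ (k + 1)" using k_pos by (simp flip: power_add)
    also have "\<dots> \<le> s ^ (2 * k)" using s k_pos by (intro power_increasing) auto
    finally show ?thesis using s by (simp add: field_simps)
  qed
  hence "8 * real k / x * (s ^ (k - 1) / s ^ (2 * k)) \<le> 8 * real k / x * (1 / s ^ 2)"
    using x_pos by (intro mult_left_mono) auto
  finally have A: "norm (of_nat k * of_real x * w ^ (k - 1) / (exp (of_real x * w ^ k) - 1)) \<le> 8 * real k / x / s ^ 2" by simp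
  have "norm (of_nat k / (w * (w\<^sup>2 + 1))) = real k / (s * norm (w\<^sup>2 + 1))"
    by (simp add: norm_divide norm_mult s_def)
  also have "\<dots> \<le> real k / (1 * s ^ 2)"
    using sector_sq_plus_1[OF w(1)] s w0 by (intro divide_left_mono mult_mono mult_pos_pos) (auto simp: s_def)
  finally have B: "norm (of_nat k / (w * (w\<^sup>2 + 1))) \<le> real k / s ^ 2" by simp
  have "norm (H w) \<le> 8 * real k / x / s ^ 2 + real k / s ^ 2"
    unfolding H_closed_form[OF w0 sector_sq_plus_1(2)[OF w(1)] exp_sector_ne_1[OF w(1) w0]]
    by (rule order.trans[OF norm_triangle_ineq4 add_mono[OF A B]])
  thus ?thesis by (simp add: H_bound_def s_def add_divide_distrib)
qed

text \<open>Taken from the closed form, which avoids differentiating the series term by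
  term.\<close>

lemma H_field_differentiable:
  assumes w: "w \<in> interior (sector 0 \<theta>)" "w \<noteq> 0"
  shows "H field_differentiable at w"
proof -
  define A where "A = interior (sector 0 \<theta>) - {0}"
  have A: "open A" "w \<in> A" "A \<subseteq> sector 0 \<theta> - {0}" using w interior_subset by (auto simp: A_def)
  have nz: "v \<noteq> 0" "v\<^sup>2 + 1 \<noteq> 0" "exp (of_real x * v ^ k) \<noteq> 1" if "v \<in> A" for v
    using A(3) that sector_sq_plus_1(2)[of v] exp_sector_ne_1[of v] by blast+
  have "(\<lambda>w. of_nat k * of_real x * w ^ (k - 1) / (exp (of_real x * w ^ k) - 1) - of_nat k / (w * (w\<^sup>2 + 1))) holomorphic_on A"
    using nz by (intro holomorphic_intros) auto
  hence "H holomorphic_on A"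
    by (rule holomorphic_transform) (use H_closed_form nz in auto)
  thus ?thesis using A by (metis holomorphic_on_imp_differentiable_at)
qed

lemma sector_Im_nonneg:
  assumes "w \<in> sector \<alpha> \<beta>" "0 \<le> \<alpha>" "\<beta> \<le> pi"
  shows "Im w \<ge> 0"
  using assms by (auto simp: sector_def intro!: mult_nonneg_nonneg sin_ge_zero)

lemma norm_kern_le_const:
  assumes "0 < r" "r < 1" "Im w \<ge> 0"
  shows "norm (kern r w) \<le> r / (1 - r)"
proof -
  have "norm (kern r w) \<le> r / (1 - r) * exp (- (2 * pi * Im w))" by (rule norm_kern_le[OF assms])
  also have "\<dots> \<le> r / (1 - r) * 1" using assms by (intro mult_left_mono) auto
  finally show ?thesis by simp
qed

lemma ray_H_rotate:
  assumes r: "0 < r" "r < 1"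
  shows "ray (\<lambda>w. H w * kern r w) 0 = ray (\<lambda>w. H w * kern r w) \<theta>"
proof (rule ray_rotate)
  have Im: "Im w \<ge> 0" if "w \<in> sector 0 \<theta>" for w
    using that theta by (intro sector_Im_nonneg[of w 0 \<theta>]) auto
  show "0 < \<theta>" "\<theta> < 0 + pi" using theta by auto
  show "continuous_on (sector 0 \<theta>) (\<lambda>w. H w * kern r w)"
    by (intro continuous_intros H_continuous continuous_on_subset[OF kern_continuous[OF r]]) (use Im in auto)
  fix z assume z: "z \<in> interior (sector 0 \<theta>)" "z \<noteq> 0"
  have "Im z \<ge> 0" using z interior_subset by (intro Im) blast
  hence "kern r field_differentiable at z" by (rule kern_field_differentiable[OF r])
  thus "(\<lambda>w. H w * kern r w) field_differentiable at z"
    by (intro field_differentiable_mult H_field_differentiable z)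
next
  fix z assume z: "z \<in> sector 0 \<theta>" "norm z \<ge> 1"
  have "norm (H z * kern r z) \<le> H_bound / norm z ^ 2 * (r / (1 - r))"
    unfolding norm_mult using r z theta
    by (intro mult_mono H_decay norm_kern_le_const sector_Im_nonneg[of z 0 \<theta>])
      (auto intro: order.trans[OF norm_ge_zero H_decay])
  thus "norm (H z * kern r z) \<le> H_bound * (r / (1 - r)) / norm z ^ 2" by (simp add: mult.commute)
qed

end

section \<open>Calculus of ray integrals and the reflection principle\<close>

lemma ray_cong:
  assumes "\<And>t. t > 0 \<Longrightarrow> f (of_real t * cis \<phi>) = g (of_real t * cis \<phi>)"
  shows "ray f \<phi> = ray g \<phi>" "ray_integrable f \<phi> \<longleftrightarrow> ray_integrable g \<phi>"
  unfolding ray_def ray_integrable_def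
  by (rule set_lebesgue_integral_cong set_integrable_cong; use assms in simp)+

lemma ray_add:
  assumes "ray_integrable f \<phi>" "ray_integrable g \<phi>"
  shows "ray_integrable (\<lambda>w. f w + g w) \<phi>" "ray (\<lambda>w. f w + g w) \<phi> = ray f \<phi> + ray g \<phi>"
  using assms unfolding ray_def ray_integrable_def distrib_right by auto

lemma ray_diff:
  assumes "ray_integrable f \<phi>" "ray_integrable g \<phi>"
  shows "ray_integrable (\<lambda>w. f w - g w) \<phi>" "ray (\<lambda>w. f w - g w) \<phi> = ray f \<phi> - ray g \<phi>"
  using assms unfolding ray_def ray_integrable_def left_diff_distrib by auto

lemma ray_cmult:
  assumes "ray_integrable f \<phi>"
  shows "ray_integrable (\<lambda>w. c * f w) \<phi>" "ray (\<lambda>w. c * f w) \<phi> = c * ray f \<phi>"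
  using assms unfolding ray_def ray_integrable_def mult.assoc by auto

lemma ray_sum:
  assumes "\<And>l. l \<in> L \<Longrightarrow> ray_integrable (f l) \<phi>"
  shows "ray_integrable (\<lambda>w. \<Sum>l\<in>L. f l w) \<phi>" "ray (\<lambda>w. \<Sum>l\<in>L. f l w) \<phi> = (\<Sum>l\<in>L. ray (f l) \<phi>)"
proof -
  have "ray_integrable (\<lambda>w. \<Sum>l\<in>L. f l w) \<phi> \<and> ray (\<lambda>w. \<Sum>l\<in>L. f l w) \<phi> = (\<Sum>l\<in>L. ray (f l) \<phi>)"
    using assms
  proof (induction L rule: infinite_finite_induct)
    case (insert l L)
    thus ?case by (simp add: ray_add)
  qed (simp_all add: ray_def ray_integrable_def set_integrable_def)
  thus "ray_integrable (\<lambda>w. \<Sum>l\<in>L. f l w) \<phi>" "ray (\<lambda>w. \<Sum>l\<in>L. f l w) \<phi> = (\<Sum>l\<in>L. ray (f l) \<phi>)"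
    by blast+
qed

lemma ray_reflect:
  assumes "\<And>t. t > 0 \<Longrightarrow> f (- cnj (of_real t * cis \<phi>)) = - cnj (f (of_real t * cis \<phi>))"
  shows "ray f (pi - \<phi>) = cnj (ray f \<phi>)"
proof -
  have c: "cis (pi - \<phi>) = - cnj (cis \<phi>)" by (simp add: complex_eq_iff)
  have "ray f (pi - \<phi>) = (LINT t:{0<..}|lborel. cnj (f (of_real t * cis \<phi>) * cis \<phi>))"
    unfolding ray_def
  proof (rule set_lebesgue_integral_cong)
    show "\<forall>t. t \<in> {0<..} \<longrightarrow> f (of_real t * cis (pi - \<phi>)) * cis (pi - \<phi>) = cnj (f (of_real t * cis \<phi>) * cis \<phi>)"
    proof (intro allI impI)
      fix t :: real assume "t \<in> {0<..}"
      moreover have "of_real t * cis (pi - \<phi>) = - cnj (of_real t * cis \<phi>)" unfolding c by simp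
      ultimately show "f (of_real t * cis (pi - \<phi>)) * cis (pi - \<phi>) = cnj (f (of_real t * cis \<phi>) * cis \<phi>)"
        using assms[of t] by (simp add: c)
    qed
  qed auto
  also have "\<dots> = (LINT t|lborel. cnj (indicator {0<..} t *\<^sub>R (f (of_real t * cis \<phi>) * cis \<phi>)))"
    unfolding set_lebesgue_integral_def by simp
  also have "\<dots> = cnj (ray f \<phi>)"
    unfolding ray_def set_lebesgue_integral_def 
    by (rule integral_bounded_linear'[OF bounded_linear_cnj bounded_linear_cnj]) simp
  finally show ?thesis .
qed

text \<open>
  The oddness of \<open>F\<close> makes the integral along the ray \<open>pi - \<phi>\<close> the conjugate of the one along \<open>\<phi>\<close>.
\<close>

lemma Im_ray_kern:
  fixes p :: "'a \<Rightarrow> complex"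
  assumes r: "0 < r" "r < 1" and \<phi>: "0 < \<phi>" "\<phi> < pi / 2"
    and p: "\<And>l. l \<in> L \<Longrightarrow> Im (p l * cis (- \<phi>)) > 0" "\<And>l. l \<in> L \<Longrightarrow> Im (p l * cis \<phi>) > 0"
    and F: "\<And>t. t > 0 \<Longrightarrow> F (of_real t * cis \<phi>) = (\<Sum>l\<in>L. 2 * (of_real t * cis \<phi>) / ((of_real t * cis \<phi>)\<^sup>2 - p l ^ 2))"
      "\<And>t. t > 0 \<Longrightarrow> F (of_real t * cis (pi - \<phi>)) = (\<Sum>l\<in>L. 2 * (of_real t * cis (pi - \<phi>)) / ((of_real t * cis (pi - \<phi>))\<^sup>2 - p l ^ 2))"
    and refl: "\<And>t. t > 0 \<Longrightarrow> F (- cnj (of_real t * cis \<phi>)) = - cnj (F (of_real t * cis \<phi>))"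
  shows "ray_integrable (\<lambda>w. F w * kern r w) \<phi>"
    and "of_real (Im (ray (\<lambda>w. F w * kern r w) \<phi>)) = of_real pi * (\<Sum>l\<in>L. kern r (p l))"
proof -
  define h where "h = (\<lambda>l w. kern r w * (2 * w / (w\<^sup>2 - p l ^ 2)))"
  have h: "ray_integrable (h l) \<phi>" "ray_integrable (h l) (pi - \<phi>)"
     "ray (h l) \<phi> - ray (h l) (pi - \<phi>) = 2 * pi * \<i> * kern r (p l)" if "l \<in> L" for l
    unfolding h_def using ray_residue[OF r \<phi> p(1)[OF that] p(2)[OF that]] by blast+
  have sin0: "sin \<phi> > 0" using \<phi> by (intro sin_gt_zero) auto
  have eq: "F w * kern r w = (\<Sum>l\<in>L. h l w)" if "F w = (\<Sum>l\<in>L. 2 * w / (w\<^sup>2 - p l ^ 2))" for w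
    unfolding that h_def by (simp add: sum_distrib_left mult.commute)
  have 1: "ray (\<lambda>w. F w * kern r w) \<phi> = (\<Sum>l\<in>L. ray (h l) \<phi>)"
    by (subst ray_cong[of _ _ "\<lambda>w. \<Sum>l\<in>L. h l w"]) (use eq F in \<open>auto intro!: ray_sum h\<close>)
  have 2: "ray (\<lambda>w. F w * kern r w) (pi - \<phi>) = (\<Sum>l\<in>L. ray (h l) (pi - \<phi>))"
    by (subst ray_cong[of _ _ "\<lambda>w. \<Sum>l\<in>L. h l w"]) (use eq F in \<open>auto intro!: ray_sum h\<close>)
  show "ray_integrable (\<lambda>w. F w * kern r w) \<phi>"
    by (subst ray_cong(2)[of _ _ "\<lambda>w. \<Sum>l\<in>L. h l w"]) (use eq F in \<open>auto intro!: ray_sum h\<close>)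
  have "ray (\<lambda>w. F w * kern r w) (pi - \<phi>) = cnj (ray (\<lambda>w. F w * kern r w) \<phi>)"
  proof (rule ray_reflect)
    fix t :: real assume t: "t > 0"
    have "kern r (- cnj (of_real t * cis \<phi>)) = cnj (kern r (of_real t * cis \<phi>))"
      using r t sin0 by (intro kern_reflect) auto
    thus "F (- cnj (of_real t * cis \<phi>)) * kern r (- cnj (of_real t * cis \<phi>)) =
       - cnj (F (of_real t * cis \<phi>) * kern r (of_real t * cis \<phi>))"
      using refl[OF t] by simp
  qed
  hence "2 * \<i> * of_real (Im (ray (\<lambda>w. F w * kern r w) \<phi>)) =
      ray (\<lambda>w. F w * kern r w) \<phi> - ray (\<lambda>w. F w * kern r w) (pi - \<phi>)"
    by (simp add: complex_eq_iff)
  also have "\<dots> = (\<Sum>l\<in>L. ray (h l) \<phi> - ray (h l) (pi - \<phi>))" unfolding 1 2 by (simp add: sum_subtractf)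
  also have "\<dots> = (\<Sum>l\<in>L. 2 * pi * \<i> * kern r (p l))" by (rule sum.cong) (use h in auto)
  also have "\<dots> = 2 * \<i> * (of_real pi * (\<Sum>l\<in>L. kern r (p l)))" by (simp add: sum_distrib_left mult_ac)
  finally show "of_real (Im (ray (\<lambda>w. F w * kern r w) \<phi>)) = of_real pi * (\<Sum>l\<in>L. kern r (p l))"
    by simp
qed

text \<open>The logarithmic derivative of v^k + P as a product over its roots, obtained
  algebraically: 1 / (v - q) is the sum of q^(k-1-i) v^i divided by v^k - q^k, and summed over the
  roots all powers vanish except the zeroth.\<close>

lemma sum_inverse_diff_roots:
  fixes v P :: complex and q :: "nat \<Rightarrow> complex"
  assumes k: "k > 0" and q: "\<And>l. l < k \<Longrightarrow> q l = c * cis (2 * pi / real k) ^ l" and P: "c ^ k = - P" "v ^ k + P \<noteq> 0"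
  shows "(\<Sum>l<k. 1 / (v - q l)) = of_nat k * v ^ (k - 1) / (v ^ k + P)"
proof -
  define \<omega> where "\<omega> = cis (2 * pi / real k)"
  have wk: "\<omega> ^ k = 1" unfolding \<omega>_def using k by (simp add: Complex.DeMoivre)
  have qk: "q l ^ k = - P" if "l < k" for l
    unfolding q[OF that] power_mult_distrib P(1) \<omega>_def[symmetric]
    by (metis wk mult.right_neutral power_commutes power_mult power_one mult.commute)
  have inv: "1 / (v - q l) = (\<Sum>i<k. q l ^ (k - Suc i) * v ^ i) / (v ^ k + P)" if "l < k" for l
  proof -
    have "v ^ k - q l ^ k = (v - q l) * (\<Sum>i<k. q l ^ (k - Suc i) * v ^ i)" by (rule power_diff_sumr2)
    hence e: "v ^ k + P = (v - q l) * (\<Sum>i<k. q l ^ (k - Suc i) * v ^ i)" using qk[OF that] by simp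
    hence "v - q l \<noteq> 0" "(\<Sum>i<k. q l ^ (k - Suc i) * v ^ i) \<noteq> 0" using P(2) by auto
    thus ?thesis unfolding e by simp
  qed
  have pow: "(\<Sum>l<k. q l ^ j) = (if j = 0 then of_nat k else 0)" if "j < k" for j
  proof (cases "j = 0")
    case False
    have "\<omega> ^ j = exp (2 * of_real pi * \<i> * of_nat j / of_nat k)"
      unfolding \<omega>_def Complex.DeMoivre by (simp add: cis_conv_exp mult_ac)
    hence "\<omega> ^ j \<noteq> 1" using complex_root_unity_eq_1[of k j] k False that by (auto dest: dvd_imp_le)
    have "(\<Sum>l<k. q l ^ j) = (\<Sum>l<k. c ^ j * (\<omega> ^ j) ^ l)"
      by (rule sum.cong) (auto simp: q \<omega>_def power_mult_distrib power_mult[symmetric] mult.commute)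
    also have "\<dots> = c ^ j * (\<Sum>l<k. (\<omega> ^ j) ^ l)" by (simp add: sum_distrib_left)
    also have "(\<Sum>l<k. (\<omega> ^ j) ^ l) = ((\<omega> ^ j) ^ k - 1) / (\<omega> ^ j - 1)"
      using \<open>\<omega> ^ j \<noteq> 1\<close> by (rule geometric_sum)
    also have "(\<omega> ^ j) ^ k = 1" by (metis wk power_commutes power_mult mult.commute power_one)
    finally show ?thesis using False by simp
  qed auto
  have "(\<Sum>l<k. 1 / (v - q l)) = (\<Sum>l<k. \<Sum>i<k. q l ^ (k - Suc i) * v ^ i) / (v ^ k + P)"
    by (simp add: inv sum_divide_distrib)
  also have "(\<Sum>l<k. \<Sum>i<k. q l ^ (k - Suc i) * v ^ i) = (\<Sum>i<k. (\<Sum>l<k. q l ^ (k - Suc i)) * v ^ i)"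
    by (subst sum.swap) (simp add: sum_distrib_right)
  also have "\<dots> = (\<Sum>i<k. if i = k - 1 then of_nat k * v ^ i else 0)"
    by (rule sum.cong) (use pow in auto)
  also have "\<dots> = of_nat k * v ^ (k - 1)" using k by simp
  finally show ?thesis .
qed

section \<open>The three pieces of the integrand on the tilted ray\<close>

context lambert begin

definition pt :: "nat \<Rightarrow> nat \<Rightarrow> complex" where
  "pt m l = of_real (pole m powr (1 / real k)) * cis (real (2 * l + 1) * pi / (2 * real k))"

text \<open>With v = w^2 the denominator is v^k + pole^2, and the squares of the points
  \<open>pt m l\<close> are its k roots, successive ones differing by the angle 2 pi / k.\<close>

lemma G_eq_sum:
  assumes "w ^ (2 * k) + of_real (pole m ^ 2) \<noteq> 0"
  shows "G m w = (\<Sum>l<k. 2 * w / (w\<^sup>2 - pt m l ^ 2))"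
proof -
  define a where "a = pole m powr (1 / real k)"
  have a: "a ^ k = pole m" unfolding a_def using pole_pos[of m] k_pos by (simp add: powr_power)
  have "(\<Sum>l<k. 1 / (w\<^sup>2 - pt m l ^ 2)) = of_nat k * (w\<^sup>2) ^ (k - 1) / ((w\<^sup>2) ^ k + of_real (pole m ^ 2))"
  proof (rule sum_inverse_diff_roots[OF k_pos])
    have ang: "real 2 * (real (2 * l + 1) * pi / (2 * real k)) = pi / real k + real l * (2 * pi / real k)" for l
      using k_pos by (simp add: field_simps)
    show "pt m l ^ 2 = (of_real (a\<^sup>2) * cis (pi / real k)) * cis (2 * pi / real k) ^ l" for l
      by (simp only: pt_def a_def[symmetric] power_mult_distrib Complex.DeMoivre mult.assoc cis_mult ang of_real_power)
    have "(of_real (a\<^sup>2) * cis (pi / real k)) ^ k = of_real ((a ^ k)\<^sup>2) * cis pi"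
      unfolding power_mult_distrib Complex.DeMoivre using k_pos by (simp add: power_commutes flip: power_mult) (simp add: mult.commute)
    thus "(of_real (a\<^sup>2) * cis (pi / real k)) ^ k = - complex_of_real (pole m ^ 2)" unfolding a by simp
    show "(w\<^sup>2) ^ k + of_real (pole m ^ 2) \<noteq> 0" using assms by (simp add: power_mult)
  qed
  hence "2 * w * (\<Sum>l<k. 1 / (w\<^sup>2 - pt m l ^ 2)) = 2 * of_nat k * (w * (w\<^sup>2) ^ (k - 1)) / (w ^ (2 * k) + of_real (pole m ^ 2))"
    by (simp add: power_mult)
  also have "w * (w\<^sup>2) ^ (k - 1) = w ^ (2 * k - 1)"
    using k_pos by (cases k) (simp_all add: power_mult)
  finally show ?thesis unfolding G_def by (simp add: sum_distrib_left)
qed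

lemma pt_position:
  assumes "l < k"
  shows "Im (pt m l * cis (- \<theta>)) > 0" "Im (pt m l * cis \<theta>) > 0" "Im (pt m l) > 0"
proof -
  define \<psi> where "\<psi> = real (2 * l + 1) * pi / (2 * real k)"
  have a: "pole m powr (1 / real k) > 0" using pole_pos[of m] by simp
  have lk: "real (2 * l + 1) \<le> 2 * real k - 1" using assms by simp
  have d: "\<psi> - \<theta> = (real (2 * l + 1) - 1 / 2) * pi / (2 * real k)" unfolding \<psi>_def \<theta>_def
    using k_pos by (simp add: field_simps)
  have s: "\<psi> + \<theta> = (real (2 * l + 1) + 1 / 2) * pi / (2 * real k)" unfolding \<psi>_def \<theta>_def
    using k_pos by (simp add: field_simps)
  have b: "0 < c * pi / (2 * real k) \<and> c * pi / (2 * real k) < pi" if "0 < c" "c < 2 * real k" for c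
    using that k_pos by (simp add: field_simps)
  have "sin (\<psi> - \<theta>) > 0" unfolding d using lk by (intro sin_gt_zero conjunct1[OF b] conjunct2[OF b]) auto
  thus "Im (pt m l * cis (- \<theta>)) > 0" unfolding pt_def \<psi>_def[symmetric] mult.assoc cis_mult using a by simp
  have "sin (\<psi> + \<theta>) > 0" unfolding s using lk by (intro sin_gt_zero conjunct1[OF b] conjunct2[OF b]) auto
  thus "Im (pt m l * cis \<theta>) > 0" unfolding pt_def \<psi>_def[symmetric] mult.assoc cis_mult using a by simp
  have "sin \<psi> > 0" unfolding \<psi>_def using lk by (intro sin_gt_zero conjunct1[OF b] conjunct2[OF b]) auto
  thus "Im (pt m l) > 0" unfolding pt_def \<psi>_def[symmetric] using a by simp
qed

lemma sector_ray: "t \<ge> 0 \<Longrightarrow> of_real t * cis \<theta> \<in> sector 0 \<theta>"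
  unfolding sector_def using theta by (intro CollectI exI[of _ t] exI[of _ \<theta>]) auto

lemma G_denom_ne_0: "Re (w ^ (2 * k)) \<ge> 0 \<Longrightarrow> w ^ (2 * k) + of_real (pole m ^ 2) \<noteq> 0"
  using G_denom_ge[of w m] pole_pos[of m] by (metis norm_zero not_le zero_less_power)

lemma G_reflect: "G m (- cnj w) = - cnj (G m w)"
proof -
  have "odd (2 * k - 1)" using k_pos by simp
  thus ?thesis by (simp add: G_def)
qed

lemma Im_ray_G:
  assumes r: "0 < r" "r < 1"
  shows "ray_integrable (\<lambda>w. G m w * kern r w) \<theta>"
    and "of_real (Im (ray (\<lambda>w. G m w * kern r w) \<theta>)) = of_real pi * (\<Sum>l<k. kern r (pt m l))"
proof -
  have 1: "Re ((of_real t * cis \<theta>) ^ (2 * k)) \<ge> 0" if "t > 0" for t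
    using that by (intro sector_power(1) sector_ray) auto
  have 2: "Re ((of_real t * cis (pi - \<theta>)) ^ (2 * k)) \<ge> 0" if "t > 0" for t
  proof -
    have "of_real t * cis (pi - \<theta>) = - cnj (of_real t * cis \<theta>)" by (simp add: complex_eq_iff)
    thus ?thesis using 1[OF that] by (simp flip: complex_cnj_power complex_cnj_mult)
  qed
  note A = Im_ray_kern[of r \<theta> "{..<k}" "pt m" "G m", OF r theta(1) theta(3) pt_position(1,2) G_eq_sum[OF G_denom_ne_0[OF 1]] G_eq_sum[OF G_denom_ne_0[OF 2]] G_reflect]
  show "ray_integrable (\<lambda>w. G m w * kern r w) \<theta>" by (rule A(1)) auto
  show "of_real (Im (ray (\<lambda>w. G m w * kern r w) \<theta>)) = of_real pi * (\<Sum>l<k. kern r (pt m l))" by (rule A(2)) auto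
qed

text \<open>Twice this integrand is the residue integrand for the single pole p =
  \<open>\<i>\<close>, at which the kernel is real.\<close>

lemma Im_ray_comparison:
  assumes r: "0 < r" "r < 1"
  shows "ray_integrable (\<lambda>w. w / (w\<^sup>2 + 1) * kern r w) \<theta>"
    and "Im (ray (\<lambda>w. w / (w\<^sup>2 + 1) * kern r w) \<theta>) = pi / 2 * ln (1 - r * exp (- (2 * pi)))"
proof -
  have c: "cos \<theta> > 0" using theta by (intro cos_gt_zero_pi) auto
  \<comment> \<open>The unit type serves as the index set with one element.\<close>
  have "ray_integrable (\<lambda>w. 2 * w / (w\<^sup>2 + 1) * kern r w) \<theta> \<and>
     complex_of_real (Im (ray (\<lambda>w. 2 * w / (w\<^sup>2 + 1) * kern r w) \<theta>)) = of_real pi * (\<Sum>l\<in>{()}. kern r \<i>)"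
    by (rule conjI; rule Im_ray_kern[of r \<theta> "{()}" "\<lambda>_. \<i>", OF r theta(1) theta(3)]) (use c in auto)
  hence I: "ray_integrable (\<lambda>w. 2 * w / (w\<^sup>2 + 1) * kern r w) \<theta>"
     "complex_of_real (Im (ray (\<lambda>w. 2 * w / (w\<^sup>2 + 1) * kern r w) \<theta>)) = of_real pi * kern r \<i>" by auto
  have e: "(\<lambda>w. 1 / 2 * (2 * w / (w\<^sup>2 + 1) * kern r w)) = (\<lambda>w. w / (w\<^sup>2 + 1) * kern r w)" by auto
  show "ray_integrable (\<lambda>w. w / (w\<^sup>2 + 1) * kern r w) \<theta>" using ray_cmult(1)[OF I(1), of "1/2"] unfolding e .
  have "r * exp (- (2 * pi)) < 1 * 1" using r by (intro mult_strict_mono) auto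
  hence p: "1 - r * exp (- (2 * pi)) > 0" by simp
  have "kern r \<i> = Ln (of_real (1 - r * exp (- (2 * pi))))"
    unfolding kern_def by (simp add: exp_of_real[symmetric] mult.assoc)
  hence k1: "kern r \<i> = of_real (ln (1 - r * exp (- (2 * pi))))" using p by (simp only: Ln_of_real)
  have "Im (ray (\<lambda>w. w / (w\<^sup>2 + 1) * kern r w) \<theta>) = 1 / 2 * Im (ray (\<lambda>w. 2 * w / (w\<^sup>2 + 1) * kern r w) \<theta>)"
    by (subst ray_cmult(2)[OF I(1), of "1/2", unfolded e]) simp
  also have "Im (ray (\<lambda>w. 2 * w / (w\<^sup>2 + 1) * kern r w) \<theta>) = pi * ln (1 - r * exp (- (2 * pi)))"
    using I(2) unfolding k1 by (simp only: of_real_mult[symmetric] of_real_eq_iff)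
  finally show "Im (ray (\<lambda>w. w / (w\<^sup>2 + 1) * kern r w) \<theta>) = pi / 2 * ln (1 - r * exp (- (2 * pi)))" by simp
qed


text \<open>What remains of the polynomial piece on the imaginary axis, apart from a power of i; its
  limit carries zeta (-k).\<close>

definition P :: "real \<Rightarrow> real" where
  "P r = (LINT t:{0<..}|lborel. t ^ (k - 1) * ln (1 - r * exp (- (2 * pi * t))))"

lemma kern_imag_axis:
  assumes "0 < r" "r < 1" "t > 0"
  shows "kern r (of_real t * \<i>) = of_real (ln (1 - r * exp (- (2 * pi * t))))"
proof -
  have "r * exp (- (2 * pi * t)) < 1 * 1" using assms by (intro mult_strict_mono) auto
  hence p: "1 - r * exp (- (2 * pi * t)) > 0" by simp
  have "2 * of_real pi * \<i> * (of_real t * \<i>) = complex_of_real (- (2 * pi * t))"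
    by (simp add: mult_ac)
  hence "kern r (of_real t * \<i>) = Ln (of_real (1 - r * exp (- (2 * pi * t))))"
    unfolding kern_def by (simp only: exp_of_real) simp
  thus ?thesis using p by (simp only: Ln_of_real)
qed

lemma sin_theta_pos: "sin \<theta> > 0"
  using theta by (intro sin_gt_zero) auto

text \<open>The exponent is chosen at each use: k + 1 against w^(k-1) and 2 k + 1 against w^(2k-1),
  each leaving quadratic decay.\<close>

lemma norm_kern_power_decay:
  assumes r: "0 < r" "r < 1" and z: "norm z > 0" "Im z \<ge> norm z * sin \<theta>"
  shows "norm (kern r z) \<le> r / (1 - r) * (fact n / (2 * pi * sin \<theta>) ^ n) / norm z ^ n"
proof -
  have y: "2 * pi * sin \<theta> * norm z > 0" using z sin_theta_pos by simp
  have Im: "Im z \<ge> 0" by (rule order.trans[OF _ z(2)]) (use sin_theta_pos in simp)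
  have "exp (- (2 * pi * Im z)) \<le> exp (- (2 * pi * sin \<theta> * norm z))"
    using z(2) by (simp add: mult_ac)
  also have "\<dots> \<le> fact n / (2 * pi * sin \<theta> * norm z) ^ n" by (rule exp_minus_le_power[OF y])
  also have "\<dots> = fact n / (2 * pi * sin \<theta>) ^ n / norm z ^ n" by (simp add: power_mult_distrib)
  finally have "r / (1 - r) * exp (- (2 * pi * Im z)) \<le> r / (1 - r) * (fact n / (2 * pi * sin \<theta>) ^ n / norm z ^ n)"
    using r by (intro mult_left_mono) auto
  with norm_kern_le[OF r Im] show ?thesis by simp
qed

text \<open>For odd k the factor w^(k-1) is even, so the reflection argument does not apply. But the
  integrand has no poles in the upper half plane and may be turned on to the imaginary axis; there
  the kernel and i^(k-1) are real, and dw = i dt makes the integral purely imaginary.\<close>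

lemma Im_ray_power:
  assumes r: "0 < r" "r < 1"
  shows "ray_integrable (\<lambda>w. w ^ (k - 1) * kern r w) \<theta>"
    and "Im (ray (\<lambda>w. w ^ (k - 1) * kern r w) \<theta>) = (-1) ^ (k div 2) * P r"
proof -
  define C where "C = r / (1 - r) * (fact (k + 1) / (2 * pi * sin \<theta>) ^ (k + 1))"
  have Im: "Im w \<ge> 0" if "w \<in> sector \<theta> (pi / 2)" for w
    using that theta by (intro sector_Im_nonneg[of w \<theta> "pi / 2"]) auto
  have cont: "continuous_on (sector \<theta> (pi / 2)) (\<lambda>w. w ^ (k - 1) * kern r w)"
    by (intro continuous_intros continuous_on_subset[OF kern_continuous[OF r]]) (use Im in auto)
  have decay: "norm (z ^ (k - 1) * kern r z) \<le> C / norm z ^ 2" if z: "z \<in> sector \<theta> (pi / 2)" "norm z \<ge> 1" for z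
  proof -
    obtain t \<phi> where t: "z = of_real t * cis \<phi>" "t \<ge> 0" "\<theta> \<le> \<phi>" "\<phi> \<le> pi / 2"
      using z by (auto simp: sector_def)
    have n: "norm z = t" using t by (simp add: norm_mult)
    have t1: "t > 0" using z n by simp
    have "sin \<theta> \<le> sin \<phi>" using t theta by (intro sin_monotone_2pi_le) auto
    hence "Im z \<ge> norm z * sin \<theta>" unfolding n using t by (simp add: mult_left_mono)
    hence "norm (kern r z) \<le> C / norm z ^ (k + 1)"
      using norm_kern_power_decay[OF r, of z "k + 1"] t1 n unfolding C_def by simp
    hence "norm (z ^ (k - 1) * kern r z) \<le> t ^ (k - 1) * (C / t ^ (k + 1))"
      unfolding norm_mult norm_power n using t by (intro mult_left_mono) auto
    also have "t ^ (k + 1) = t ^ (k - 1) * t ^ 2" using k_pos by (simp flip: power_add)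
    finally show ?thesis using t1 unfolding n by simp
  qed
  show "ray_integrable (\<lambda>w. w ^ (k - 1) * kern r w) \<theta>"
    by (rule ray_integrableI[OF cont _ _ decay]) (use theta in auto)
  have "ray (\<lambda>w. w ^ (k - 1) * kern r w) \<theta> = ray (\<lambda>w. w ^ (k - 1) * kern r w) (pi / 2)"
  proof (rule ray_rotate[OF _ _ cont _ decay])
    fix z assume "z \<in> interior (sector \<theta> (pi / 2))"
    hence "Im z \<ge> 0" using Im interior_subset by blast
    thus "(\<lambda>w. w ^ (k - 1) * kern r w) field_differentiable at z"
      using r by (intro field_differentiable_mult kern_field_differentiable field_differentiable_power field_differentiable_ident)
  qed (use theta in auto)
  also have "\<dots> = (LINT t:{0<..}|lborel. (\<i> * (-1) ^ (k div 2)) * of_real (t ^ (k - 1) * ln (1 - r * exp (- (2 * pi * t)))))"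
    unfolding ray_def
  proof (rule set_lebesgue_integral_cong)
    obtain n where n: "k = 2 * n + 1" using odd_k by (auto elim: oddE)
    have i: "\<i> ^ (k - Suc 0) = (-1) ^ (k div 2)" unfolding n by (simp add: power_mult)
    show "\<forall>t. t \<in> {0<..} \<longrightarrow> (of_real t * cis (pi / 2)) ^ (k - 1) * kern r (of_real t * cis (pi / 2)) * cis (pi / 2) =
        \<i> * (-1) ^ (k div 2) * of_real (t ^ (k - 1) * ln (1 - r * exp (- (2 * pi * t))))"
      using kern_imag_axis[OF r] by (auto simp: cis_pi_half power_mult_distrib i)
  qed auto
  also have "\<dots> = (\<i> * (-1) ^ (k div 2)) * of_real (P r)"
    unfolding P_def set_integral_complex_of_real[symmetric] by (rule set_integral_mult_right)
  also have "\<dots> = \<i> * of_real ((-1) ^ (k div 2) * P r)" by simp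
  finally show "Im (ray (\<lambda>w. w ^ (k - 1) * kern r w) \<theta>) = (-1) ^ (k div 2) * P r"
    by (simp only: Im_i_times Re_complex_of_real)
qed

text \<open>Here the tilt is essential: apart from the kernel the majorant grows like t^(2k-1), and
  only the decay of the kernel on this ray makes it integrable. Summability over m comes from 1 /
  pole^2.\<close>

lemma ray_G_sums:
  assumes r: "0 < r" "r < 1"
  shows "ray_integrable (\<lambda>w. (\<Sum>m. G m w) * kern r w) \<theta>"
    and "(\<lambda>m. ray (\<lambda>w. G m w * kern r w) \<theta>) sums ray (\<lambda>w. (\<Sum>m. G m w) * kern r w) \<theta>"
proof -
  define B where "B = (\<lambda>t. 2 * real k * t ^ (2 * k - 1) * norm (kern r (of_real t * cis \<theta>)))"
  define f where "f = (\<lambda>m t. G m (of_real t * cis \<theta>) * kern r (of_real t * cis \<theta>) * cis \<theta>)"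
  have Im: "Im (of_real t * cis \<theta>) = t * sin \<theta>" for t by simp
  have Bint: "set_integrable lborel {0<..} B"
  proof (rule integrable_quadratic_decay[of _ 1])
    show "continuous_on {0..} B" unfolding B_def
      by (intro continuous_intros continuous_on_compose2[OF kern_continuous[OF r]])
        (use sin_theta_pos in auto)
    define C where "C = r / (1 - r) * (fact (2 * k + 1) / (2 * pi * sin \<theta>) ^ (2 * k + 1))"
    fix t :: real assume t: "t \<ge> 1"
    have "norm (kern r (of_real t * cis \<theta>)) \<le> C / t ^ (2 * k + 1)"
      using norm_kern_power_decay[OF r, of "of_real t * cis \<theta>" "2 * k + 1"] t unfolding C_def
      by (simp add: norm_mult)
    hence "B t \<le> 2 * real k * t ^ (2 * k - 1) * (C / t ^ (2 * k + 1))"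
      unfolding B_def using t by (intro mult_left_mono) auto
    also have "t ^ (2 * k + 1) = t ^ (2 * k - 1) * t ^ 2" using k_pos by (simp flip: power_add)
    finally have "B t \<le> 2 * real k * C / t\<^sup>2" using t by simp
    moreover have "B t \<ge> 0" using t by (simp add: B_def)
    ultimately show "norm (B t) \<le> 2 * real k * C / t\<^sup>2" by simp
  qed auto
  have f1: "set_integrable lborel {0<..} (f m)" for m
    using Im_ray_G(1)[OF r, of m] unfolding f_def ray_integrable_def .
  have nf: "norm (f m t) \<le> B t * (1 / pole m ^ 2)" if "t \<in> {0<..}" for m t
  proof -
    have "norm (G m (of_real t * cis \<theta>)) \<le> 2 * real k * norm (of_real t * cis \<theta>) ^ (2 * k - 1) * (1 / pole m ^ 2)"
      using that by (intro norm_G_le sector_power(1) sector_ray) auto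
    also have "norm (of_real t * cis \<theta>) = t" using that by (simp add: norm_mult)
    finally have "norm (G m (of_real t * cis \<theta>)) * norm (kern r (of_real t * cis \<theta>)) \<le>
        2 * real k * t ^ (2 * k - 1) * (1 / pole m ^ 2) * norm (kern r (of_real t * cis \<theta>))"
      by (rule mult_right_mono) auto
    thus ?thesis unfolding f_def B_def by (simp add: norm_mult mult_ac)
  qed
  have f2: "summable (\<lambda>m. norm (f m t))" if "t \<in> {0<..}" for t
    by (rule summable_comparison_test[OF _ summable_mult[OF summable_pole, of "B t"]]) (use nf[OF that] in auto)
  have f3: "summable (\<lambda>m. LINT t:{0<..}|lborel. norm (f m t))"
  proof (rule summable_comparison_test[OF _ summable_mult[OF summable_pole, of "LINT t:{0<..}|lborel. B t"]], intro exI allI impI)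
    fix m
    have "(LINT t:{0<..}|lborel. norm (f m t)) \<le> (LINT t:{0<..}|lborel. B t * (1 / pole m ^ 2))"
      by (intro set_integral_mono set_integrable_norm f1 nf set_integrable_mult_left Bint)
    also have "\<dots> = (LINT t:{0<..}|lborel. B t) * (1 / pole m ^ 2)" by simp
    finally show "norm (LINT t:{0<..}|lborel. norm (f m t)) \<le> (LINT t:{0<..}|lborel. B t) * (1 / pole m ^ 2)"
      by (simp add: set_lebesgue_integral_def Bochner_Integration.integral_nonneg)
  qed
  have eq: "(\<Sum>m. G m (of_real t * cis \<theta>)) * kern r (of_real t * cis \<theta>) * cis \<theta> = (\<Sum>m. f m t)" if "t \<in> {0<..}" for t
  proof -
    have "summable (\<lambda>m. G m (of_real t * cis \<theta>))"
    proof (rule summable_comparison_test[OF _ summable_mult[OF summable_pole]], intro exI allI impI)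
      show "norm (G m (of_real t * cis \<theta>)) \<le> 2 * real k * norm (of_real t * cis \<theta>) ^ (2 * k - 1) * (1 / pole m ^ 2)" for m
        using that by (intro norm_G_le sector_power(1) sector_ray) auto
    qed
    from suminf_mult2[OF this, of "kern r (of_real t * cis \<theta>) * cis \<theta>"] show ?thesis
      unfolding f_def by (simp only: mult.assoc)
  qed
  note F = set_sums_integral[OF f1 f2 f3]
  show "ray_integrable (\<lambda>w. (\<Sum>m. G m w) * kern r w) \<theta>"
    unfolding ray_integrable_def using F(1) by (subst set_integrable_cong[OF refl refl eq]) auto
  have "ray (\<lambda>w. (\<Sum>m. G m w) * kern r w) \<theta> = (LINT t:{0<..}|lborel. \<Sum>m. f m t)"
    unfolding ray_def by (rule set_lebesgue_integral_cong) (use eq in auto)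
  thus "(\<lambda>m. ray (\<lambda>w. G m w * kern r w) \<theta>) sums ray (\<lambda>w. (\<Sum>m. G m w) * kern r w) \<theta>"
    using F(2) unfolding f_def ray_def by simp
qed

lemma Im_ray_H:
  assumes r: "0 < r" "r < 1"
  shows "(\<lambda>m. pi * Re (\<Sum>l<k. kern r (pt m l))) sums
     (Im (ray (\<lambda>w. H w * kern r w) 0) - real k * pi / 2 * ln (1 - r * exp (- (2 * pi)))
        + real k * x / 2 * ((-1) ^ (k div 2) * P r))"
proof -
  note i1 = ray_cmult[OF Im_ray_comparison(1)[OF r], of "of_nat k"]
  note i2 = ray_cmult[OF Im_ray_power(1)[OF r], of "of_nat k * of_real x / 2"]
  note i12 = ray_diff[OF i1(1) i2(1)]
  note i3 = ray_add[OF i12(1) ray_G_sums(1)[OF r]]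
  have Heq: "(\<lambda>w. H w * kern r w) = (\<lambda>w. of_nat k * (w / (w\<^sup>2 + 1) * kern r w) - of_nat k * of_real x / 2 * (w ^ (k - 1) * kern r w)
      + (\<Sum>m. G m w) * kern r w)"
    unfolding H_def by (rule ext) (simp only: distrib_right left_diff_distrib mult.assoc)
  have "ray (\<lambda>w. H w * kern r w) 0 = ray (\<lambda>w. H w * kern r w) \<theta>" by (rule ray_H_rotate[OF r])
  also have "\<dots> = of_nat k * ray (\<lambda>w. w / (w\<^sup>2 + 1) * kern r w) \<theta> - of_nat k * of_real x / 2 * ray (\<lambda>w. w ^ (k - 1) * kern r w) \<theta>
       + ray (\<lambda>w. (\<Sum>m. G m w) * kern r w) \<theta>"
    unfolding Heq i3(2) i12(2) i1(2) i2(2) ..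
  finally have "Im (ray (\<lambda>w. H w * kern r w) 0) = real k * Im (ray (\<lambda>w. w / (w\<^sup>2 + 1) * kern r w) \<theta>)
      - real k * x / 2 * Im (ray (\<lambda>w. w ^ (k - 1) * kern r w) \<theta>) + Im (ray (\<lambda>w. (\<Sum>m. G m w) * kern r w) \<theta>)"
    by simp
  hence val: "Im (ray (\<lambda>w. (\<Sum>m. G m w) * kern r w) \<theta>) = Im (ray (\<lambda>w. H w * kern r w) 0)
      - real k * pi / 2 * ln (1 - r * exp (- (2 * pi))) + real k * x / 2 * ((-1) ^ (k div 2) * P r)"
    unfolding Im_ray_comparison(2)[OF r] Im_ray_power(2)[OF r] by simp
  have "(\<lambda>m. Im (ray (\<lambda>w. G m w * kern r w) \<theta>)) sums Im (ray (\<lambda>w. (\<Sum>m. G m w) * kern r w) \<theta>)"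
    by (intro sums_Im ray_G_sums r)
  also have "(\<lambda>m. Im (ray (\<lambda>w. G m w * kern r w) \<theta>)) = (\<lambda>m. pi * Re (\<Sum>l<k. kern r (pt m l)))"
  proof
    fix m
    have "Re (complex_of_real (Im (ray (\<lambda>w. G m w * kern r w) \<theta>))) = Re (of_real pi * (\<Sum>l<k. kern r (pt m l)))"
      unfolding Im_ray_G(2)[OF r] ..
    thus "Im (ray (\<lambda>w. G m w * kern r w) \<theta>) = pi * Re (\<Sum>l<k. kern r (pt m l))"
      by simp
  qed
  finally show ?thesis unfolding val .
qed

text \<open>The residue identity equates pi times this sum with an imaginary part, that is, with a
  real number; this replaces a pairing of each point with its mirror image.\<close>

lemma Im_sum_kern_pt:
  assumes r: "0 < r" "r < 1"
  shows "Im (\<Sum>l<k. kern r (pt m l)) = 0"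
proof -
  have "Im (of_real pi * (\<Sum>l<k. kern r (pt m l))) = 0"
    unfolding Im_ray_G(2)[OF r, symmetric] by simp
  thus ?thesis by simp
qed

end

section \<open>The integral against the sawtooth\<close>

lemma minus_ln_one_minus_sums:
  fixes u :: real
  assumes "0 < u" "u < 1"
  shows "(\<lambda>n. u ^ Suc n / real (Suc n)) sums (- ln (1 - u))"
proof -
  have "(\<lambda>n. - ((- (- u)) ^ n) / of_nat n) sums ln (1 + (- u))" using assms by (intro ln_series') auto
  hence "(\<lambda>n. - (u ^ Suc n) / of_nat (Suc n)) sums ln (1 - u)"
    by (subst sums_Suc_iff) simp
  from sums_minus[OF this] show ?thesis by simp
qed

lemma kern_tendsto:
  assumes u: "r \<longlonglongrightarrow> 1" and p: "Re (1 - exp (2 * of_real pi * \<i> * p)) > 0"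
  shows "(\<lambda>n. kern (r n) p) \<longlonglongrightarrow> kern 1 p"
proof -
  have "(\<lambda>n. 1 - of_real (r n) * exp (2 * of_real pi * \<i> * p)) \<longlonglongrightarrow> 1 - of_real 1 * exp (2 * of_real pi * \<i> * p)"
    by (intro tendsto_intros u)
  thus ?thesis unfolding kern_def by (rule tendsto_Ln) (use p in \<open>auto intro!: Re_pos_nonpos_Reals\<close>)
qed

text \<open>1 - e^(2 pi i f) = 2 sin (pi f) e^(i (pi f - pi/2)), and for 0 < f < 1 this argument is
  the principal one.\<close>

lemma Im_Ln_one_minus_cis:
  assumes "t \<notin> \<int>"
  shows "Re (1 - exp (2 * of_real pi * \<i> * of_real t)) > 0"
    and "Im (kern 1 (of_real t)) = pi * (frac t - 1 / 2)"
proof -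
  define f where "f = frac t"
  have f: "0 < f" "f < 1" using assms frac_lt_1[of t] frac_gt_0_iff[of t] by (auto simp: f_def)
  have s: "sin (pi * f) > 0" using f by (intro sin_gt_zero) auto
  have e: "exp (2 * of_real pi * \<i> * of_real t) = cis (2 * (pi * f))"
  proof -
    have "t = f + of_int \<lfloor>t\<rfloor>" by (simp add: f_def frac_def)
    hence "2 * of_real pi * \<i> * of_real t = \<i> * of_real (2 * (pi * f)) + \<i> * (of_int \<lfloor>t\<rfloor> * (of_real pi * 2))"
      by (metis (no_types, opaque_lifting) distrib_left mult.assoc mult.commute mult.left_commute of_real_add of_real_mult of_real_numeral of_real_of_int_eq)
    also have "exp \<dots> = exp (\<i> * of_real (2 * (pi * f))) * exp (\<i> * (of_int \<lfloor>t\<rfloor> * (of_real pi * 2)))"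
      by (rule exp_add)
    also have "exp (\<i> * (of_int \<lfloor>t\<rfloor> * (of_real pi * 2))) = 1" by simp
    finally show ?thesis by (simp only: cis_conv_exp mult_1_right)
  qed
  have main: "1 - cis (2 * (pi * f)) = of_real (2 * sin (pi * f)) * cis (pi * f - pi / 2)"
    by (rule complex_eqI) (simp_all add: cos_double_sin sin_double cos_diff sin_diff power2_eq_square)
  have "Re (1 - cis (2 * (pi * f))) = 2 * sin (pi * f) * sin (pi * f)"
    unfolding main by (simp add: cos_diff)
  thus "Re (1 - exp (2 * of_real pi * \<i> * of_real t)) > 0" unfolding e using s by simp
  have "1 - cis (2 * (pi * f)) = exp (of_real (ln (2 * sin (pi * f))) + \<i> * of_real (pi * f - pi / 2))"
  proof -
    have "exp (of_real a + \<i> * of_real b) = of_real (exp a) * cis b" for a b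
      by (simp only: exp_add cis_conv_exp exp_of_real)
    note polar = this
    show ?thesis unfolding main polar using s by simp
  qed
  moreover have "- pi < pi * f - pi / 2" "pi * f - pi / 2 \<le> pi"
  proof -
    have "pi * f < pi * 1" using f by (intro mult_strict_left_mono) auto
    moreover have "pi * f > 0" using f by simp
    ultimately show "- pi < pi * f - pi / 2" "pi * f - pi / 2 \<le> pi" by linarith+
  qed
  ultimately have "Ln (1 - cis (2 * (pi * f))) = of_real (ln (2 * sin (pi * f))) + \<i> * of_real (pi * f - pi / 2)"
    by (simp only:) (rule Ln_exp; simp)
  hence "Im (Ln (1 - cis (2 * (pi * f)))) = pi * f - pi / 2" by simp
  thus "Im (kern 1 (of_real t)) = pi * (frac t - 1 / 2)"
    unfolding kern_def e f_def by (simp add: right_diff_distrib)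
qed

text \<open>A sequence, as dominated convergence is used for sequences; the shift by 2 keeps it
  strictly between 0 and 1 from the first index on.\<close>

definition rseq :: "nat \<Rightarrow> real" where "rseq n = 1 - 1 / real (n + 2)"

lemma rseq: "0 < rseq n" "rseq n < 1"
  by (simp_all add: rseq_def)

lemma rseq_tendsto: "rseq \<longlonglongrightarrow> 1"
proof -
  have "(\<lambda>n. 1 / real (n + 2)) \<longlonglongrightarrow> 0"
    using LIMSEQ_ignore_initial_segment[OF lim_1_over_n, of 2] by simp
  from tendsto_diff[OF tendsto_const[of 1] this] show ?thesis unfolding rseq_def[abs_def] by simp
qed

lemma tendsto_suminf_dominated:
  fixes a :: "nat \<Rightarrow> nat \<Rightarrow> 'a::{real_normed_algebra, banach}"
  assumes "\<And>m. (\<lambda>n. a m n) \<longlonglongrightarrow> b m" "\<And>m n. norm (a m n) \<le> M m" "summable M"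
  shows "summable (\<lambda>m. norm (b m))" "(\<lambda>n. \<Sum>m. a m n) \<longlonglongrightarrow> (\<Sum>m. b m)"
proof -
  have "\<forall>\<^sub>F (m, n) in at_top \<times>\<^sub>F sequentially. norm (a m n) \<le> M m"
    using assms(2) by (intro always_eventually) auto
  from tannerys_theorem[OF assms(1) this assms(3)]
  show "summable (\<lambda>m. norm (b m))" "(\<lambda>n. \<Sum>m. a m n) \<longlonglongrightarrow> (\<Sum>m. b m)" by simp_all
qed

lemma power_exp_integral:
  fixes a :: real
  assumes a: "a > 0" and k: "k > 0"
  shows "set_integrable lborel {0<..} (\<lambda>t. t ^ (k - 1) * exp (- (a * t)))"
    and "(LINT t:{0<..}|lborel. t ^ (k - 1) * exp (- (a * t))) = fact (k - 1) / a ^ k"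
proof -
  have eq: "t ^ (k - 1) * exp (- (a * t)) = t powr (real k - 1) * exp (- (a * t))" if "t \<in> {0<..}" for t
    using that k by (simp add: of_nat_diff flip: powr_realpow)
  have "set_integrable lborel {0<..} (\<lambda>t. t powr (real k - 1) * exp (- (a * t)))"
    using a k by (intro set_integrable_lborel_powr_exp) auto
  moreover have "set_integrable lborel {0<..} (\<lambda>t. t ^ (k - 1) * exp (- (a * t))) \<longleftrightarrow>
      set_integrable lborel {0<..} (\<lambda>t. t powr (real k - 1) * exp (- (a * t)))"
    by (rule set_integrable_cong[OF refl refl eq])
  ultimately show "set_integrable lborel {0<..} (\<lambda>t. t ^ (k - 1) * exp (- (a * t)))" by blast
  have "(LINT t:{0<..}|lborel. t ^ (k - 1) * exp (- (a * t))) = (LINT t:{0<..}|lborel. t powr (real k - 1) * exp (- (a * t)))"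
    by (rule set_lebesgue_integral_cong) (use eq in auto)
  also have "\<dots> = Gamma (real k) * a powr (- real k)" using a k by (intro powr_exp_integral) auto
  also have "Gamma (real k) = fact (k - 1)" using Gamma_fact[of "k - 1", where 'a = real] k by (simp add: of_nat_diff)
  also have "a powr (- real k) = 1 / a ^ k" using a by (simp add: powr_minus powr_realpow field_simps)
  finally show "(LINT t:{0<..}|lborel. t ^ (k - 1) * exp (- (a * t))) = fact (k - 1) / a ^ k" by simp
qed

section \<open>Removing the damping\<close>

context lambert begin

text \<open>In e^(-y) \<le> (2k)! / y^(2k) the exponent 2 k turns the k-th root into the summable 1
  / pole^2.\<close>

lemma summable_exp_root_pole:
  assumes "c > 0"
  shows "summable (\<lambda>m. exp (- (c * pole m powr (1 / real k))))"
proof (rule summable_comparison_test[OF _ summable_mult[OF summable_pole]], intro exI allI impI)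
  fix m
  have y: "c * pole m powr (1 / real k) > 0" using assms pole_pos[of m] by simp
  have "norm (exp (- (c * pole m powr (1 / real k)))) \<le> fact (2 * k) / (c * pole m powr (1 / real k)) ^ (2 * k)"
    using exp_minus_le_power[OF y] by simp
  also have "(c * pole m powr (1 / real k)) ^ (2 * k) = c ^ (2 * k) * pole m ^ 2"
  proof -
    have "(pole m powr (1 / real k)) ^ k = pole m" using pole_pos[of m] k_pos by (simp add: powr_power)
    thus ?thesis unfolding power_mult_distrib by (simp only: power_even_eq)
  qed
  also have "fact (2 * k) / \<dots> = fact (2 * k) / c ^ (2 * k) * (1 / pole m ^ 2)" by simp
  finally show "norm (exp (- (c * pole m powr (1 / real k)))) \<le> fact (2 * k) / c ^ (2 * k) * (1 / pole m ^ 2)" .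
qed

text \<open>For fixed \<open>l\<close> the points lie on one ray, so e^(2 pi i w) is largest in
  modulus at m = 0. That value \<open>q\<close> keeps the logarithms away from their singularity
  uniformly in m and n, and Tannery's theorem applies.\<close>

lemma kern_pt_limit:
  assumes l: "l < k"
  shows "summable (\<lambda>m. norm (kern 1 (pt m l)))"
    and "summable (\<lambda>m. kern (rseq n) (pt m l))"
    and "(\<lambda>n. \<Sum>m. kern (rseq n) (pt m l)) \<longlonglongrightarrow> (\<Sum>m. kern 1 (pt m l))"
proof -
  define s where "s = sin (real (2 * l + 1) * pi / (2 * real k))"
  have Im: "Im (pt m l) = pole m powr (1 / real k) * s" for m by (simp add: pt_def s_def)
  have s: "s > 0" using pt_position(3)[OF l, of 0] pole_pos[of 0] unfolding Im by (simp add: zero_less_mult_iff)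
  define c where "c = 2 * pi * s"
  have c: "c > 0" using s by (simp add: c_def)
  define q where "q = exp (- (c * pole 0 powr (1 / real k)))"
  have q: "q < 1" unfolding q_def using c pole_pos[of 0] by simp
  have ne: "norm (exp (2 * of_real pi * \<i> * pt m l)) = exp (- (c * pole m powr (1 / real k)))" for m
    unfolding norm_kern_arg Im c_def by (simp add: mult_ac)
  have mono: "exp (- (c * pole m powr (1 / real k))) \<le> q" for m
  proof -
    have "pole 0 \<le> pole m" using x_pos by (auto simp: pole_def intro!: divide_right_mono)
    hence "pole 0 powr (1 / real k) \<le> pole m powr (1 / real k)" using pole_pos[of 0] by (intro powr_mono2) auto
    thus ?thesis unfolding q_def using c by (simp add: mult_left_mono)
  qed
  define M where "M = (\<lambda>m. exp (- (c * pole m powr (1 / real k))) / (1 - q))"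
  have M: "summable M" unfolding M_def by (intro summable_divide summable_exp_root_pole c)
  have bound: "norm (kern (rseq n) (pt m l)) \<le> M m" for m n
  proof -
    have le: "norm (of_real (rseq n) * exp (2 * of_real pi * \<i> * pt m l)) \<le> exp (- (c * pole m powr (1 / real k)))"
      unfolding norm_mult ne using rseq[of n] by (simp add: mult_left_le_one_le)
    hence "norm (kern (rseq n) (pt m l)) \<le> norm (of_real (rseq n) * exp (2 * of_real pi * \<i> * pt m l)) / (1 - q)"
      unfolding kern_def using mono[of m] q by (intro norm_Ln_one_minus_le) auto
    also have "\<dots> \<le> M m" unfolding M_def using le q by (intro divide_right_mono) auto
    finally show ?thesis .
  qed
  have lim: "(\<lambda>n. kern (rseq n) (pt m l)) \<longlonglongrightarrow> kern 1 (pt m l)" for m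
  proof (rule kern_tendsto[OF rseq_tendsto])
    have "Re (exp (2 * of_real pi * \<i> * pt m l)) \<le> norm (exp (2 * of_real pi * \<i> * pt m l))"
      by (rule complex_Re_le_cmod)
    also have "\<dots> < 1" unfolding ne using mono[of m] q by linarith
    finally show "Re (1 - exp (2 * of_real pi * \<i> * pt m l)) > 0" by simp
  qed
  show "summable (\<lambda>m. norm (kern 1 (pt m l)))" "(\<lambda>n. \<Sum>m. kern (rseq n) (pt m l)) \<longlonglongrightarrow> (\<Sum>m. kern 1 (pt m l))"
    using tendsto_suminf_dominated[OF lim bound M] by auto
  show "summable (\<lambda>m. kern (rseq n) (pt m l))"
    by (rule summable_comparison_test[OF _ M]) (use bound in auto)
qed

lemma P_limit: "(\<lambda>n. P (rseq n)) \<longlonglongrightarrow> - (fact (k - 1) * (2 * pi) * (\<Sum>j. 1 / (2 * pi * real (Suc j)) ^ Suc k))"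
proof -
  \<comment> \<open>With n = j + 1 this is the j-th integral (k-1)! / (n (2 pi n)^k); the factor 2
    pi compensates for writing the power as k + 1.\<close>
  define c where "c = (\<lambda>j. fact (k - 1) * (2 * pi) * (1 / (2 * pi * real (Suc j)) ^ Suc k))"
  have c: "summable c" unfolding c_def using k_pos by (intro summable_mult summable_inverse_two_pi_power) auto
  have c0: "c j \<ge> 0" for j by (simp add: c_def)
  have P: "P r = - (\<Sum>j. r ^ Suc j * c j)" if r: "0 < r" "r < 1" for r
  proof -
    define f where "f = (\<lambda>j t. r ^ Suc j / real (Suc j) * (t ^ (k - 1) * exp (- (2 * pi * real (Suc j) * t))))"
    have a: "2 * pi * real (Suc j) > 0" for j by simp
    have f1: "set_integrable lborel {0<..} (f j)" for j
      unfolding f_def by (intro set_integrable_mult_right power_exp_integral a k_pos)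
    have fval: "(LINT t:{0<..}|lborel. f j t) = r ^ Suc j * c j" for j
      unfolding f_def set_integral_mult_right power_exp_integral(2)[OF a k_pos] c_def
      by (simp add: field_simps del: of_nat_Suc)
    have fnn: "norm (f j t) = f j t" if "t \<in> {0<..}" for j t
      using that r by (simp add: f_def)
    have fsums: "(\<lambda>j. f j t) sums (- (t ^ (k - 1) * ln (1 - r * exp (- (2 * pi * t)))))" if t: "t \<in> {0<..}" for t
    proof -
      define u where "u = r * exp (- (2 * pi * t))"
      have "u < 1 * 1" unfolding u_def using r t by (intro mult_strict_mono) auto
      hence u: "0 < u" "u < 1" using r by (auto simp: u_def)
      have "(\<lambda>n. t ^ (k - 1) * (u ^ Suc n / real (Suc n))) sums (t ^ (k - 1) * (- ln (1 - u)))"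
        by (intro sums_mult minus_ln_one_minus_sums u)
      also have "(\<lambda>n. t ^ (k - 1) * (u ^ Suc n / real (Suc n))) = (\<lambda>j. f j t)"
      proof
        fix j
        have "u ^ Suc j = r ^ Suc j * exp (- (2 * pi * real (Suc j) * t))"
          unfolding u_def power_mult_distrib exp_of_nat_mult[symmetric] by (simp add: mult_ac)
        thus "t ^ (k - 1) * (u ^ Suc j / real (Suc j)) = f j t" by (simp add: f_def)
      qed
      finally show ?thesis by (simp add: u_def)
    qed
    have f2: "summable (\<lambda>j. norm (f j t))" if "t \<in> {0<..}" for t
      using fsums[OF that] fnn[OF that] by (simp add: sums_iff)
    have "(LINT t:{0<..}|lborel. norm (f j t)) = r ^ Suc j * c j" for j
      unfolding fval[symmetric] by (rule set_lebesgue_integral_cong) (use fnn in auto)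
    moreover have "summable (\<lambda>j. r ^ Suc j * c j)"
    proof (rule summable_comparison_test[OF _ c], intro exI allI impI)
      fix j
      have "r ^ Suc j \<le> 1" using r by (intro power_le_one) auto
      thus "norm (r ^ Suc j * c j) \<le> c j" using r c0[of j] by (simp add: abs_mult mult_left_le_one_le)
    qed
    ultimately have f3: "summable (\<lambda>j. LINT t:{0<..}|lborel. norm (f j t))" by simp
    have "(\<Sum>j. r ^ Suc j * c j) = (LINT t:{0<..}|lborel. \<Sum>j. f j t)"
      using set_sums_integral(2)[OF f1 f2 f3] unfolding fval by (simp add: sums_iff)
    also have "\<dots> = (LINT t:{0<..}|lborel. - (t ^ (k - 1) * ln (1 - r * exp (- (2 * pi * t)))))"
      by (rule set_lebesgue_integral_cong) (use fsums in \<open>auto simp: sums_iff\<close>)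
    also have "\<dots> = - P r" unfolding P_def set_lebesgue_integral_def by simp
    finally show ?thesis by simp
  qed
  have "(\<lambda>n. \<Sum>j. rseq n ^ Suc j * c j) \<longlonglongrightarrow> (\<Sum>j. c j)"
  proof (rule tendsto_suminf_dominated[OF _ _ c])
    show "(\<lambda>n. rseq n ^ Suc j * c j) \<longlonglongrightarrow> c j" for j
    proof -
      have "(\<lambda>n. rseq n ^ Suc j * c j) \<longlonglongrightarrow> 1 ^ Suc j * c j" by (intro tendsto_intros rseq_tendsto)
      thus ?thesis by simp
    qed
    show "norm (rseq n ^ Suc j * c j) \<le> c j" for j n
    proof -
      have "rseq n ^ Suc j \<le> 1" using rseq[of n] by (intro power_le_one) auto
      thus ?thesis using rseq[of n] c0[of j] by (simp add: abs_mult mult_left_le_one_le)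
    qed
  qed
  hence "(\<lambda>n. P (rseq n)) \<longlonglongrightarrow> - (\<Sum>j. c j)" unfolding P[OF rseq] by (rule tendsto_minus)
  also have "(\<Sum>j. c j) = fact (k - 1) * (2 * pi) * (\<Sum>j. 1 / (2 * pi * real (Suc j)) ^ Suc k)"
    unfolding c_def using k_pos by (intro suminf_mult summable_inverse_two_pi_power) auto
  finally show ?thesis .
qed


definition h :: "real \<Rightarrow> real" where
  "h t = real k * x * t ^ (k - 1) / (exp (x * t ^ k) - 1) - real k / (t * (t\<^sup>2 + 1))"

lemma H_real:
  assumes "t > 0"
  shows "H (of_real t) = of_real (h t)"
proof -
  have s: "of_real t \<in> sector 0 \<theta>" unfolding sector_def using assms theta
    by (intro CollectI exI[of _ t] exI[of _ 0]) auto
  have "exp (of_real x * of_real t ^ k) = complex_of_real (exp (x * t ^ k))"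
    by (simp flip: exp_of_real)
  thus ?thesis
    by (subst H_closed_form[OF _ sector_sq_plus_1(2)[OF s] exp_sector_ne_1[OF s]]) (use assms in \<open>auto simp: h_def\<close>)
qed

text \<open>Inherited from \<open>H\<close> on the real ray, where the cancellation of the two terms
  of order k/t at 0 and the decay at infinity are already settled.\<close>

lemma h_integrable: "set_integrable lborel {0<..} h"
proof -
  have "ray_integrable H 0"
    by (rule ray_integrableI[OF H_continuous _ _ H_decay]) (use theta in auto)
  hence "set_integrable lborel {0<..} (\<lambda>t. H (of_real t))"
    by (simp add: ray_integrable_def)
  also have "?this \<longleftrightarrow> set_integrable lborel {0<..} (\<lambda>t. complex_of_real (h t))"
    by (intro set_integrable_cong) (auto simp: H_real)
  finally have "set_integrable lborel {0<..} (\<lambda>t. Re (complex_of_real (h t)))"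
    unfolding set_integrable_def using integrable_Re by fastforce
  thus ?thesis by simp
qed

text \<open>The argument of the logarithm lies in the right half plane. Unlike the bound on the
  norm, this one is uniform in \<open>r\<close> and so provides the majorant for the limit.\<close>

lemma abs_Im_kern_le:
  assumes "0 < r" "r < 1" "Im w \<ge> 0"
  shows "\<bar>Im (kern r w)\<bar> \<le> pi / 2"
proof -
  define z where "z = 1 - of_real r * exp (2 * of_real pi * \<i> * w)"
  have z: "Re z > 0" unfolding z_def by (rule kern_arg_Re_pos'[OF assms])
  hence "z \<noteq> 0" by auto
  hence "\<bar>Im (kern r w)\<bar> < pi / 2" using z unfolding kern_def z_def[symmetric] by (subst Re_Ln_pos_lt)
  thus ?thesis by simp
qed

lemma kern_real_measurable:
  assumes "0 < r" "r < 1"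
  shows "(\<lambda>t. kern r (complex_of_real t)) \<in> borel_measurable borel"
  by (intro borel_measurable_continuous_onI continuous_on_compose2[OF kern_continuous[OF assms]] continuous_intros) auto

lemma Im_ray_H_0:
  assumes r: "0 < r" "r < 1"
  shows "Im (ray (\<lambda>w. H w * kern r w) 0) = (LINT t:{0<..}|lborel. h t * Im (kern r (of_real t)))"
proof -
  have "set_integrable lborel {0<..} (\<lambda>t. complex_of_real (h t) * kern r (of_real t))"
  proof (rule set_integrable_bound)
    show "set_integrable lborel {0<..} (\<lambda>t. h t * (r / (1 - r)))" by (intro set_integrable_mult_left h_integrable)
    have [measurable]: "(\<lambda>t. indicator {0<..} t *\<^sub>R h t) \<in> borel_measurable borel"
      using h_integrable unfolding set_integrable_def by auto
    note kern_real_measurable[OF r, measurable]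
    have "(\<lambda>t. complex_of_real (indicator {0<..} t *\<^sub>R h t) * kern r (of_real t)) \<in> borel_measurable lborel"
      by measurable
    thus "set_borel_measurable lborel {0<..} (\<lambda>t. complex_of_real (h t) * kern r (of_real t))"
      unfolding set_borel_measurable_def by (simp add: scaleR_conv_of_real mult.assoc)
    show "AE t in lborel. t \<in> {0<..} \<longrightarrow> norm (complex_of_real (h t) * kern r (of_real t)) \<le> norm (h t * (r / (1 - r)))"
    proof (intro AE_I2 impI)
      fix t :: real
      have "norm (kern r (of_real t)) \<le> r / (1 - r)" using r by (intro norm_kern_le_const) auto
      hence "\<bar>h t\<bar> * norm (kern r (of_real t)) \<le> \<bar>h t\<bar> * (r / (1 - r))" by (intro mult_left_mono) auto
      thus "norm (complex_of_real (h t) * kern r (of_real t)) \<le> norm (h t * (r / (1 - r)))"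
        using r by (simp add: norm_mult abs_mult)
    qed
  qed
  hence int: "integrable lborel (\<lambda>t. indicator {0<..} t *\<^sub>R (complex_of_real (h t) * kern r (of_real t)))"
    unfolding set_integrable_def .
  have "ray (\<lambda>w. H w * kern r w) 0 = (LINT t:{0<..}|lborel. complex_of_real (h t) * kern r (of_real t))"
    unfolding ray_def by (rule set_lebesgue_integral_cong) (auto simp: H_real)
  hence "Im (ray (\<lambda>w. H w * kern r w) 0) = (LINT t|lborel. Im (indicator {0<..} t *\<^sub>R (complex_of_real (h t) * kern r (of_real t))))"
    unfolding set_lebesgue_integral_def by (simp only: integral_Im[OF int])
  also have "\<dots> = (LINT t:{0<..}|lborel. h t * Im (kern r (of_real t)))"
    unfolding set_lebesgue_integral_def by (rule Bochner_Integration.integral_cong) auto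
  finally show ?thesis .
qed

lemma h_sawtooth_limit:
  "set_integrable lborel {0<..} (\<lambda>t. h t * (pi * (frac t - 1 / 2)))"
  "(\<lambda>n. LINT t:{0<..}|lborel. h t * Im (kern (rseq n) (of_real t))) \<longlonglongrightarrow>
     (LINT t:{0<..}|lborel. h t * (pi * (frac t - 1 / 2)))"
proof -
  let ?h = "\<lambda>t. indicator {0<..} t *\<^sub>R h t"
  have hi: "integrable lborel ?h" using h_integrable unfolding set_integrable_def .
  hence hm [measurable]: "?h \<in> borel_measurable borel" by auto
  have fm [measurable]: "(\<lambda>t::real. frac t) \<in> borel_measurable borel"
    unfolding frac_def by measurable
  let ?f = "\<lambda>t. ?h t * (pi * (frac t - 1 / 2))"
  let ?s = "\<lambda>n t. ?h t * Im (kern (rseq n) (of_real t))"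
  let ?w = "\<lambda>t. norm (?h t) * (pi / 2)"
  have 1: "?f \<in> borel_measurable lborel" by measurable
  have 2: "?s n \<in> borel_measurable lborel" for n
    using hm kern_real_measurable[OF rseq, of n] by (intro borel_measurable_times borel_measurable_Im) auto
  have 3: "integrable lborel ?w" by (intro integrable_mult_left integrable_norm hi)
  \<comment> \<open>At an integer the damped kernel has imaginary part 0, while the sawtooth is
    -1/2; the integers form a null set.\<close>
  have "AE t in lborel. t \<notin> range (real_of_int)"
    by (intro AE_not_in countable_imp_null_set_lborel) auto
  hence 4: "AE t in lborel. (\<lambda>n. ?s n t) \<longlonglongrightarrow> ?f t"
  proof (eventually_elim)
    case (elim t)
    hence t: "t \<notin> \<int>" by (auto elim: Ints_cases)
    show ?case unfolding Im_Ln_one_minus_cis(2)[OF t, symmetric]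
      by (intro tendsto_intros kern_tendsto[OF rseq_tendsto] Im_Ln_one_minus_cis(1)[OF t])
  qed
  have 5: "AE t in lborel. norm (?s n t) \<le> ?w t" for n
  proof (rule AE_I2)
    fix t :: real
    show "norm (?s n t) \<le> ?w t" unfolding norm_mult
      using abs_Im_kern_le[OF rseq, of "of_real t" n] by (intro mult_left_mono) auto
  qed
  have "integrable lborel ?f" by (rule integrable_dominated_convergence[OF 1 2 3 4 5])
  thus "set_integrable lborel {0<..} (\<lambda>t. h t * (pi * (frac t - 1 / 2)))"
    unfolding set_integrable_def by (simp add: mult.assoc)
  have "(\<lambda>n. integral\<^sup>L lborel (?s n)) \<longlonglongrightarrow> integral\<^sup>L lborel ?f"
    by (rule integral_dominated_convergence[OF 1 2 3 4 5])
  thus "(\<lambda>n. LINT t:{0<..}|lborel. h t * Im (kern (rseq n) (of_real t))) \<longlonglongrightarrow>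
     (LINT t:{0<..}|lborel. h t * (pi * (frac t - 1 / 2)))"
    unfolding set_lebesgue_integral_def by (simp add: mult.assoc)
qed

lemma sawtooth_integral:
  "(LINT t:{0<..}|lborel. h t * (frac t - 1 / 2)) =
     real k / 2 * ln (1 - exp (- (2 * pi)))
     + x * ((-1) ^ (k div 2) * fact k * (\<Sum>j. 1 / (2 * pi * real (Suc j)) ^ Suc k))
     + Re (\<Sum>l<k. \<Sum>m. kern 1 (pt m l))"
  and sum_kern_real: "Im (\<Sum>l<k. \<Sum>m. kern 1 (pt m l)) = 0"
proof -
  define Z where "Z = (\<Sum>j. 1 / (2 * pi * real (Suc j)) ^ Suc k)"
  define S where "S = (\<lambda>n. \<Sum>l<k. \<Sum>m. kern (rseq n) (pt m l))"
  define I where "I = (LINT t:{0<..}|lborel. h t * (pi * (frac t - 1 / 2)))"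
  have Slim: "S \<longlonglongrightarrow> (\<Sum>l<k. \<Sum>m. kern 1 (pt m l))"
    unfolding S_def by (intro tendsto_sum kern_pt_limit) auto
  have Seq: "(\<lambda>m. \<Sum>l<k. kern (rseq n) (pt m l)) sums S n" for n
    unfolding S_def by (intro sums_sum summable_sums kern_pt_limit) auto
  \<comment> \<open>The series of residue sums over m is evaluated twice, as \<open>S n\<close> and
    through the ray integral.\<close>
  have eqn: "(LINT t:{0<..}|lborel. h t * Im (kern (rseq n) (of_real t))) =
      pi * Re (S n) + real k * pi / 2 * ln (1 - rseq n * exp (- (2 * pi)))
        - real k * x / 2 * ((-1) ^ (k div 2) * P (rseq n))" for n
  proof -
    have "(\<lambda>m. pi * Re (\<Sum>l<k. kern (rseq n) (pt m l))) sums (pi * Re (S n))"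
      by (intro sums_mult sums_Re Seq)
    from sums_unique2[OF this Im_ray_H[OF rseq, of n]] show ?thesis
      unfolding Im_ray_H_0[OF rseq] by simp
  qed
  have e1: "exp (- (2 * pi)) < 1" by simp
  have "(\<lambda>n. pi * Re (S n) + real k * pi / 2 * ln (1 - rseq n * exp (- (2 * pi)))
        - real k * x / 2 * ((-1) ^ (k div 2) * P (rseq n))) \<longlonglongrightarrow>
     pi * Re (\<Sum>l<k. \<Sum>m. kern 1 (pt m l)) + real k * pi / 2 * ln (1 - 1 * exp (- (2 * pi)))
        - real k * x / 2 * ((-1) ^ (k div 2) * (- (fact (k - 1) * (2 * pi) * Z)))"
    unfolding Z_def using e1 by (intro tendsto_intros Slim rseq_tendsto P_limit) auto
  with h_sawtooth_limit(2) have "I = pi * Re (\<Sum>l<k. \<Sum>m. kern 1 (pt m l)) + real k * pi / 2 * ln (1 - 1 * exp (- (2 * pi)))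
        - real k * x / 2 * ((-1) ^ (k div 2) * (- (fact (k - 1) * (2 * pi) * Z)))"
    unfolding eqn I_def by (rule LIMSEQ_unique)
  moreover have "(fact k :: real) = real k * fact (k - 1)" using k_pos by (cases k) auto
  moreover have "I = pi * (LINT t:{0<..}|lborel. h t * (frac t - 1 / 2))"
    unfolding I_def set_integral_mult_right[symmetric] by (simp add: mult_ac)
  ultimately have "pi * (LINT t:{0<..}|lborel. h t * (frac t - 1 / 2)) =
     pi * (real k / 2 * ln (1 - exp (- (2 * pi))) + x * ((-1) ^ (k div 2) * fact k * Z)
     + Re (\<Sum>l<k. \<Sum>m. kern 1 (pt m l)))"
    by (simp add: algebra_simps)
  thus "(LINT t:{0<..}|lborel. h t * (frac t - 1 / 2)) =
     real k / 2 * ln (1 - exp (- (2 * pi)))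
     + x * ((-1) ^ (k div 2) * fact k * (\<Sum>j. 1 / (2 * pi * real (Suc j)) ^ Suc k))
     + Re (\<Sum>l<k. \<Sum>m. kern 1 (pt m l))" unfolding Z_def by simp
  have "(\<lambda>m. Im (\<Sum>l<k. kern (rseq n) (pt m l))) sums Im (S n)" for n
    by (intro sums_Im Seq)
  hence "Im (S n) = 0" for n unfolding Im_sum_kern_pt[OF rseq] using sums_unique2[OF _ sums_zero] by blast
  moreover have "(\<lambda>n. Im (S n)) \<longlonglongrightarrow> Im (\<Sum>l<k. \<Sum>m. kern 1 (pt m l))" by (intro tendsto_Im Slim)
  ultimately show "Im (\<Sum>l<k. \<Sum>m. kern 1 (pt m l)) = 0" by (simp add: LIMSEQ_const_iff)
qed

end

section \<open>Euler--Maclaurin summation\<close>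

lemma ln_one_plus_inverse_square_eq:
  fixes t :: real
  assumes t: "t > 0"
  shows "ln (1 + 1 / t\<^sup>2) = ln (t\<^sup>2 + 1) - 2 * ln t"
proof -
  have p: "t\<^sup>2 + 1 > 0" by (simp add: add_nonneg_pos)
  have "1 + 1 / t\<^sup>2 = (t\<^sup>2 + 1) / t\<^sup>2" using t by (simp add: field_simps)
  thus ?thesis using t p by (simp add: ln_div ln_realpow)
qed

lemma ln_one_plus_inverse_square_deriv:
  fixes t :: real
  assumes t: "t > 0"
  shows "((\<lambda>t. ln (1 + 1 / t\<^sup>2)) has_real_derivative - (2 / (t * (t\<^sup>2 + 1)))) (at t)"
proof -
  have "t\<^sup>2 + 1 > 0" by (simp add: add_nonneg_pos)
  hence "((\<lambda>t. ln (t\<^sup>2 + 1) - 2 * ln t) has_real_derivative - (2 / (t * (t\<^sup>2 + 1)))) (at t)"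
    using t by (auto intro!: derivative_eq_intros) (simp add: field_simps power2_eq_square)
  thus ?thesis
  proof (rule DERIV_cong_ev[THEN iffD1, rotated 3])
    show "\<forall>\<^sub>F u in nhds t. ln (u\<^sup>2 + 1) - 2 * ln u = ln (1 + 1 / u\<^sup>2)"
      using eventually_nhds_in_open[of "{0<..}" t] t
      by (auto simp: ln_one_plus_inverse_square_eq elim!: eventually_mono)
  qed auto
qed

context lambert begin

definition f :: "real \<Rightarrow> real" where "f t = - ln (1 - exp (- (x * t ^ k)))"

definition f0 :: "real \<Rightarrow> real" where "f0 t = ln (1 + 1 / t\<^sup>2)"

text \<open>The value at 0 is the limit: \<open>f t\<close> behaves like - ln x - k ln t there, and
  k/2 f0 t like - k ln t.\<close>

definition g :: "real \<Rightarrow> real" where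
  "g t = (if t = 0 then - ln x else f t - real k / 2 * f0 t)"

lemma one_minus_exp_pos: "t > 0 \<Longrightarrow> 1 - exp (- (x * t ^ k)) > 0"
  using x_pos by simp

lemma g_deriv:
  assumes t: "t > 0"
  shows "(g has_real_derivative - h t) (at t)"
proof -
  have e: "1 - exp (- (x * t ^ k)) > 0" using one_minus_exp_pos[OF t] .
  have e': "exp (x * t ^ k) > 1" using t x_pos by simp
  have "(f has_real_derivative - (real k * x * t ^ (k - 1) / (exp (x * t ^ k) - 1))) (at t)"
    unfolding f_def[abs_def] using e e'
    by (auto intro!: derivative_eq_intros) (simp add: exp_minus field_simps)
  moreover have "(f0 has_real_derivative - (2 / (t * (t\<^sup>2 + 1)))) (at t)"
    unfolding f0_def[abs_def] by (rule ln_one_plus_inverse_square_deriv[OF t])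
  ultimately have "((\<lambda>t. f t - real k / 2 * f0 t) has_real_derivative
      - (real k * x * t ^ (k - 1) / (exp (x * t ^ k) - 1)) - real k / 2 * (- (2 / (t * (t\<^sup>2 + 1))))) (at t)"
    by (intro DERIV_diff DERIV_cmult)
  also have "- (real k * x * t ^ (k - 1) / (exp (x * t ^ k) - 1)) - real k / 2 * (- (2 / (t * (t\<^sup>2 + 1)))) = - h t"
    by (simp add: h_def)
  finally show ?thesis
  proof (rule DERIV_cong_ev[THEN iffD1, rotated 3])
    show "\<forall>\<^sub>F u in nhds t. f u - real k / 2 * f0 u = g u"
    proof -
      have "\<forall>\<^sub>F u in nhds t. u \<in> {0<..}" using t by (intro eventually_nhds_in_open) auto
      thus ?thesis by eventually_elim (simp add: g_def)
    qed
  qed auto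
qed

lemma g_tendsto_0: "(g \<longlongrightarrow> g 0) (at_right 0)"
proof -
  have "((\<lambda>u. 1 - exp (- (x * u))) has_real_derivative x) (at 0)"
    by (auto intro!: derivative_eq_intros)
  hence "((\<lambda>u. (1 - exp (- (x * u))) / u) \<longlongrightarrow> x) (at 0)"
    unfolding DERIV_def by simp
  hence "((\<lambda>u. (1 - exp (- (x * u))) / u) \<longlongrightarrow> x) (at_right 0)"
    by (rule filterlim_mono) (auto simp: at_le)
  moreover have "filterlim (\<lambda>t::real. t ^ k) (at_right 0) (at_right 0)"
  proof -
    have "((\<lambda>t::real. t ^ k) \<longlongrightarrow> 0 ^ k) (at_right 0)" by (intro tendsto_intros)
    thus ?thesis unfolding filterlim_at using k_pos
      by (auto simp: eventually_at_filter power_0_left)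
  qed
  ultimately have "((\<lambda>t. (1 - exp (- (x * t ^ k))) / t ^ k) \<longlongrightarrow> x) (at_right 0)"
    by (rule filterlim_compose)
  hence "((\<lambda>t. - ln ((1 - exp (- (x * t ^ k))) / t ^ k) - real k / 2 * ln (t\<^sup>2 + 1)) \<longlongrightarrow>
      - ln x - real k / 2 * ln (0\<^sup>2 + 1)) (at_right 0)"
    using x_pos by (intro tendsto_intros) auto
  hence "((\<lambda>t. - ln ((1 - exp (- (x * t ^ k))) / t ^ k) - real k / 2 * ln (t\<^sup>2 + 1)) \<longlongrightarrow> g 0) (at_right 0)"
    by (simp add: g_def)
  thus ?thesis
  proof (rule Lim_transform_eventually)
    show "\<forall>\<^sub>F t in at_right 0. - ln ((1 - exp (- (x * t ^ k))) / t ^ k) - real k / 2 * ln (t\<^sup>2 + 1) = g t"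
      using eventually_at_right_less[of 0]
    proof eventually_elim
      case (elim t)
      have e: "1 - exp (- (x * t ^ k)) > 0" by (rule one_minus_exp_pos[OF elim])
      have f0: "f0 t = ln (t\<^sup>2 + 1) - 2 * ln t" unfolding f0_def by (rule ln_one_plus_inverse_square_eq[OF elim])
      have q: "ln ((1 - exp (- (x * t ^ k))) / t ^ k) = - f t - real k * ln t"
        unfolding f_def using e elim x_pos by (simp add: ln_div ln_realpow)
      have "g t = f t - real k / 2 * f0 t" using elim by (simp add: g_def)
      thus ?case unfolding f0 q by (simp add: right_diff_distrib)
    qed
  qed
qed

lemma g_continuous: "continuous_on {0..} g"
  unfolding continuous_on_def
proof
  fix t :: real assume t: "t \<in> {0..}"
  show "(g \<longlongrightarrow> g t) (at t within {0..})"
  proof (cases "t = 0")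
    case True
    have "at (0::real) within {0..} = at_right 0" by (rule at_within_nhd[of _ UNIV]) auto
    thus ?thesis using g_tendsto_0 True by simp
  next
    case False
    hence "isCont g t" using t g_deriv[of t] by (auto intro: DERIV_isCont)
    thus ?thesis by (simp add: isCont_def tendsto_within_subset[OF _ subset_UNIV])
  qed
qed

lemma g_tendsto_infinity: "(\<lambda>n. g (real n)) \<longlonglongrightarrow> 0"
proof -
  have "filterlim (\<lambda>n. real n ^ k) at_top sequentially"
    using k_pos by (intro filterlim_pow_at_top filterlim_real_sequentially) auto
  hence "filterlim (\<lambda>n. x * real n ^ k) at_top sequentially"
    using x_pos by (intro filterlim_tendsto_pos_mult_at_top[OF tendsto_const]) auto
  hence "(\<lambda>n. exp (- (x * real n ^ k))) \<longlonglongrightarrow> 0"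
    by (intro filterlim_compose[OF exp_at_bot] filterlim_compose[OF filterlim_uminus_at_bot_at_top])
  hence A: "(\<lambda>n. - ln (1 - exp (- (x * real n ^ k)))) \<longlonglongrightarrow> - ln (1 - 0)"
    by (intro tendsto_intros) auto
  have B: "(\<lambda>n. ln (1 + 1 / (real n)\<^sup>2)) \<longlonglongrightarrow> 0" by real_asymp
  have "(\<lambda>n. f (real n) - real k / 2 * f0 (real n)) \<longlonglongrightarrow> - ln (1 - 0) - real k / 2 * 0"
    unfolding f_def f0_def by (intro tendsto_diff A tendsto_mult_left B)
  hence "(\<lambda>n. f (real n) - real k / 2 * f0 (real n)) \<longlonglongrightarrow> 0" by simp
  thus ?thesis
  proof (rule Lim_transform_eventually)
    show "\<forall>\<^sub>F n in sequentially. f (real n) - real k / 2 * f0 (real n) = g (real n)"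
      using eventually_gt_at_top[of 0] by eventually_elim (simp add: g_def)
  qed
qed

text \<open>(t - n - 1/2) g t is an antiderivative, since g' = - h, and its end values form the
  trapezoid. For n = 0 only continuity of \<open>g\<close> is known at 0, hence the interior version
  of the fundamental theorem.\<close>

lemma euler_maclaurin_step:
  "((\<lambda>t. g t - h t * (frac t - 1 / 2)) has_integral (g (real n) + g (real (Suc n))) / 2) {real n..real (Suc n)}"
proof -
  have "((\<lambda>t. g t - h t * (t - real n - 1 / 2)) has_integral
      ((real (Suc n) - real n - 1 / 2) * g (real (Suc n)) - (real n - real n - 1 / 2) * g (real n))) {real n..real (Suc n)}"
  proof (rule fundamental_theorem_of_calculus_interior)
    show "continuous_on {real n..real (Suc n)} (\<lambda>t. (t - real n - 1 / 2) * g t)"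
      by (intro continuous_intros continuous_on_subset[OF g_continuous]) auto
    fix t assume t: "t \<in> {real n<..<real (Suc n)}"
    have "t > 0" using t of_nat_0_le_iff[of n] by (auto intro: order.strict_trans1)
    have "((\<lambda>t. (t - real n - 1 / 2) * g t) has_real_derivative (1 * g t + (- h t) * (t - real n - 1 / 2))) (at t)"
      by (intro DERIV_mult g_deriv \<open>t > 0\<close>) (auto intro!: derivative_eq_intros)
    thus "((\<lambda>t. (t - real n - 1 / 2) * g t) has_vector_derivative g t - h t * (t - real n - 1 / 2)) (at t)"
      by (simp add: has_real_derivative_iff_has_vector_derivative)
  qed auto
  hence "((\<lambda>t. g t - h t * (t - real n - 1 / 2)) has_integral (g (real n) + g (real (Suc n))) / 2) {real n..real (Suc n)}"
    by (simp add: field_simps)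
  \<comment> \<open>At the right end point \<open>frac t\<close> jumps to 0; one point does not
    affect the integral.\<close>
  thus ?thesis
  proof (rule has_integral_spike_finite[of "{real (Suc n)}", rotated 2])
    fix t assume t: "t \<in> {real n..real (Suc n)} - {real (Suc n)}"
    hence "\<lfloor>t\<rfloor> = int n" by (intro floor_unique) auto
    thus "g t - h t * (frac t - 1 / 2) = g t - h t * (t - real n - 1 / 2)" by (simp add: frac_def)
  qed auto
qed

text \<open>The steps add up to a trapezoidal sum with weight 1/2 at 0 and at N. The end at N
  vanishes in the limit, and g 0 = - ln x is the source of the term ln x / 2.\<close>

lemma euler_maclaurin:
  assumes g: "set_integrable lborel {0<..} g"
  shows "(\<lambda>n. g (real (Suc n))) sums
     ((LINT t:{0<..}|lborel. g t) - (LINT t:{0<..}|lborel. h t * (frac t - 1 / 2)) - g 0 / 2)"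
proof -
  define \<phi> where "\<phi> = (\<lambda>t. g t - h t * (frac t - 1 / 2))"
  have saw: "set_integrable lborel {0<..} (\<lambda>t. h t * (frac t - 1 / 2))"
  proof -
    have "(\<lambda>t. 1 / pi * (h t * (pi * (frac t - 1 / 2)))) = (\<lambda>t. h t * (frac t - 1 / 2))" by (rule ext) simp
    thus ?thesis using set_integrable_mult_right[OF h_sawtooth_limit(1), of "1 / pi"] by simp
  qed
  have phi: "set_integrable lborel {0..} \<phi>"
    unfolding \<phi>_def set_integrable_Ici_iff_Ioi by (intro set_integral_diff g saw)
  have val: "(LINT t:{0..}|lborel. \<phi> t) = (LINT t:{0<..}|lborel. g t) - (LINT t:{0<..}|lborel. h t * (frac t - 1 / 2))"
    unfolding \<phi>_def set_lebesgue_integral_Ici_eq_Ioi by (intro set_integral_diff g saw)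
  have fin: "(LINT t:{0..real N}|lborel. \<phi> t) = (\<Sum>n<N. g (real (Suc n))) + g 0 / 2 - g (real N) / 2" for N
  proof -
    have "(\<phi> has_integral ((\<Sum>n<N. g (real (Suc n))) + g 0 / 2 - g (real N) / 2)) {0..real N}"
    proof (induction N)
      case 0
      show ?case using has_integral_refl(2)[of \<phi> 0] by simp
    next
      case (Suc N)
      have "(\<phi> has_integral ((\<Sum>n<N. g (real (Suc n))) + g 0 / 2 - g (real N) / 2) + (g (real N) + g (real (Suc N))) / 2) {0..real (Suc N)}"
        using euler_maclaurin_step[of N] by (intro has_integral_combine[OF _ _ Suc]) (auto simp: \<phi>_def)
      also have "((\<Sum>n<N. g (real (Suc n))) + g 0 / 2 - g (real N) / 2) + (g (real N) + g (real (Suc N))) / 2 =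
          (\<Sum>n<Suc N. g (real (Suc n))) + g 0 / 2 - g (real (Suc N)) / 2"
        by (simp add: add_divide_distrib del: of_nat_Suc)
      finally show ?case .
    qed
    moreover have "set_integrable lborel {0..real N} \<phi>" by (rule set_integrable_subset[OF phi]) auto
    ultimately show ?thesis using set_borel_integral_eq_integral(2) by (metis integral_unique)
  qed
  have "(\<lambda>N. LINT t:{0..real N}|lborel. \<phi> t) \<longlonglongrightarrow> (LINT t:{0..}|lborel. \<phi> t)"
    by (rule filterlim_compose[OF tendsto_set_lebesgue_integral_at_top filterlim_real_sequentially]) (use phi in auto)
  hence "(\<lambda>N. (LINT t:{0..real N}|lborel. \<phi> t) - g 0 / 2 + g (real N) / 2) \<longlonglongrightarrow> (LINT t:{0..}|lborel. \<phi> t) - g 0 / 2 + 0 / 2"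
    by (intro tendsto_intros g_tendsto_infinity) auto
  thus ?thesis unfolding sums_def fin val by simp
qed

end

section \<open>Integrals and sums of the summand and of the comparison function\<close>

lemma exp_minus_power_integral:
  fixes y :: real and k :: nat
  assumes y: "y > 0" and k: "k > 0"
  shows "set_integrable lborel {0<..} (\<lambda>t. exp (- (y * t ^ k)))"
    and "(LINT t:{0<..}|lborel. exp (- (y * t ^ k))) = 1 / real k * Gamma (1 / real k) * y powr (- (1 / real k))"
proof -
  define p where "p = 1 / real k"
  have p: "p > 0" using k by (simp add: p_def)
  define G where "G = p * (Gamma p * y powr (- p))"
  have int: "set_integrable lborel {0<..} (\<lambda>u. p * (u powr (p - 1) * exp (- (y * u))))"
    using p y by (intro set_integrable_mult_right set_integrable_lborel_powr_exp) auto
  have val: "integral {0<..} (\<lambda>u. p * (u powr (p - 1) * exp (- (y * u)))) = G"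
    unfolding set_borel_integral_eq_integral(2)[OF int, symmetric] set_integral_mult_right powr_exp_integral[OF y p] G_def ..
  have abs: "(\<lambda>u. p * (u powr (p - 1) * exp (- (y * u)))) absolutely_integrable_on {0<..}"
    using int unfolding set_integrable_def by (subst integrable_completion) auto
  have eq: "\<bar>p * u powr (p - 1)\<bar> * exp (- (y * (u powr p) ^ k)) = p * (u powr (p - 1) * exp (- (y * u)))" if "u \<in> {0<..}" for u
  proof -
    have "(u powr p) ^ k = u" using that k by (simp add: p_def powr_power)
    thus ?thesis using p by simp
  qed
  \<comment> \<open>The substitution t = u^(1/k): p u^(p-1) is its Jacobian, and the exponent
    becomes linear in u.\<close>
  have "(\<lambda>u. \<bar>p * u powr (p - 1)\<bar> * exp (- (y * (u powr p) ^ k))) absolutely_integrable_on {0<..} \<and>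
       integral {0<..} (\<lambda>u. \<bar>p * u powr (p - 1)\<bar> * exp (- (y * (u powr p) ^ k))) = G"
  proof
    show "(\<lambda>u. \<bar>p * u powr (p - 1)\<bar> * exp (- (y * (u powr p) ^ k))) absolutely_integrable_on {0<..}"
      using abs by (subst set_integrable_cong[OF refl refl eq]) auto
    show "integral {0<..} (\<lambda>u. \<bar>p * u powr (p - 1)\<bar> * exp (- (y * (u powr p) ^ k))) = G"
      unfolding val[symmetric] by (rule Henstock_Kurzweil_Integration.integral_cong) (rule eq)
  qed
  also have "?this \<longleftrightarrow> (\<lambda>t. exp (- (y * t ^ k))) absolutely_integrable_on ((\<lambda>u. u powr p) ` {0<..}) \<and>
      integral ((\<lambda>u. u powr p) ` {0<..}) (\<lambda>t. exp (- (y * t ^ k))) = G"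
  proof (rule has_absolute_integral_change_of_variables_1')
    show "((\<lambda>u. u powr p) has_real_derivative p * u powr (p - 1)) (at u within {0<..})" if "u \<in> {0<..}" for u
      using that by (auto intro!: derivative_eq_intros)
    show "inj_on (\<lambda>u. u powr p) {0<..}"
    proof (rule inj_on_inverseI)
      show "(u powr p) powr (1 / p) = u" if "u \<in> {0<..}" for u
        using that p by (simp add: powr_powr)
    qed
  qed auto
  also have "(\<lambda>u::real. u powr p) ` {0<..} = {0<..}"
  proof (intro equalityI subsetI)
    fix t :: real assume "t \<in> {0<..}"
    hence "t = (t ^ k) powr p" "t ^ k \<in> {0<..}" using k by (auto simp: p_def powr_powr simp flip: powr_realpow)
    thus "t \<in> (\<lambda>u. u powr p) ` {0<..}" by blast
  qed auto
  finally have R: "(\<lambda>t. exp (- (y * t ^ k))) absolutely_integrable_on {0<..}" "integral {0<..} (\<lambda>t. exp (- (y * t ^ k))) = G"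
    by blast+
  show int2: "set_integrable lborel {0<..} (\<lambda>t. exp (- (y * t ^ k)))"
    using R(1) unfolding set_integrable_def by (subst (asm) integrable_completion) auto
  show "(LINT t:{0<..}|lborel. exp (- (y * t ^ k))) = 1 / real k * Gamma (1 / real k) * y powr (- (1 / real k))"
    unfolding set_borel_integral_eq_integral(2)[OF int2] R(2) G_def p_def by simp
qed

lemma ln_one_plus_inverse_square_integral:
  "set_integrable lborel {0<..} (\<lambda>t::real. ln (1 + 1 / t\<^sup>2))"
  "(LINT t:{0<..}|lborel. ln (1 + 1 / t\<^sup>2)) = pi"
proof -
  \<comment> \<open>An antiderivative by parts; its first summand vanishes at both ends, and 2
    arctan t supplies the value pi.\<close>
  define F where "F = (\<lambda>t::real. t * ln (1 + 1 / t\<^sup>2) + 2 * arctan t)"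
  have p: "1 + 1 / t\<^sup>2 > 0" if "t > 0" for t :: real using that by (simp add: add_pos_nonneg)
  have E: "einterval 0 \<infinity> = {0::real<..}" by (auto simp: einterval_def zero_ereal_def)
  have D: "(F has_real_derivative ln (1 + 1 / t\<^sup>2)) (at t)" if t: "t > 0" for t
  proof -
    have "(F has_real_derivative (1 * ln (1 + 1 / t\<^sup>2) + - (2 / (t * (t\<^sup>2 + 1))) * t + 2 * inverse (1 + t\<^sup>2))) (at t)"
      unfolding F_def by (intro DERIV_add DERIV_mult ln_one_plus_inverse_square_deriv t DERIV_ident DERIV_cmult DERIV_arctan)
    also have "1 * ln (1 + 1 / t\<^sup>2) + - (2 / (t * (t\<^sup>2 + 1))) * t + 2 * inverse (1 + t\<^sup>2) = ln (1 + 1 / t\<^sup>2)"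
    proof -
      have "- (2 / (t * (t\<^sup>2 + 1))) * t = - (2 / (t\<^sup>2 + 1))" using t by simp
      thus ?thesis by (simp add: inverse_eq_divide add.commute)
    qed
    finally show ?thesis .
  qed
  have "(F \<longlongrightarrow> 0) (at_right 0)" unfolding F_def by real_asymp
  hence A: "((F \<circ> real_of_ereal) \<longlongrightarrow> 0) (at_right 0)" by (simp add: ereal_tendsto_simps zero_ereal_def)
  have "(F \<longlongrightarrow> pi) at_top" unfolding F_def by real_asymp
  hence B: "((F \<circ> real_of_ereal) \<longlongrightarrow> pi) (at_left \<infinity>)" by (simp add: ereal_tendsto_simps)
  have C: "isCont (\<lambda>t. ln (1 + 1 / t\<^sup>2)) t" if "t > 0" for t :: real
    using that p[OF that] by (auto intro!: continuous_intros)
  have I: "set_integrable lborel (einterval 0 \<infinity>) (\<lambda>t. ln (1 + 1 / t\<^sup>2))"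
       "(LBINT t=0..\<infinity>. ln (1 + 1 / t\<^sup>2)) = pi - 0"
    by (rule interval_integral_FTC_nonneg[where F = F]; use D A B C in \<open>auto simp: zero_ereal_def intro!: AE_I2\<close>)+
  show "set_integrable lborel {0<..} (\<lambda>t::real. ln (1 + 1 / t\<^sup>2))" using I(1) unfolding E .
  show "(LINT t:{0<..}|lborel. ln (1 + 1 / t\<^sup>2)) = pi"
    using I(2) by (simp add: interval_lebesgue_integral_def E)
qed

text \<open>Euler's sine product at pi i gives sinh pi / pi = e^pi (1 - e^(-2 pi)) / (2 pi). The
  logarithms of the first two factors cancel later; the third leaves ln (2 pi).\<close>

lemma ln_one_plus_inverse_square_sums:
  "(\<lambda>n. ln (1 + 1 / real (Suc n) ^ 2)) sums (pi + ln (1 - exp (- (2 * pi))) - ln (2 * pi))"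
proof -
  have "(\<lambda>n. of_real pi * \<i> * (\<Prod>k=1..n. 1 - \<i>^2 / of_nat k^2)) \<longlonglongrightarrow> sin (of_real pi * \<i>)"
    by (rule sin_product_formula_complex)
  also have "(\<lambda>n. of_real pi * \<i> * (\<Prod>k=1..n. 1 - \<i>^2 / of_nat k^2)) =
      (\<lambda>n. \<i> * of_real (pi * (\<Prod>k=1..n. 1 + 1 / real k ^ 2)))"
  proof
    fix n
    have "(\<Prod>k=1..n. 1 - \<i>^2 / of_nat k^2) = complex_of_real (\<Prod>k=1..n. 1 + 1 / real k ^ 2)" by simp
    thus "of_real pi * \<i> * (\<Prod>k=1..n. 1 - \<i>^2 / of_nat k^2) = \<i> * of_real (pi * (\<Prod>k=1..n. 1 + 1 / real k ^ 2))"
      by (simp only: of_real_mult mult.assoc mult.left_commute)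
  qed
  also have "sin (of_real pi * \<i>) = \<i> * of_real (sinh pi)"
  proof -
    have "exp (- complex_of_real pi) = of_real (exp (- pi))" by (simp flip: exp_of_real)
    hence "sinh (complex_of_real pi) = of_real (sinh pi)"
      by (simp add: sinh_field_def exp_of_real)
    moreover have "\<i> * (of_real pi * \<i>) = - complex_of_real pi" by (simp add: complex_eq_iff)
    ultimately show ?thesis unfolding sin_conv_sinh by simp
  qed
  finally have "(\<lambda>n. Im (\<i> * of_real (pi * (\<Prod>k=1..n. 1 + 1 / real k ^ 2)))) \<longlonglongrightarrow> Im (\<i> * of_real (sinh pi))"
    by (rule tendsto_Im)
  hence "(\<lambda>n. pi * (\<Prod>k=1..n. 1 + 1 / real k ^ 2)) \<longlonglongrightarrow> sinh pi"
    by (simp only: Im_i_times Re_complex_of_real)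
  hence "(\<lambda>n. pi * (\<Prod>k=1..n. 1 + 1 / real k ^ 2) / pi) \<longlonglongrightarrow> sinh pi / pi" by (intro tendsto_divide) auto
  hence "(\<lambda>n. ln (\<Prod>k=1..n. 1 + 1 / real k ^ 2)) \<longlonglongrightarrow> ln (sinh pi / pi)"
    by (intro tendsto_ln) auto
  also have "(\<lambda>n. ln (\<Prod>k=1..n. 1 + 1 / real k ^ 2)) = (\<lambda>n. \<Sum>i<n. ln (1 + 1 / real (Suc i) ^ 2))"
  proof
    fix n
    have pos: "1 + 1 / real k ^ 2 > 0" for k by (intro add_pos_nonneg) auto
    have "ln (\<Prod>k=1..n. 1 + 1 / real k ^ 2) = (\<Sum>k=1..n. ln (1 + 1 / real k ^ 2))"
      by (rule ln_prod) (use pos less_irrefl in \<open>simp, metis\<close>)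
    also have "\<dots> = (\<Sum>i<n. ln (1 + 1 / real (Suc i) ^ 2))"
      by (rule sum.reindex_bij_witness[of _ Suc "\<lambda>k. k - 1"]) auto
    finally show "ln (\<Prod>k=1..n. 1 + 1 / real k ^ 2) = (\<Sum>i<n. ln (1 + 1 / real (Suc i) ^ 2))" .
  qed
  also have "ln (sinh pi / pi) = pi + ln (1 - exp (- (2 * pi))) - ln (2 * pi)"
  proof -
    have "sinh pi / pi = exp pi * (1 - exp (- (2 * pi))) / (2 * pi)"
      by (simp add: sinh_field_def right_diff_distrib flip: exp_add)
    thus ?thesis by (simp add: ln_div ln_mult)
  qed
  finally show ?thesis unfolding sums_def .
qed

context lambert begin

text \<open>The logarithm expands into e^(-n x t^k) / n, whose integral scales as n^(-1-1/k); this
  is where zeta (1 + 1/k) enters.\<close>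

lemma f_integral:
  "set_integrable lborel {0<..} f"
  "(LINT t:{0<..}|lborel. f t) = 1 / real k * Gamma (1 / real k) * x powr (- (1 / real k)) * (\<Sum>n. real (Suc n) powr (- (1 + 1 / real k)))"
proof -
  define p where "p = 1 / real k"
  have p: "p > 0" using k_pos by (simp add: p_def)
  define c where "c = p * Gamma p * x powr (- p)"
  define F where "F = (\<lambda>n t. 1 / real (Suc n) * exp (- ((real (Suc n) * x) * t ^ k)))"
  have y: "real (Suc n) * x > 0" for n using x_pos by simp
  have F1: "set_integrable lborel {0<..} (F n)" for n
    unfolding F_def by (intro set_integrable_mult_right exp_minus_power_integral y k_pos)
  have F1': "(LINT t:{0<..}|lborel. F n t) = c * real (Suc n) powr (- (1 + p))" for n
  proof -
    have "(LINT t:{0<..}|lborel. F n t) = 1 / real (Suc n) * (p * Gamma p * (real (Suc n) * x) powr (- p))"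
      unfolding F_def set_integral_mult_right exp_minus_power_integral(2)[OF y k_pos] p_def ..
    also have "\<dots> = c * (real (Suc n) powr (-1) * real (Suc n) powr (- p))"
      using x_pos by (simp add: c_def powr_mult powr_minus field_simps del: of_nat_Suc)
    also have "real (Suc n) powr (-1) * real (Suc n) powr (- p) = real (Suc n) powr (- (1 + p))"
      by (simp only: powr_add[symmetric]) simp
    finally show ?thesis .
  qed
  have Fsums: "(\<lambda>n. F n t) sums f t" if t: "t \<in> {0<..}" for t
  proof -
    define u where "u = exp (- (x * t ^ k))"
    have u: "0 < u" "u < 1" using t x_pos by (auto simp: u_def)
    have "(\<lambda>n. u ^ Suc n / real (Suc n)) sums (- ln (1 - u))" by (rule minus_ln_one_minus_sums[OF u])
    also have "(\<lambda>n. u ^ Suc n / real (Suc n)) = (\<lambda>n. F n t)"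
    proof
      fix n
      have "u ^ Suc n = exp (- ((real (Suc n) * x) * t ^ k))"
        unfolding u_def exp_of_nat_mult[symmetric] by (simp add: mult_ac)
      thus "u ^ Suc n / real (Suc n) = F n t" by (simp add: F_def)
    qed
    finally show ?thesis by (simp add: f_def u_def)
  qed
  have Fnn: "norm (F n t) = F n t" for n t by (simp add: F_def)
  have F2: "summable (\<lambda>n. norm (F n t))" if "t \<in> {0<..}" for t
    using Fsums[OF that] unfolding Fnn by (simp add: sums_iff)
  have s: "summable (\<lambda>n. real (Suc n) powr (- (1 + p)))"
    using p by (subst summable_Suc_iff[of "\<lambda>n. real n powr (- (1 + p))"]) (subst summable_real_powr_iff, simp)
  have F3: "summable (\<lambda>n. LINT t:{0<..}|lborel. norm (F n t))"
    unfolding Fnn F1' by (intro summable_mult s)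
  note FF = set_sums_integral[OF F1 F2 F3]
  have eq: "(\<Sum>n. F n t) = f t" if "t \<in> {0<..}" for t using Fsums[OF that] by (simp add: sums_iff)
  have "set_integrable lborel {0<..} f \<longleftrightarrow> set_integrable lborel {0<..} (\<lambda>t. \<Sum>n. F n t)"
    by (rule set_integrable_cong) (use eq in auto)
  thus "set_integrable lborel {0<..} f" using FF(1) by blast
  have "(LINT t:{0<..}|lborel. f t) = (LINT t:{0<..}|lborel. \<Sum>n. F n t)"
    by (rule set_lebesgue_integral_cong) (use eq in auto)
  also have "\<dots> = (\<Sum>n. c * real (Suc n) powr (- (1 + p)))"
    using FF(2) unfolding F1' by (simp add: sums_iff)
  also have "\<dots> = c * (\<Sum>n. real (Suc n) powr (- (1 + p)))" by (intro suminf_mult s)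
  finally show "(LINT t:{0<..}|lborel. f t) = 1 / real k * Gamma (1 / real k) * x powr (- (1 / real k)) * (\<Sum>n. real (Suc n) powr (- (1 + 1 / real k)))"
    by (simp add: c_def p_def)
qed

text \<open>Adding back the sum of the comparison function cancels its integral k pi / 2 and the
  contribution of the pole \<open>\<i>\<close>, (k/2) ln (1 - e^(-2 pi)).\<close>

lemma f_sums:
  "(\<lambda>n. f (real (Suc n))) sums
     (1 / real k * Gamma (1 / real k) * x powr (- (1 / real k)) * (\<Sum>n. real (Suc n) powr (- (1 + 1 / real k)))
      + ln x / 2 - real k / 2 * ln (2 * pi)
      - x * ((-1) ^ (k div 2) * fact k * (\<Sum>j. 1 / (2 * pi * real (Suc j)) ^ Suc k))
      - Re (\<Sum>l<k. \<Sum>m. kern 1 (pt m l)))" (is "_ sums ?R")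
proof -
  note f0i = ln_one_plus_inverse_square_integral[folded f0_def]
  have "set_integrable lborel {0<..} (\<lambda>t. f t - real k / 2 * f0 t)"
    by (intro set_integral_diff set_integrable_mult_right f_integral f0i)
  hence g: "set_integrable lborel {0<..} g"
    by (subst set_integrable_cong[of lborel lborel "{0<..}" "{0<..}" g "\<lambda>t. f t - real k / 2 * f0 t"]) (auto simp: g_def)
  have "(LINT t:{0<..}|lborel. g t) = (LINT t:{0<..}|lborel. f t - real k / 2 * f0 t)"
    by (rule set_lebesgue_integral_cong) (auto simp: g_def)
  also have "\<dots> = (LINT t:{0<..}|lborel. f t) - (LINT t:{0<..}|lborel. real k / 2 * f0 t)"
    by (intro set_integral_diff set_integrable_mult_right f_integral f0i)
  also have "(LINT t:{0<..}|lborel. real k / 2 * f0 t) = real k / 2 * pi" using f0i(2) by simp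
  finally have gval: "(LINT t:{0<..}|lborel. g t) = (LINT t:{0<..}|lborel. f t) - real k / 2 * pi" .
  have "(\<lambda>n. real k / 2 * f0 (real (Suc n))) sums (real k / 2 * (pi + ln (1 - exp (- (2 * pi))) - ln (2 * pi)))"
    unfolding f0_def by (intro sums_mult ln_one_plus_inverse_square_sums)
  from sums_add[OF euler_maclaurin[OF g] this]
  have "(\<lambda>n. g (real (Suc n)) + real k / 2 * f0 (real (Suc n))) sums ?R"
    unfolding gval f_integral(2) sawtooth_integral by (simp add: g_def algebra_simps)
  thus ?thesis by (simp add: g_def del: of_nat_Suc)
qed

end

section \<open>The series of divisor sums\<close>

lemma finite_power_divisors:
  assumes "k > 0" "n > 0"
  shows "finite {d::nat. d \<ge> 1 \<and> d ^ k dvd n}"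
proof (rule finite_subset)
  show "{d. d \<ge> 1 \<and> d ^ k dvd n} \<subseteq> {..n}"
  proof
    fix d assume "d \<in> {d. d \<ge> 1 \<and> d ^ k dvd n}"
    hence "d ^ k \<le> n" "d \<ge> 1" using assms by (auto dest: dvd_imp_le)
    moreover have "d ^ 1 \<le> d ^ k" using \<open>d \<ge> 1\<close> assms by (intro power_increasing) auto
    ultimately show "d \<in> {..n}" by simp
  qed
qed simp

lemma bij_betw_Suc_atLeast_1: "bij_betw Suc UNIV {1..}"
  by (rule bij_betwI[of _ _ _ "\<lambda>n. n - 1"]) auto

lemma has_sum_nat_Suc_imp_sums:
  fixes f :: "nat \<Rightarrow> real"
  assumes "(f has_sum S) {1..}"
  shows "(\<lambda>n. f (Suc n)) sums S"
  using assms has_sum_reindex_bij_betw[OF bij_betw_Suc_atLeast_1, of f S]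
  by (intro has_sum_imp_sums) simp

context lambert begin

text \<open>Lambert's rearrangement: f d is the sum over m of e^(-m x d^k) / m, and for n = m d^k
  the weight 1/m is (n / d^k)^(-1). All terms are non-negative, so the double series may be
  regrouped freely.\<close>

lemma D_series_sums:
  assumes f: "(\<lambda>n. f (real (Suc n))) sums S"
  shows "(\<lambda>n. D k (-1) (Suc n) * exp (- (real (Suc n) * x))) sums S"
proof -
  define F where "F = (\<lambda>(d::nat, m::nat). exp (- (real m * (x * real d ^ k))) / real m)"
  have inner: "((\<lambda>m. F (d, m)) has_sum f (real d)) {1..}" if d: "d \<ge> 1" for d
  proof -
    define u where "u = exp (- (x * real d ^ k))"
    have u: "0 < u" "u < 1" using d x_pos by (auto simp: u_def)
    have "(\<lambda>n. u ^ Suc n / real (Suc n)) sums (- ln (1 - u))" by (rule minus_ln_one_minus_sums[OF u])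
    also have "(\<lambda>n. u ^ Suc n / real (Suc n)) = (\<lambda>n. F (d, Suc n))"
    proof
      fix n
      have "u ^ Suc n = exp (- (real (Suc n) * (x * real d ^ k)))"
        unfolding u_def exp_of_nat_mult[symmetric] by (simp add: mult_ac)
      thus "u ^ Suc n / real (Suc n) = F (d, Suc n)" by (simp add: F_def)
    qed
    also have "- ln (1 - u) = f (real d)" by (simp add: f_def u_def)
    finally have "(\<lambda>n. F (d, Suc n)) sums f (real d)" .
    hence "((\<lambda>n. F (d, Suc n)) has_sum f (real d)) UNIV"
      by (rule sums_nonneg_imp_has_sum) (simp add: F_def)
    thus ?thesis unfolding has_sum_reindex_bij_betw[OF bij_betw_Suc_atLeast_1, of "\<lambda>m. F (d, m)"] .
  qed
  have f0: "f (real d) \<ge> 0" if "d \<ge> 1" for d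
    using that x_pos by (auto simp: f_def intro!: ln_le_zero_iff[THEN iffD2])
  have "((\<lambda>n. f (real (Suc n))) has_sum S) UNIV"
    by (rule sums_nonneg_imp_has_sum[OF f]) (rule f0, simp)
  hence outer: "((\<lambda>d. f (real d)) has_sum S) {1..}"
    unfolding has_sum_reindex_bij_betw[OF bij_betw_Suc_atLeast_1, of "\<lambda>d. f (real d)"] .
  have "(F has_sum S) ({1..} \<times> {1..})"
  proof (rule has_sum_SigmaI[OF inner outer])
    show "F summable_on {1..} \<times> {1..}"
      by (rule summable_on_SigmaI[OF inner]) (use outer in \<open>auto simp: F_def has_sum_imp_summable\<close>)
  qed auto
  define E where "E = (\<lambda>(n::nat, d::nat). (real n / real d ^ k) powi (-1) * exp (- (real n * x)))"
  have bij: "bij_betw (\<lambda>(d::nat, m::nat). (d ^ k * m, d)) ({1..} \<times> {1..}) (SIGMA n:{1..}. {d. d \<ge> 1 \<and> d ^ k dvd n})"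
    by (rule bij_betwI[of _ _ _ "\<lambda>(n::nat, d::nat). (d, n div d ^ k)"])
       (auto simp: Suc_le_eq elim!: dvdE)
  have EF: "E (case p of (d, m) \<Rightarrow> (d ^ k * m, d)) = F p" if p: "p \<in> {1..} \<times> {1..}" for p
    using p by (auto simp: E_def F_def power_int_minus field_simps split: prod.splits)
  have "((\<lambda>p. E (case p of (d, m) \<Rightarrow> (d ^ k * m, d))) has_sum S) ({1..} \<times> {1..})"
    using \<open>(F has_sum S) ({1..} \<times> {1..})\<close> by (subst has_sum_cong[OF EF])
  hence "(E has_sum S) (SIGMA n:{1..}. {d. d \<ge> 1 \<and> d ^ k dvd n})"
    by (subst (asm) has_sum_reindex_bij_betw[OF bij])
  hence "((\<lambda>n. D k (-1) n * exp (- (real n * x))) has_sum S) {1..}"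
  proof (rule has_sum_SigmaD)
    fix n :: nat assume n: "n \<in> {1..}"
    have "((\<lambda>d. E (n, d)) has_sum (\<Sum>d | d \<ge> 1 \<and> d ^ k dvd n. E (n, d))) {d. d \<ge> 1 \<and> d ^ k dvd n}"
      by (rule has_sum_finite) (use n k_pos finite_power_divisors[of k n] in auto)
    thus "((\<lambda>d. E (n, d)) has_sum D k (-1) n * exp (- (real n * x))) {d. d \<ge> 1 \<and> d ^ k dvd n}"
      by (simp add: E_def D_def sum_distrib_right)
  qed
  thus ?thesis by (rule has_sum_nat_Suc_imp_sums)
qed

section \<open>Matching the residues with the logarithms of the statement\<close>

definition jset :: "int set" where
  "jset = {j. - (int k - 1) \<le> j \<and> j \<le> int k - 1 \<and> [j = int k - 1] (mod 2)}"

lemma jset_bij: "bij_betw (\<lambda>l. 2 * int l - (int k - 1)) {..<k} jset"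
proof (rule bij_betwI[of _ _ _ "\<lambda>j. nat ((j + (int k - 1)) div 2)"])
  have e: "even (int k - 1)" using odd_k by simp
  show "(\<lambda>l. 2 * int l - (int k - 1)) \<in> {..<k} \<rightarrow> jset"
    using e by (auto simp: jset_def cong_def mod_2_eq_odd)
  show "(\<lambda>j. nat ((j + (int k - 1)) div 2)) \<in> jset \<rightarrow> {..<k}"
    using k_pos by (auto simp: jset_def)
  show "nat ((2 * int l - (int k - 1) + (int k - 1)) div 2) = l" for l by simp
  fix j assume j: "j \<in> jset"
  hence "even j" using e by (auto simp: jset_def cong_def mod_2_eq_odd split: if_splits)
  hence "2 * ((j + (int k - 1)) div 2) = j + (int k - 1)" using e by simp
  thus "2 * int (nat ((j + (int k - 1)) div 2)) - (int k - 1) = j"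
    using j by (auto simp: jset_def)
qed

text \<open>j = 2 l - (k - 1) gives j / (2k) = (2 l + 1) / (2k) - 1/2, so the exponential is that of
  \<open>pt m l\<close> divided by i, and the minus sign in the exponent turns 1/i into i. The
  powers of 2 pi combine to 2 pi times the radius of \<open>pt m l\<close>.\<close>

lemma log_arg_eq:
  "ln (log_arg k x (2 * int l - (int k - 1)) (Suc m)) = kern 1 (pt m l)"
proof -
  define a where "a = pole m powr (1 / real k)"
  have "(2 * pi) powr (1 + 1 / real k) * (real (Suc m) / x) powr (1 / real k) = 2 * pi * a"
  proof -
    have "pole m = 2 * pi * (real (Suc m) / x)" by (simp add: pole_def)
    hence "a = (2 * pi) powr (1 / real k) * (real (Suc m) / x) powr (1 / real k)"
      unfolding a_def using x_pos by (simp only: powr_mult)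
    thus ?thesis by (simp add: powr_add)
  qed
  moreover have "exp (\<i> * of_real pi * of_int (2 * int l - (int k - 1)) / (2 * of_nat k)) =
       cis (real (2 * l + 1) * pi / (2 * real k)) / \<i>"
  proof -
    have "exp (\<i> * of_real a - \<i> * of_real b) = cis a / cis b" for a b
      by (simp only: exp_diff cis_conv_exp)
    note polar = this
    have "\<i> * of_real pi * of_int (2 * int l - (int k - 1)) / (2 * of_nat k) =
        \<i> * of_real (real (2 * l + 1) * pi / (2 * real k)) - \<i> * of_real (pi / 2)"
      using k_pos by (simp add: field_simps)
    thus ?thesis by (simp only: polar cis_pi_half)
  qed
  ultimately have "log_arg k x (2 * int l - (int k - 1)) (Suc m) =
      1 - exp (- (cis (real (2 * l + 1) * pi / (2 * real k)) / \<i> * of_real (2 * pi * a)))"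
    by (simp only: log_arg_def)
  also have "- (cis (real (2 * l + 1) * pi / (2 * real k)) / \<i> * of_real (2 * pi * a)) = 2 * of_real pi * \<i> * pt m l"
    by (simp add: pt_def a_def[symmetric] complex_eq_iff)
  finally show ?thesis by (simp add: kern_def)
qed

end

text \<open>The summability clauses give the infinite sums of the identity their meaning, as
  \<open>suminf\<close> is a total function.\<close>

theorem theorem3p11:
  fixes k :: nat and x :: real
  assumes "k \<ge> 1" and "odd k" and "x > 0"
  shows "summable (\<lambda>n. D k (-1) (Suc n) * exp (- (real (Suc n) * x)))
    \<and> (\<forall>j\<in>{j :: int. - (int k - 1) \<le> j \<and> j \<le> int k - 1 \<and> [j = int k - 1] (mod 2)}.
          summable (\<lambda>m. ln (log_arg k x j (Suc m))))
    \<and> complex_of_real (\<Sum>n. D k (-1) (Suc n) * exp (- (real (Suc n) * x))) =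
        1 / 2 * ln (complex_of_real (x / (2 * pi) ^ k))
        + 1 / of_nat k * Gamma (1 / of_nat k) * zeta (1 + 1 / of_nat k)
            * of_real (x powr (- (1 / real k)))
        + zeta (- of_nat k) * of_real x / 2
        - (\<Sum>j | - (int k - 1) \<le> j \<and> j \<le> int k - 1 \<and> [j = int k - 1] (mod 2).
             \<Sum>m. ln (log_arg k x j (Suc m)))"
proof -
  interpret lambert k x using assms by unfold_locales
  define Z where "Z = (\<Sum>j. 1 / (2 * pi * real (Suc j)) ^ Suc k)"
  define A where "A = (\<Sum>n. real (Suc n) powr (- (1 + 1 / real k)))"
  define T where "T = (\<Sum>l<k. \<Sum>m. kern 1 (pt m l))"
  define S where "S = 1 / real k * Gamma (1 / real k) * x powr (- (1 / real k)) * A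
      + ln x / 2 - real k / 2 * ln (2 * pi) - x * ((-1) ^ (k div 2) * fact k * Z) - Re T"
  have D: "(\<lambda>n. D k (-1) (Suc n) * exp (- (real (Suc n) * x))) sums S"
    by (rule D_series_sums) (unfold S_def Z_def A_def T_def, rule f_sums)
  have summ: "summable (\<lambda>m. ln (log_arg k x j (Suc m)))" if "j \<in> jset" for j
  proof -
    have "j \<in> (\<lambda>l. 2 * int l - (int k - 1)) ` {..<k}"
      using that by (simp only: bij_betw_imp_surj_on[OF jset_bij])
    then obtain l where l: "l < k" "j = 2 * int l - (int k - 1)" by auto
    show ?thesis unfolding l(2) log_arg_eq by (rule summable_norm_cancel[OF kern_pt_limit(1)[OF l(1)]])
  qed
  have "(\<Sum>j\<in>jset. \<Sum>m. ln (log_arg k x j (Suc m))) = T"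
    unfolding T_def sum.reindex_bij_betw[OF jset_bij, symmetric] log_arg_eq ..
  \<comment> \<open>A single j may contribute a non-real number; the whole sum is real as a limit of
    the real residue sums.\<close>
  moreover have "T = of_real (Re T)" using sum_kern_real unfolding T_def by (simp add: complex_eq_iff)
  ultimately have T: "(\<Sum>j\<in>jset. \<Sum>m. ln (log_arg k x j (Suc m))) = of_real (Re T)" by simp
  have zeta1: "zeta (1 + 1 / of_nat k) = of_real A"
  proof -
    have "summable (\<lambda>n. real (Suc n) powr (- (1 + 1 / real k)))"
      using k_pos by (subst summable_Suc_iff[of "\<lambda>n. real n powr (- (1 + 1 / real k))"]) (subst summable_real_powr_iff, simp)
    hence "(\<lambda>n. complex_of_real (real (Suc n) powr (- (1 + 1 / real k)))) sums of_real A"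
      unfolding A_def by (simp only: sums_of_real_iff summable_sums)
    also have "(\<lambda>n. complex_of_real (real (Suc n) powr (- (1 + 1 / real k)))) = (\<lambda>n. of_nat (Suc n) powr (- (1 + 1 / of_nat k)))"
      by (rule ext) (simp add: powr_Reals_eq)
    finally have "(\<lambda>n. of_nat (Suc n) powr (- (1 + 1 / of_nat k))) sums complex_of_real A" .
    moreover have "Re (1 + 1 / of_nat k) > 1" using k_pos by (simp add: Re_divide_of_nat)
    ultimately show ?thesis using zeta_sums sums_unique2 by blast
  qed
  have gam: "Gamma (1 / of_nat k) = complex_of_real (Gamma (1 / real k))"
    by (simp flip: Gamma_complex_of_real)
  have lnx: "ln (complex_of_real (x / (2 * pi) ^ k)) = of_real (ln x - real k * ln (2 * pi))"
  proof -
    have "ln ((2 * pi) ^ k) = real k * ln (2 * pi)" by (rule ln_realpow)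
    hence "ln (x / (2 * pi) ^ k) = ln x - real k * ln (2 * pi)" using assms by (subst ln_div) auto
    thus ?thesis using assms by (subst Ln_of_real) auto
  qed
  have "complex_of_real S = 1 / 2 * ln (complex_of_real (x / (2 * pi) ^ k))
        + 1 / of_nat k * Gamma (1 / of_nat k) * zeta (1 + 1 / of_nat k)
            * of_real (x powr (- (1 / real k)))
        + zeta (- of_nat k) * of_real x / 2 - of_real (Re T)"
    unfolding lnx gam zeta1 zeta_minus_odd[OF assms(2)] Z_def[symmetric] S_def
    by (simp add: algebra_simps diff_divide_distrib)
  thus ?thesis using D summ unfolding T[symmetric] jset_def by (simp add: sums_iff)
qed

end
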